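(* Let $(R,\mathfrak m)$ be a Noetherian local ring. Let $S$ be a (commutative) $R$-algebra with $\mathfrak mS$ contained in the Jacobson radical of $S$. (1) $\mathrm{cl}_S$ is a Nakayama closure on finitely generated $R$-modules. (2) If $S$ is local and $N$ is a finitely generated $S$-module, then $\mathrm{cl}_N$ is a Nakayama closure on finitely generated $R$-modules. (3) In particular, Frobenius closure (in characteristic $p>0$) and plus closure (when $R$ is complete) are Nakayama closures. (4) If $B$ is a local big Cohen-Macaulay $R$-algebra and $R\to B$ is a local homomorphism, then $\mathrm{cl}_B$ is a Nakayama closure.
   Context: A closure operation $\mathrm{cl}$ on finitely generated $R$-modules assigns to each pair $L\subseteq M$ a module $L\subseteq L^{\mathrm{cl}}_M\subseteq M$, idempotent ($(L^{\mathrm{cl}}_M)^{\mathrm{cl}}_M=L^{\mathrm{cl}}_M$) and order-preserving ($L\subseteq N\subseteq M$ implies $L^{\mathrm{cl}}_M\subseteq N^{\mathrm{cl}}_M$). It is a Nakayama closure if whenever $L\subseteq N\subseteq M$ are finitely generated $R$-modules with $N\subseteq(L+\mathfrak mN)^{\mathrm{cl}}_M$, then $L^{\mathrm{cl}}_M=N^{\mathrm{cl}}_M$. For an $R$-module $N$, the module closure $\mathrm{cl}_N$ is defined by: $z\in L^{\mathrm{cl}_N}_M$ iff for every $n\in N$ the element $n\otimes z\in N\otimes_RM$ lies in the image of $N\otimes_RL\to N\otimes_RM$. For an $R$-algebra $S$, this says $1\otimes z\in\operatorname{im}(S\otimes_RL\to S\otimes_RM)$. Frobenius closure is $\mathrm{cl}_{R^{1/p^\infty}}$,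 where $R^{1/p^\infty}$ is the perfect closure of $R$ (the direct limit of $R\to R\to R\to\cdots$ under Frobenius). Plus closure is $\mathrm{cl}_{R^+}$, where $R^+$ is the absolute integral closure of $R$: if $R$ is a domain, $R^+$ is the integral closure of $R$ in an algebraic closure of its fraction field; in general, $R^+$ is the product of the rings $(R/P)^+$ over the minimal primes $P$ of $R$. "Local" rings, when not said to be Noetherian, need not be Noetherian. A big Cohen-Macaulay $R$-algebra is an $R$-algebra $B$ with $\mathfrak mB\neq B$ such that every system of parameters of $R$ is a regular sequence on $B$. *)

theory Defs
  imports "HOL-Algebra.Algebra" "HOL-Library.Extended_Nat"
begin

section \<open>Local rings and modules\<close>

definition local_ring :: "('a, 'z) ring_scheme \<Rightarrow> 'a set \<Rightarrow> bool"
  where "local_ring R m \<longleftrightarrow> cring R \<and> {I. maximalideal I R} = {m}"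

definition jacobson_radical :: "('a, 'z) ring_scheme \<Rightarrow> 'a set"
  where "jacobson_radical R = {x \<in> carrier R. \<forall>I. maximalideal I R \<longrightarrow> x \<in> I}"

definition module_span :: "('a, 'z) ring_scheme \<Rightarrow> ('a, 'm, 'y) module_scheme \<Rightarrow> 'm set \<Rightarrow> 'm set"
  where "module_span R M A = \<Inter>{N. submodule N R M \<and> A \<subseteq> N}"

definition fg_submodule :: "('a, 'z) ring_scheme \<Rightarrow> ('a, 'm, 'y) module_scheme \<Rightarrow> 'm set \<Rightarrow> bool"
  where "fg_submodule R M N \<longleftrightarrow>
    submodule N R M \<and> (\<exists>A. finite A \<and> A \<subseteq> N \<and> module_span R M A = N)"

definition fg_module :: "('a, 'z) ring_scheme \<Rightarrow> ('a, 'm, 'y) module_scheme \<Rightarrow> bool"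
  where "fg_module R M \<longleftrightarrow> module R M \<and> fg_submodule R M (carrier M)"

text \<open>The product \<open>J N\<close> of a subset \<open>J\<close> of \<open>R\<close> and a submodule \<open>N\<close> of \<open>M\<close>. For an
  \<open>R\<close>-algebra \<open>S\<close>, \<open>set_smult R S J (carrier S)\<close> is the extended ideal \<open>J S\<close>.\<close>

definition set_smult ::
    "('a, 'z) ring_scheme \<Rightarrow> ('a, 'm, 'y) module_scheme \<Rightarrow> 'a set \<Rightarrow> 'm set \<Rightarrow> 'm set"
  where "set_smult R M J N = module_span R M {a \<odot>\<^bsub>M\<^esub> x | a x. a \<in> J \<and> x \<in> N}"

text \<open>A commutative \<open>R\<close>-algebra is a record \<open>S\<close> with \<^locale>\<open>algebra\<close> \<open>R S\<close>; its structure map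
  is \<open>r \<mapsto> r \<odot> \<one>\<close>, and \<open>S\<close> is at the same time an \<open>R\<close>-module and a ring.\<close>

definition restrict_scalars :: "('a, 's) module \<Rightarrow> ('s, 'n) module \<Rightarrow> ('a, 'n) module"
  where "restrict_scalars S N =
    \<lparr>carrier = carrier N, monoid.mult = monoid.mult N, one = one N,
     ring.zero = ring.zero N, add = add N,
     smult = (\<lambda>r x. (r \<odot>\<^bsub>S\<^esub> \<one>\<^bsub>S\<^esub>) \<odot>\<^bsub>N\<^esub> x)\<rparr>"


section \<open>Closure operations on finitely generated modules\<close>

type_synonym ('a, 'm) closure_op = "('a, 'm) module \<Rightarrow> 'm set \<Rightarrow> 'm set"

definition closure_operation :: "('a, 'z) ring_scheme \<Rightarrow> ('a, 'm) closure_op \<Rightarrow> bool"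
  where "closure_operation R cl \<longleftrightarrow>
    (\<forall>M. fg_module R M \<longrightarrow>
      (\<forall>L. submodule L R M \<longrightarrow>
         submodule (cl M L) R M \<and> L \<subseteq> cl M L \<and> cl M (cl M L) = cl M L) \<and>
      (\<forall>L N. submodule L R M \<longrightarrow> submodule N R M \<longrightarrow> L \<subseteq> N \<longrightarrow> cl M L \<subseteq> cl M N))"

definition nakayama_closure ::
    "('a, 'z) ring_scheme \<Rightarrow> 'a set \<Rightarrow> ('a, 'm) closure_op \<Rightarrow> bool"
  where "nakayama_closure R m cl \<longleftrightarrow> closure_operation R cl \<and>
    (\<forall>M L N. fg_module R M \<longrightarrow> fg_submodule R M L \<longrightarrow> fg_submodule R M N \<longrightarrow> L \<subseteq> N \<longrightarrow>
       N \<subseteq> cl M (L <+>\<^bsub>M\<^esub> set_smult R M m N) \<longrightarrow> cl M L = cl M N)"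


section \<open>Tensor products and module closures\<close>

text \<open>\<open>N \<otimes>\<^sub>R M\<close> is the free abelian group on \<open>N \<times> M\<close> modulo the bilinearity and balancing
  relations. Only its group structure is needed, since the image of \<open>N \<otimes> L \<rightarrow> N \<otimes> M\<close> does not
  depend on the action of \<open>R\<close>.\<close>

definition tensor_relations ::
    "('a, 'z) ring_scheme \<Rightarrow> ('a, 'n) module \<Rightarrow> ('a, 'm) module \<Rightarrow> (('n \<times> 'm) \<Rightarrow>\<^sub>0 int) set"
  where "tensor_relations R N M =
    generate (free_Abelian_group (carrier N \<times> carrier M))
     ({frag_of (x \<oplus>\<^bsub>N\<^esub> x', y) - frag_of (x, y) - frag_of (x', y) | x x' y.
          x \<in> carrier N \<and> x' \<in> carrier N \<and> y \<in> carrier M} \<union>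
      {frag_of (x, y \<oplus>\<^bsub>M\<^esub> y') - frag_of (x, y) - frag_of (x, y') | x y y'.
          x \<in> carrier N \<and> y \<in> carrier M \<and> y' \<in> carrier M} \<union>
      {frag_of (r \<odot>\<^bsub>N\<^esub> x, y) - frag_of (x, r \<odot>\<^bsub>M\<^esub> y) | r x y.
          r \<in> carrier R \<and> x \<in> carrier N \<and> y \<in> carrier M})"

definition tensor_product ::
    "('a, 'z) ring_scheme \<Rightarrow> ('a, 'n) module \<Rightarrow> ('a, 'm) module \<Rightarrow> (('n \<times> 'm) \<Rightarrow>\<^sub>0 int) set monoid"
  where "tensor_product R N M =
    free_Abelian_group (carrier N \<times> carrier M) Mod tensor_relations R N M"

definition tensor_class ::
    "('a, 'z) ring_scheme \<Rightarrow> ('a, 'n) module \<Rightarrow> ('a, 'm) module \<Rightarrow>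
     (('n \<times> 'm) \<Rightarrow>\<^sub>0 int) \<Rightarrow> (('n \<times> 'm) \<Rightarrow>\<^sub>0 int) set"
  where "tensor_class R N M c =
    tensor_relations R N M #>\<^bsub>free_Abelian_group (carrier N \<times> carrier M)\<^esub> c"

definition pure_tensor ::
    "('a, 'z) ring_scheme \<Rightarrow> ('a, 'n) module \<Rightarrow> ('a, 'm) module \<Rightarrow>
     'n \<Rightarrow> 'm \<Rightarrow> (('n \<times> 'm) \<Rightarrow>\<^sub>0 int) set"
  where "pure_tensor R N M x y = tensor_class R N M (frag_of (x, y))"

text \<open>The map \<open>id \<otimes> f : N \<otimes> L \<rightarrow> N \<otimes> M\<close> induced by an \<open>R\<close>-linear \<open>f : L \<rightarrow> M\<close>; the union is
  over the representatives of a coset, all of which give the same class.\<close>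

definition tensor_map ::
    "('a, 'z) ring_scheme \<Rightarrow> ('a, 'n) module \<Rightarrow> ('a, 'm) module \<Rightarrow> ('l \<Rightarrow> 'm) \<Rightarrow>
     (('n \<times> 'l) \<Rightarrow>\<^sub>0 int) set \<Rightarrow> (('n \<times> 'm) \<Rightarrow>\<^sub>0 int) set"
  where "tensor_map R N M f C =
    (\<Union>c\<in>C. tensor_class R N M (frag_extend (\<lambda>(x, y). frag_of (x, f y)) c))"

definition module_closure ::
    "('a, 'z) ring_scheme \<Rightarrow> ('a, 'n) module \<Rightarrow> ('a, 'm) closure_op"
  where "module_closure R N M L =
    {z \<in> carrier M. \<forall>n \<in> carrier N.
       pure_tensor R N M n z \<in>
         tensor_map R N M (\<lambda>l. l) ` carrier (tensor_product R N (M\<lparr>carrier := L\<rparr>))}"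


section \<open>Frobenius closure\<close>

definition has_characteristic :: "('a, 'z) ring_scheme \<Rightarrow> nat \<Rightarrow> bool"
  where "has_characteristic R p \<longleftrightarrow> (\<forall>n::nat. [n] \<cdot>\<^bsub>R\<^esub> \<one>\<^bsub>R\<^esub> = \<zero>\<^bsub>R\<^esub> \<longleftrightarrow> p dvd n)"

definition frobenius_map :: "('a, 'z) ring_scheme \<Rightarrow> nat \<Rightarrow> 'a \<Rightarrow> 'a"
  where "frobenius_map R p x = x [^]\<^bsub>R\<^esub> p"

text \<open>The direct limit of \<open>R \<rightarrow> R \<rightarrow> R \<rightarrow> \<dots>\<close> under the Frobenius map: \<open>(i, x)\<close> is the element \<open>x\<close>
  of the \<open>i\<close>-th copy of \<open>R\<close>, so that its class plays the role of the \<open>p^i\<close>-th root of \<open>x\<close>, and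
  two elements are identified when they agree in some later copy. The elements \<open>(i, x)\<close> and
  \<open>(j, y)\<close> are added and multiplied in the copy with index \<open>i + j\<close>.\<close>

definition perfect_rel :: "('a, 'z) ring_scheme \<Rightarrow> nat \<Rightarrow> ((nat \<times> 'a) \<times> (nat \<times> 'a)) set"
  where "perfect_rel R p =
    {((i, x), (j, y)) | i x j y. x \<in> carrier R \<and> y \<in> carrier R \<and>
       (\<exists>k \<ge> max i j. (frobenius_map R p ^^ (k - i)) x = (frobenius_map R p ^^ (k - j)) y)}"

definition perfect_class :: "('a, 'z) ring_scheme \<Rightarrow> nat \<Rightarrow> nat \<Rightarrow> 'a \<Rightarrow> (nat \<times> 'a) set"
  where "perfect_class R p i x = perfect_rel R p `` {(i, x)}"

definition perfect_op ::
    "('a, 'z) ring_scheme \<Rightarrow> nat \<Rightarrow> ('a \<Rightarrow> 'a \<Rightarrow> 'a) \<Rightarrow>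
     (nat \<times> 'a) set \<Rightarrow> (nat \<times> 'a) set \<Rightarrow> (nat \<times> 'a) set"
  where "perfect_op R p f C D =
    (\<Union>(i, x) \<in> C. \<Union>(j, y) \<in> D.
       perfect_class R p (i + j)
         (f ((frobenius_map R p ^^ j) x) ((frobenius_map R p ^^ i) y)))"

definition perfect_closure :: "('a, 'z) ring_scheme \<Rightarrow> nat \<Rightarrow> ('a, (nat \<times> 'a) set) module"
  where "perfect_closure R p =
    \<lparr>carrier = (UNIV \<times> carrier R) // perfect_rel R p,
     monoid.mult = perfect_op R p (monoid.mult R),
     one = perfect_class R p 0 \<one>\<^bsub>R\<^esub>,
     ring.zero = perfect_class R p 0 \<zero>\<^bsub>R\<^esub>,
     add = perfect_op R p (add R),
     smult = (\<lambda>r. perfect_op R p (monoid.mult R) (perfect_class R p 0 r))\<rparr>"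

definition frobenius_closure :: "('a, 'z) ring_scheme \<Rightarrow> nat \<Rightarrow> ('a, 'm) closure_op"
  where "frobenius_closure R p = module_closure R (perfect_closure R p)"


section \<open>Plus closure\<close>

fun ideal_power :: "('a, 'z) ring_scheme \<Rightarrow> 'a set \<Rightarrow> nat \<Rightarrow> 'a set"
  where
    "ideal_power R I 0 = carrier R"
  | "ideal_power R I (Suc n) = ideal_prod R (ideal_power R I n) I"

text \<open>Completeness in the \<open>m\<close>-adic topology includes being separated.\<close>

definition adic_complete :: "('a, 'z) ring_scheme \<Rightarrow> 'a set \<Rightarrow> bool"
  where "adic_complete R m \<longleftrightarrow>
    (\<Inter>k. ideal_power R m k) = {\<zero>\<^bsub>R\<^esub>} \<and>
    (\<forall>a::nat \<Rightarrow> 'a. range a \<subseteq> carrier R \<longrightarrow>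
       (\<forall>k. \<exists>n0. \<forall>i\<ge>n0. \<forall>j\<ge>n0. a i \<ominus>\<^bsub>R\<^esub> a j \<in> ideal_power R m k) \<longrightarrow>
       (\<exists>x \<in> carrier R. \<forall>k. \<exists>n0. \<forall>i\<ge>n0. a i \<ominus>\<^bsub>R\<^esub> x \<in> ideal_power R m k))"

definition minimal_primes :: "('a, 'z) ring_scheme \<Rightarrow> 'a set set"
  where "minimal_primes R =
    {P. primeideal P R \<and> (\<forall>Q. primeideal Q R \<longrightarrow> Q \<subseteq> P \<longrightarrow> Q = P)}"

text \<open>\<open>K\<close>, with the embedding \<open>\<iota>\<close> of the domain \<open>D\<close>, is an algebraic closure of the fraction
  field of \<open>D\<close>, the latter being realised as the set of quotients in \<open>K\<close>.\<close>

definition alg_closure_of_fractions ::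
    "('d, 'z) ring_scheme \<Rightarrow> 'k ring \<Rightarrow> ('d \<Rightarrow> 'k) \<Rightarrow> bool"
  where "alg_closure_of_fractions D K \<iota> \<longleftrightarrow>
    \<iota> \<in> ring_hom D K \<and> inj_on \<iota> (carrier D) \<and>
    algebraic_closure K
      {\<iota> a \<otimes>\<^bsub>K\<^esub> inv\<^bsub>K\<^esub> (\<iota> b) | a b. a \<in> carrier D \<and> b \<in> carrier D \<and> b \<noteq> \<zero>\<^bsub>D\<^esub>}"

text \<open>Polynomials are lists of coefficients, leading coefficient first.\<close>

definition integral_closure_in :: "'k ring \<Rightarrow> 'k set \<Rightarrow> 'k set"
  where "integral_closure_in K A =
    {x \<in> carrier K. \<exists>f. f \<noteq> [] \<and> polynomial\<^bsub>K\<^esub> A f \<and> lead_coeff f = \<one>\<^bsub>K\<^esub> \<and>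
       ring.eval K f x = \<zero>\<^bsub>K\<^esub>}"

text \<open>The product of the rings \<open>(R/P)\<^sup>+\<close> over the minimal primes \<open>P\<close>, where \<open>K P\<close> and
  \<open>\<iota> P : R/P \<rightarrow> K P\<close> are the chosen algebraic closures of the fraction fields. As these are unique
  only up to isomorphism, they are parameters.\<close>

definition absolute_integral_closure ::
    "('a, 'z) ring_scheme \<Rightarrow> ('a set \<Rightarrow> 'k ring) \<Rightarrow> ('a set \<Rightarrow> 'a set \<Rightarrow> 'k) \<Rightarrow>
     ('a, 'a set \<Rightarrow> 'k) module"
  where "absolute_integral_closure R K \<iota> =
    \<lparr>carrier = (\<Pi>\<^sub>E P \<in> minimal_primes R.
                  integral_closure_in (K P) (\<iota> P ` carrier (R Quot P))),
     monoid.mult = (\<lambda>f g. \<lambda>P\<in>minimal_primes R. f P \<otimes>\<^bsub>K P\<^esub> g P),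
     one = (\<lambda>P\<in>minimal_primes R. \<one>\<^bsub>K P\<^esub>),
     ring.zero = (\<lambda>P\<in>minimal_primes R. \<zero>\<^bsub>K P\<^esub>),
     add = (\<lambda>f g. \<lambda>P\<in>minimal_primes R. f P \<oplus>\<^bsub>K P\<^esub> g P),
     smult = (\<lambda>r f. \<lambda>P\<in>minimal_primes R. \<iota> P (P +>\<^bsub>R\<^esub> r) \<otimes>\<^bsub>K P\<^esub> f P)\<rparr>"

definition plus_closure ::
    "('a, 'z) ring_scheme \<Rightarrow> ('a set \<Rightarrow> 'k ring) \<Rightarrow> ('a set \<Rightarrow> 'a set \<Rightarrow> 'k) \<Rightarrow>
     ('a, 'm) closure_op"
  where "plus_closure R K \<iota> = module_closure R (absolute_integral_closure R K \<iota>)"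


section \<open>Big Cohen-Macaulay algebras\<close>

definition krull_dim :: "('a, 'z) ring_scheme \<Rightarrow> enat"
  where "krull_dim R =
    Sup {enat n | n. \<exists>P::nat \<Rightarrow> 'a set.
           (\<forall>i\<le>n. primeideal (P i) R) \<and> (\<forall>i<n. P i \<subset> P (Suc i))}"

definition system_of_parameters :: "('a, 'z) ring_scheme \<Rightarrow> 'a set \<Rightarrow> 'a list \<Rightarrow> bool"
  where "system_of_parameters R m xs \<longleftrightarrow>
    set xs \<subseteq> m \<and> enat (length xs) = krull_dim R \<and>
    {r \<in> carrier R. \<exists>n::nat. r [^]\<^bsub>R\<^esub> n \<in> Idl\<^bsub>R\<^esub> (set xs)} = m"

definition regular_sequence :: "('a, 'z) ring_scheme \<Rightarrow> ('a, 'm) module \<Rightarrow> 'a list \<Rightarrow> bool"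
  where "regular_sequence R M xs \<longleftrightarrow>
    set xs \<subseteq> carrier R \<and>
    (\<forall>i < length xs. \<forall>b \<in> carrier M.
       xs ! i \<odot>\<^bsub>M\<^esub> b \<in> set_smult R M (set (take i xs)) (carrier M) \<longrightarrow>
       b \<in> set_smult R M (set (take i xs)) (carrier M)) \<and>
    set_smult R M (set xs) (carrier M) \<noteq> carrier M"

definition big_CM_algebra :: "('a, 'z) ring_scheme \<Rightarrow> 'a set \<Rightarrow> ('a, 'b) module \<Rightarrow> bool"
  where "big_CM_algebra R m B \<longleftrightarrow>
    algebra R B \<and> set_smult R B m (carrier B) \<noteq> carrier B \<and>
    (\<forall>xs. system_of_parameters R m xs \<longrightarrow> regular_sequence R B xs)"

end

theory Submission
  imports Defs
begin

text \<open>For a fixed \<open>R\<close>-module \<open>N\<close> and a submodule \<open>L\<close> of \<open>M\<close>, let \<open>tensor_span L\<close> be the preimage of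
  the image of \<open>N \<otimes> L \<rightarrow> N \<otimes> M\<close> in the free abelian group on \<open>N \<times> M\<close>, and let \<open>slice U\<close> be the set
  of those \<open>y\<close> with \<open>(x, y) \<in> U\<close> for all \<open>x \<in> N\<close>. The two maps form a Galois connection, and the
  module closure of \<open>L\<close> is \<open>slice (tensor_span L)\<close>. If \<open>N\<close> is finitely generated over an \<open>R\<close>-algebra \<open>S\<close>
  with \<open>m S\<close> in the Jacobson radical, then the image of \<open>N \<otimes> L'\<close> is a finitely generated \<open>S\<close>-module
  for finitely generated \<open>L'\<close>, and Nakayama's lemma over \<open>S\<close> gives the Nakayama property of the closure.

  In the perfect closure, the classes of elements of \<open>m\<close> form an ideal consisting of elements \<open>a\<close> with
  \<open>1 - a\<close> a unit. For \<open>(R/P)\<^sup>+\<close> the elements \<open>1 - r t\<close> with \<open>r \<in> m\<close> are units because \<open>t\<close> satisfies a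
  monic equation over \<open>R\<close>.\<close>

section \<open>Spans\<close>

text \<open>All work is therefore done in the free abelian group on N \<times> M, with subgroups
  that contain the relations standing for subgroups of N \<otimes> M. S acts by scaling the first
  entry of each generator, which is additive in the scalar only up to relations, so the resulting
  error terms have to be absorbed again and again. Nakayama's lemma is proved by discarding
  generators one at a time. Each round inverts a single element 1 - a, with no determinant involved,
  and so it works for any ideal J all of whose elements a have 1 - a invertible. The hypothesis on
  N' enters as follows: the image of N \<otimes> N' lies in that of N \<otimes> (L + m N'), and a
  factor from m passes across the tensor sign to become a scalar in J. For plus closure the
  difficulty is twofold: integral elements must be shown to form a ring, and the inverse of 1 - r t
  must again be integral. Both are treated over R itself, along R -> R/P -> K, and not over the
  quotient R/P.\<close>

context module
begin

lemma submodule_Inter: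
  assumes "\<And>N. N \<in> F \<Longrightarrow> submodule N R M" "F \<noteq> {}"
  shows "submodule (\<Inter>F) R M"
proof (rule submoduleI)
  show "\<Inter>F \<subseteq> carrier M"
    using assms submoduleE(1) by blast
  show "\<zero>\<^bsub>M\<^esub> \<in> \<Inter>F"
    using assms(1) by (auto intro: subgroup.one_closed[OF submodule.axioms(1), simplified])
qed (use assms(1) in \<open>auto intro: submoduleE\<close>)

lemma span_submodule: "A \<subseteq> carrier M \<Longrightarrow> submodule (module_span R M A) R M"
  unfolding module_span_def by (rule submodule_Inter) (use carrier_is_submodule in auto)

lemma span_superset: "A \<subseteq> module_span R M A"
  unfolding module_span_def by auto

lemma span_minimal: "submodule N R M \<Longrightarrow> A \<subseteq> N \<Longrightarrow> module_span R M A \<subseteq> N"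
  unfolding module_span_def by auto

lemma span_closed: "A \<subseteq> carrier M \<Longrightarrow> module_span R M A \<subseteq> carrier M"
  by (rule span_minimal[OF carrier_is_submodule])

lemma submodule_zero: "submodule H R M \<Longrightarrow> \<zero>\<^bsub>M\<^esub> \<in> H"
  using subgroup.one_closed[OF submodule.axioms(1)] by fastforce

lemma fg_submodule_spanI:
  assumes "finite A" "A \<subseteq> carrier M"
  shows "fg_submodule R M (module_span R M A)"
  using assms span_submodule span_superset unfolding fg_submodule_def by blast

lemma mem_set_add_iff: "a \<in> H <+>\<^bsub>M\<^esub> K \<longleftrightarrow> (\<exists>h\<in>H. \<exists>k\<in>K. a = h \<oplus>\<^bsub>M\<^esub> k)"
  unfolding set_add_def' by simp

lemma submodule_set_add:
  assumes H: "submodule H R M" and K: "submodule K R M"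
  shows "submodule (H <+>\<^bsub>M\<^esub> K) R M"
proof (rule submoduleI)
  note h = submoduleE[OF H] and k = submoduleE[OF K]
  have c: "a \<in> carrier M" if "a \<in> H \<or> a \<in> K" for a
    using that h(1) k(1) by blast
  show "H <+>\<^bsub>M\<^esub> K \<subseteq> carrier M"
    using c by (auto simp: mem_set_add_iff)
  show "\<zero>\<^bsub>M\<^esub> \<in> H <+>\<^bsub>M\<^esub> K"
    unfolding mem_set_add_iff using submodule_zero[OF H] submodule_zero[OF K]
    by (intro bexI) simp_all
  show "\<ominus>\<^bsub>M\<^esub> a \<in> H <+>\<^bsub>M\<^esub> K" if "a \<in> H <+>\<^bsub>M\<^esub> K" for a
    using that h(3) k(3) by (force simp: mem_set_add_iff c M.minus_add)
  show "r \<odot>\<^bsub>M\<^esub> a \<in> H <+>\<^bsub>M\<^esub> K" if "r \<in> carrier R" "a \<in> H <+>\<^bsub>M\<^esub> K" for r a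
    using that h(4) k(4) by (force simp: mem_set_add_iff c smult_r_distr)
  fix a b assume "a \<in> H <+>\<^bsub>M\<^esub> K" "b \<in> H <+>\<^bsub>M\<^esub> K"
  then obtain x y x' y' where e: "x \<in> H" "y \<in> K" "a = x \<oplus>\<^bsub>M\<^esub> y" "x' \<in> H" "y' \<in> K" "b = x' \<oplus>\<^bsub>M\<^esub> y'"
    unfolding mem_set_add_iff by blast
  then have "a \<oplus>\<^bsub>M\<^esub> b = (x \<oplus>\<^bsub>M\<^esub> x') \<oplus>\<^bsub>M\<^esub> (y \<oplus>\<^bsub>M\<^esub> y')"
    using c by (simp add: M.a_ac)
  then show "a \<oplus>\<^bsub>M\<^esub> b \<in> H <+>\<^bsub>M\<^esub> K"
    unfolding mem_set_add_iff using h(5)[OF e(1,4)] k(5)[OF e(2,5)] by blast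
qed

lemma set_smult_submodule:
  assumes "J \<subseteq> carrier R" "N \<subseteq> carrier M"
  shows "submodule (set_smult R M J N) R M"
  unfolding set_smult_def using assms by (intro span_submodule) auto

end

section \<open>Subgroups of the free abelian group containing the tensor relations\<close>

lemma subgroup_free_Abelian_groupD:
  assumes "subgroup U (free_Abelian_group A)"
  shows "x \<in> U \<Longrightarrow> Poly_Mapping.keys x \<subseteq> A" and "0 \<in> U"
    and "x \<in> U \<Longrightarrow> y \<in> U \<Longrightarrow> x + y \<in> U" and "x \<in> U \<Longrightarrow> - x \<in> U"
    and "x \<in> U \<Longrightarrow> y \<in> U \<Longrightarrow> x - y \<in> U"
proof -
  show k: "x \<in> U \<Longrightarrow> Poly_Mapping.keys x \<subseteq> A" for x
    using subgroup.mem_carrier[OF assms] by fastforce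
  show "0 \<in> U"
    using subgroup.one_closed[OF assms] by simp
  show p: "x \<in> U \<Longrightarrow> y \<in> U \<Longrightarrow> x + y \<in> U" for x y
    using subgroup.m_closed[OF assms] by simp
  show m: "x \<in> U \<Longrightarrow> - x \<in> U" for x
    using subgroup.m_inv_closed[OF assms, of x] k[of x] by simp
  show "x \<in> U \<Longrightarrow> y \<in> U \<Longrightarrow> x - y \<in> U"
    using p[of x "- y"] m[of y] by simp
qed

lemma subgroup_free_Abelian_groupI:
  assumes "\<And>x. x \<in> U \<Longrightarrow> Poly_Mapping.keys x \<subseteq> A" and "0 \<in> U"
    and "\<And>x y. x \<in> U \<Longrightarrow> y \<in> U \<Longrightarrow> x - y \<in> U"
  shows "subgroup U (free_Abelian_group A)"
proof (rule subgroup.intro)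
  have m: "- x \<in> U" if "x \<in> U" for x
    using assms(3)[OF assms(2) that] by simp
  show "x \<otimes>\<^bsub>free_Abelian_group A\<^esub> y \<in> U" if "x \<in> U" "y \<in> U" for x y
    using assms(3)[OF that(1) m[OF that(2)]] by simp
  show "inv\<^bsub>free_Abelian_group A\<^esub> x \<in> U" if "x \<in> U" for x
    using m[OF that] assms(1)[OF that] by simp
qed (use assms in \<open>auto simp: subset_iff\<close>)

locale module_pair = N: module R N + M: module R M
  for R :: "('a, 'z) ring_scheme" (structure)
    and N :: "('a, 'n) module" and M :: "('a, 'm) module"
begin

abbreviation free_group :: "('n \<times> 'm \<Rightarrow>\<^sub>0 int) monoid"
  where "free_group \<equiv> free_Abelian_group (carrier N \<times> carrier M)"

abbreviation relations :: "('n \<times> 'm \<Rightarrow>\<^sub>0 int) set"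
  where "relations \<equiv> tensor_relations R N M"

text \<open>By the correspondence theorem these are the subgroups of N \<otimes> M, pulled back to
  the free group.\<close>

definition tensor_subgroup :: "('n \<times> 'm \<Rightarrow>\<^sub>0 int) set \<Rightarrow> bool"
  where "tensor_subgroup U \<longleftrightarrow> subgroup U free_group \<and> relations \<subseteq> U"

definition slice :: "('n \<times> 'm \<Rightarrow>\<^sub>0 int) set \<Rightarrow> 'm set"
  where "slice U = {y \<in> carrier M. \<forall>x \<in> carrier N. frag_of (x, y) \<in> U}"

definition tensor_span :: "'m set \<Rightarrow> ('n \<times> 'm \<Rightarrow>\<^sub>0 int) set"
  where "tensor_span L = generate free_group (relations \<union> frag_of ` (carrier N \<times> L))"

lemma keys_frag_diff:
  "a \<in> A \<Longrightarrow> b \<in> A \<Longrightarrow> Poly_Mapping.keys (frag_of a - frag_of b) \<subseteq> A"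
  "a \<in> A \<Longrightarrow> b \<in> A \<Longrightarrow> c \<in> A \<Longrightarrow> Poly_Mapping.keys (frag_of a - frag_of b - frag_of c) \<subseteq> A"
proof -
  show *: "a \<in> A \<Longrightarrow> b \<in> A \<Longrightarrow> Poly_Mapping.keys (frag_of a - frag_of b) \<subseteq> A"
    using keys_diff[of "frag_of a" "frag_of b"] by auto
  show "a \<in> A \<Longrightarrow> b \<in> A \<Longrightarrow> c \<in> A \<Longrightarrow> Poly_Mapping.keys (frag_of a - frag_of b - frag_of c) \<subseteq> A"
    using keys_diff[of "frag_of a - frag_of b" "frag_of c"] * by auto
qed

lemma subgroup_relations: "subgroup relations free_group"
  unfolding tensor_relations_def
  by (intro group.generate_is_subgroup group_free_Abelian_group Un_least subsetI;
      elim CollectE exE conjE; simp only: carrier_free_Abelian_group_iff; rule keys_frag_diff)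
    simp_all

lemmas relationsD = subgroup_free_Abelian_groupD[OF subgroup_relations]

lemma relation_add_left:
  "x \<in> carrier N \<Longrightarrow> x' \<in> carrier N \<Longrightarrow> y \<in> carrier M \<Longrightarrow>
    frag_of (x \<oplus>\<^bsub>N\<^esub> x', y) - frag_of (x, y) - frag_of (x', y) \<in> relations"
  unfolding tensor_relations_def by (rule generate.incl) blast

lemma relation_add_right:
  "x \<in> carrier N \<Longrightarrow> y \<in> carrier M \<Longrightarrow> y' \<in> carrier M \<Longrightarrow>
    frag_of (x, y \<oplus>\<^bsub>M\<^esub> y') - frag_of (x, y) - frag_of (x, y') \<in> relations"
  unfolding tensor_relations_def by (rule generate.incl) blast

lemma relation_smult:
  "r \<in> carrier R \<Longrightarrow> x \<in> carrier N \<Longrightarrow> y \<in> carrier M \<Longrightarrow>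
    frag_of (r \<odot>\<^bsub>N\<^esub> x, y) - frag_of (x, r \<odot>\<^bsub>M\<^esub> y) \<in> relations"
  unfolding tensor_relations_def by (rule generate.incl) blast

lemma relations_subset:
  assumes U: "subgroup U free_group"
    and "\<And>x x' y. x \<in> carrier N \<Longrightarrow> x' \<in> carrier N \<Longrightarrow> y \<in> carrier M \<Longrightarrow>
      frag_of (x \<oplus>\<^bsub>N\<^esub> x', y) - frag_of (x, y) - frag_of (x', y) \<in> U"
    and "\<And>x y y'. x \<in> carrier N \<Longrightarrow> y \<in> carrier M \<Longrightarrow> y' \<in> carrier M \<Longrightarrow>
      frag_of (x, y \<oplus>\<^bsub>M\<^esub> y') - frag_of (x, y) - frag_of (x, y') \<in> U"
    and "\<And>r x y. r \<in> carrier R \<Longrightarrow> x \<in> carrier N \<Longrightarrow> y \<in> carrier M \<Longrightarrow>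
      frag_of (r \<odot>\<^bsub>N\<^esub> x, y) - frag_of (x, r \<odot>\<^bsub>M\<^esub> y) \<in> U"
  shows "relations \<subseteq> U"
  unfolding tensor_relations_def
  by (rule group.generate_subgroup_incl[OF group_free_Abelian_group _ U])
    (use assms(2-4) in \<open>auto simp only: Un_subset_iff intro!: subsetI elim!: CollectE\<close>)

text \<open>Membership in such a U depends only on the class in N \<otimes> M, so every tensor
  relation can be used as an equation.\<close>

lemma tensor_subgroup_mod:
  assumes U: "tensor_subgroup U" and d: "a - b \<in> relations"
  shows "a \<in> U \<longleftrightarrow> b \<in> U"
proof -
  have "a - b \<in> U"
    using U d unfolding tensor_subgroup_def by blast
  moreover note D = subgroup_free_Abelian_groupD[OF conjunct1[OF U[unfolded tensor_subgroup_def]]]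
  ultimately show ?thesis
    using D(3)[of "a - b" b] D(5)[of a "a - b"] by auto
qed

lemma slice_submodule:
  assumes U: "tensor_subgroup U"
  shows "submodule (slice U) R M"
proof -
  note D = subgroup_free_Abelian_groupD[OF conjunct1[OF U[unfolded tensor_subgroup_def]]]
  have add: "frag_of (x, y \<oplus>\<^bsub>M\<^esub> y') \<in> U"
    if "x \<in> carrier N" "y \<in> slice U" "y' \<in> slice U" for x y y'
  proof -
    have "frag_of (x, y \<oplus>\<^bsub>M\<^esub> y') - (frag_of (x, y) + frag_of (x, y')) \<in> relations"
      using relation_add_right[of x y y'] that by (simp add: slice_def algebra_simps)
    then show ?thesis
      using tensor_subgroup_mod[OF U] D(3) that by (auto simp: slice_def)
  qed
  have smult: "frag_of (x, r \<odot>\<^bsub>M\<^esub> y) \<in> U"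
    if "x \<in> carrier N" "y \<in> slice U" "r \<in> carrier R" for x r y
    using tensor_subgroup_mod[OF U relation_smult[of r x y]] that by (auto simp: slice_def)
  have zero: "frag_of (x, \<zero>\<^bsub>M\<^esub>) \<in> U" if "x \<in> carrier N" for x
  proof -
    \<comment> \<open>The relation for 0 + 0 = 0 in the second entry has the form g - g - g, which
      is minus the wanted generator g.\<close>
    have "- frag_of (x, \<zero>\<^bsub>M\<^esub>) \<in> relations"
      using relation_add_right[of x "\<zero>\<^bsub>M\<^esub>" "\<zero>\<^bsub>M\<^esub>"] that by simp
    then show ?thesis
      using tensor_subgroup_mod[OF U, of 0 "frag_of (x, \<zero>\<^bsub>M\<^esub>)"] D(2) by simp
  qed
  show ?thesis
  proof (rule M.submoduleI)
    fix a assume a: "a \<in> slice U"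
    \<comment> \<open>Writing negation as multiplication by -1 reduces it to the scalar
      case.\<close>
    then have "\<ominus>\<^bsub>M\<^esub> a = (\<ominus> \<one>) \<odot>\<^bsub>M\<^esub> a"
      using M.smult_l_minus[of \<one> a] by (simp add: slice_def)
    then show "\<ominus>\<^bsub>M\<^esub> a \<in> slice U"
      using smult[OF _ a, of _ "\<ominus> \<one>"] a by (auto simp: slice_def)
  qed (use add smult zero in \<open>auto simp: slice_def\<close>)
qed

lemma slice_mono: "U \<subseteq> Y \<Longrightarrow> slice U \<subseteq> slice Y"
  unfolding slice_def by blast

lemma tensor_span_tensor_subgroup:
  assumes "L \<subseteq> carrier M"
  shows "tensor_subgroup (tensor_span L)"
proof -
  have "relations \<union> frag_of ` (carrier N \<times> L) \<subseteq> carrier free_group"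
    using assms relationsD(1) by fastforce
  then have "subgroup (tensor_span L) free_group"
    unfolding tensor_span_def by (intro group.generate_is_subgroup) simp_all
  then show ?thesis
    unfolding tensor_subgroup_def tensor_span_def by (auto intro: generate.incl)
qed

lemma tensor_span_subset_iff:
  assumes "L \<subseteq> carrier M" "tensor_subgroup U"
  shows "tensor_span L \<subseteq> U \<longleftrightarrow> L \<subseteq> slice U"
proof
  assume "tensor_span L \<subseteq> U"
  moreover have "frag_of (x, y) \<in> tensor_span L" if "x \<in> carrier N" "y \<in> L" for x y
    unfolding tensor_span_def by (rule generate.incl) (use that in blast)
  ultimately show "L \<subseteq> slice U"
    using assms(1) unfolding slice_def by blast
next
  assume "L \<subseteq> slice U"
  then show "tensor_span L \<subseteq> U"
    unfolding tensor_span_def using assms(2)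
    by (intro group.generate_subgroup_incl[OF group_free_Abelian_group])
      (auto simp: tensor_subgroup_def slice_def)
qed

lemma tensor_span_mono: "L \<subseteq> L' \<Longrightarrow> tensor_span L \<subseteq> tensor_span L'"
  unfolding tensor_span_def by (intro group.mono_generate) auto

text \<open>\<open>generate\<close> offers no explicit elements, whereas the image of N \<otimes> L
  consists of classes of formal sums supported on N \<times> L. This normal form is the bridge
  between the two descriptions.\<close>

lemma tensor_span_eq:
  assumes L: "L \<subseteq> carrier M"
  shows "tensor_span L = {r + c | r c. r \<in> relations \<and> Poly_Mapping.keys c \<subseteq> carrier N \<times> L}"
    (is "_ = ?U")
proof
  have "subgroup ?U free_group"
  proof (rule subgroup_free_Abelian_groupI)
    show "Poly_Mapping.keys x \<subseteq> carrier N \<times> carrier M" if x: "x \<in> ?U" for x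
    proof -
      obtain r c where "x = r + c" "r \<in> relations" "Poly_Mapping.keys c \<subseteq> carrier N \<times> L"
        using x by blast
      then show ?thesis
        using keys_add[of r c] relationsD(1)[of r] L by blast
    qed
    show "0 \<in> ?U"
      using relationsD(2) by (intro CollectI exI[of _ 0]) simp
    show "x - y \<in> ?U" if xy: "x \<in> ?U" "y \<in> ?U" for x y
    proof -
      obtain r c r' c' where e: "x = r + c" "r \<in> relations" "Poly_Mapping.keys c \<subseteq> carrier N \<times> L"
        "y = r' + c'" "r' \<in> relations" "Poly_Mapping.keys c' \<subseteq> carrier N \<times> L"
        using xy by blast
      then have "x - y = (r - r') + (c - c')" "r - r' \<in> relations"
        using relationsD(5) by simp_all
      moreover have "Poly_Mapping.keys (c - c') \<subseteq> carrier N \<times> L"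
        using keys_diff[of c c'] e by blast
      ultimately show ?thesis
        by blast
    qed
  qed
  moreover have "relations \<subseteq> ?U"
  proof
    fix r assume "r \<in> relations"
    then show "r \<in> ?U"
      by (intro CollectI exI[of _ r] exI[of _ 0]) simp
  qed
  moreover have "frag_of ` (carrier N \<times> L) \<subseteq> ?U"
  proof
    fix c assume "c \<in> frag_of ` (carrier N \<times> L)"
    then show "c \<in> ?U"
      using relationsD(2) by (intro CollectI exI[of _ 0] exI[of _ c]) auto
  qed
  ultimately show "tensor_span L \<subseteq> ?U"
    unfolding tensor_span_def by (intro group.generate_subgroup_incl[OF group_free_Abelian_group]) auto
  note U = tensor_span_tensor_subgroup[OF L]
  note D = subgroup_free_Abelian_groupD[OF conjunct1[OF U[unfolded tensor_subgroup_def]]]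
  have "c \<in> tensor_span L" if "Poly_Mapping.keys c \<subseteq> carrier N \<times> L" for c
    using that
  proof (induction c rule: frag_induction)
    case (one x)
    then show ?case
      unfolding tensor_span_def by (intro generate.incl) blast
  qed (use D in auto)
  then show "?U \<subseteq> tensor_span L"
    using U D(3) unfolding tensor_subgroup_def by blast
qed

section \<open>Cosets and the image of N \<otimes> L in N \<otimes> M\<close>

lemma tensor_class_eq: "tensor_class R N M c = (\<lambda>r. r + c) ` relations"
  unfolding tensor_class_def r_coset_def by auto

lemma tensor_class_eq_iff: "tensor_class R N M c = tensor_class R N M d \<longleftrightarrow> c - d \<in> relations"
proof
  assume "tensor_class R N M c = tensor_class R N M d"
  then have "c \<in> (\<lambda>r. r + d) ` relations"
    using relationsD(2) unfolding tensor_class_eq by force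
  then show "c - d \<in> relations"
    by auto
next
  assume d: "c - d \<in> relations"
  have "r + c \<in> (\<lambda>r. r + d) ` relations" if "r \<in> relations" for r
    using relationsD(3)[OF that d] by (intro image_eqI[of _ _ "r + (c - d)"]) auto
  moreover have "r + d \<in> (\<lambda>r. r + c) ` relations" if "r \<in> relations" for r
    using relationsD(5)[OF that d] by (intro image_eqI[of _ _ "r - (c - d)"]) auto
  ultimately show "tensor_class R N M c = tensor_class R N M d"
    unfolding tensor_class_eq by blast
qed

text \<open>The source N \<otimes> L has its own, possibly smaller, group of relations. Since these
  are relations of N \<otimes> M as well, all representatives of a coset have the same image, and
  the image is given by the formal sums supported on N \<times> L.\<close>

lemma tensor_map_inclusion_image:
  assumes L: "submodule L R M"
  shows "tensor_map R N M (\<lambda>l. l) ` carrier (tensor_product R N (M\<lparr>carrier := L\<rparr>)) =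
    tensor_class R N M ` {c. Poly_Mapping.keys c \<subseteq> carrier N \<times> L}"
proof -
  interpret L: module_pair R N "M\<lparr>carrier := L\<rparr>"
    using N.module_axioms submodule.submodule_is_module[OF L M.module_axioms]
    by (intro module_pair.intro)
  note l = M.submoduleE(1)[OF L]
  let ?F = "free_Abelian_group (carrier N \<times> L)"
  let ?G = "{c. Poly_Mapping.keys c \<subseteq> carrier N \<times> L}"
  have keys: "c - d \<in> ?G" if "c \<in> ?G" "d \<in> ?G" for c d
    using keys_diff[of c d] that by blast
  \<comment> \<open>The kernel of N \<otimes> L -> N \<otimes> M is the quotient of this
    intersection by \<open>L.relations\<close>. The map can fail to be injective, so only one
    inclusion is aimed at.\<close>
  have "subgroup (relations \<inter> ?G) L.free_group"
  proof (rule subgroup_free_Abelian_groupI)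
    show "x - y \<in> relations \<inter> ?G" if "x \<in> relations \<inter> ?G" "y \<in> relations \<inter> ?G" for x y
      using that keys relationsD(5) by blast
  qed (use relationsD(2) in auto)
  then have sub: "L.relations \<subseteq> relations \<inter> ?G"
  proof (rule L.relations_subset, unfold Int_iff mem_Collect_eq)
    have c: "y \<in> carrier M" if "y \<in> L" for y
      using that l by blast
    note simps = relation_add_left relation_add_right relation_smult M.submoduleE(4,5)[OF L] c
    show "frag_of (x \<oplus>\<^bsub>N\<^esub> x', y) - frag_of (x, y) - frag_of (x', y) \<in> relations \<and>
        Poly_Mapping.keys (frag_of (x \<oplus>\<^bsub>N\<^esub> x', y) - frag_of (x, y) - frag_of (x', y)) \<subseteq> carrier N \<times> L"
      if "x \<in> carrier N" "x' \<in> carrier N" "y \<in> carrier (M\<lparr>carrier := L\<rparr>)" for x x' y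
      using that by (intro conjI keys_frag_diff) (simp_all add: simps)
    show "frag_of (x, y \<oplus>\<^bsub>M\<lparr>carrier := L\<rparr>\<^esub> y') - frag_of (x, y) - frag_of (x, y') \<in> relations \<and>
        Poly_Mapping.keys (frag_of (x, y \<oplus>\<^bsub>M\<lparr>carrier := L\<rparr>\<^esub> y') - frag_of (x, y) - frag_of (x, y'))
          \<subseteq> carrier N \<times> L"
      if "x \<in> carrier N" "y \<in> carrier (M\<lparr>carrier := L\<rparr>)" "y' \<in> carrier (M\<lparr>carrier := L\<rparr>)" for x y y'
      using that by (intro conjI keys_frag_diff) (simp_all add: simps)
    show "frag_of (r \<odot>\<^bsub>N\<^esub> x, y) - frag_of (x, r \<odot>\<^bsub>M\<lparr>carrier := L\<rparr>\<^esub> y) \<in> relations \<and>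
        Poly_Mapping.keys (frag_of (r \<odot>\<^bsub>N\<^esub> x, y) - frag_of (x, r \<odot>\<^bsub>M\<lparr>carrier := L\<rparr>\<^esub> y))
          \<subseteq> carrier N \<times> L"
      if "r \<in> carrier R" "x \<in> carrier N" "y \<in> carrier (M\<lparr>carrier := L\<rparr>)" for r x y
      using that by (intro conjI keys_frag_diff) (simp_all add: simps)
  qed
  have coset: "L.relations #>\<^bsub>?F\<^esub> c = (\<lambda>r. r + c) ` L.relations" for c
    unfolding r_coset_def by auto
  have "tensor_map R N M (\<lambda>l. l) (L.relations #>\<^bsub>?F\<^esub> c) = tensor_class R N M c" for c
  proof -
    \<comment> \<open>The inclusion acts on formal sums as the identity, so the union runs over the
      classes of r + c with r a relation of N \<otimes> L, all of them equal.\<close>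
    have "tensor_map R N M (\<lambda>l. l) (L.relations #>\<^bsub>?F\<^esub> c) =
        (\<Union>r\<in>L.relations. tensor_class R N M (r + c))"
      unfolding tensor_map_def coset image_image case_prod_eta[of frag_of] frag_expansion[symmetric] by simp
    also have "tensor_class R N M (r + c) = tensor_class R N M c" if "r \<in> L.relations" for r
      using sub that by (auto simp: tensor_class_eq_iff)
    then have "(\<Union>r\<in>L.relations. tensor_class R N M (r + c)) = tensor_class R N M c"
      using L.relationsD(2) by auto
    finally show ?thesis .
  qed
  moreover have "carrier (tensor_product R N (M\<lparr>carrier := L\<rparr>)) =
      (\<lambda>c. L.relations #>\<^bsub>?F\<^esub> c) ` ?G"
    unfolding tensor_product_def FactGroup_def RCOSETS_def by auto
  ultimately show ?thesis
    by (simp add: image_image)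
qed

text \<open>From here on cosets and induced maps no longer appear; closures are handled through
  \<open>slice\<close> and \<open>tensor_span\<close> alone.\<close>

lemma module_closure_eq:
  assumes "submodule L R M"
  shows "module_closure R N M L = slice (tensor_span L)"
proof -
  have "pure_tensor R N M x z \<in> tensor_map R N M (\<lambda>l. l) ` carrier (tensor_product R N (M\<lparr>carrier := L\<rparr>))
      \<longleftrightarrow> frag_of (x, z) \<in> tensor_span L" for x z
  proof -
    have "(\<exists>r. frag_of (x, z) = r + c \<and> r \<in> relations) \<longleftrightarrow> frag_of (x, z) - c \<in> relations" for c
      by (metis add_diff_cancel_right' diff_add_cancel)
    then show ?thesis
      unfolding tensor_map_inclusion_image[OF assms] pure_tensor_def
        tensor_span_eq[OF M.submoduleE(1)[OF assms]] image_iff tensor_class_eq_iff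
      by blast
  qed
  then show ?thesis
    unfolding module_closure_def slice_def by simp
qed

text \<open>Formal for any Galois connection: the composite of the two adjoint maps is idempotent.
  The idempotence axiom of a closure operation is exactly this.\<close>

lemma slice_tensor_span_idem:
  assumes "L \<subseteq> carrier M"
  shows "slice (tensor_span (slice (tensor_span L))) = slice (tensor_span L)"
proof (rule antisym)
  note U = tensor_span_tensor_subgroup[OF assms]
  have s: "slice (tensor_span L) \<subseteq> carrier M"
    by (auto simp: slice_def)
  show "slice (tensor_span (slice (tensor_span L))) \<subseteq> slice (tensor_span L)"
    using tensor_span_subset_iff[OF s U] by (intro slice_mono) simp
  show "slice (tensor_span L) \<subseteq> slice (tensor_span (slice (tensor_span L)))"
    using tensor_span_subset_iff[OF s tensor_span_tensor_subgroup[OF s]] by simp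
qed

end

lemma module_closure_closure_operation:
  assumes "module R N"
  shows "closure_operation R (module_closure R N :: ('a, 'm) closure_op)"
  unfolding closure_operation_def
proof (intro allI impI)
  fix M :: "('a, 'm) module"
  assume "fg_module R M"
  then interpret module_pair R N M
    using assms by (simp add: module_pair_def fg_module_def)
  have 1: "submodule (module_closure R N M L) R M \<and> L \<subseteq> module_closure R N M L \<and>
      module_closure R N M (module_closure R N M L) = module_closure R N M L"
    if L: "submodule L R M" for L
  proof -
    note l = M.submoduleE(1)[OF L]
    note U = tensor_span_tensor_subgroup[OF l]
    have s: "submodule (slice (tensor_span L)) R M"
      by (rule slice_submodule[OF U])
    show ?thesis
      using s tensor_span_subset_iff[OF l U] slice_tensor_span_idem[OF l]
      by (simp add: module_closure_eq[OF L] module_closure_eq[OF s])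
  qed
  have 2: "module_closure R N M L \<subseteq> module_closure R N M L'"
    if "submodule L R M" "submodule L' R M" "L \<subseteq> L'" for L L'
    using that by (simp add: module_closure_eq slice_mono tensor_span_mono)
  show "(\<forall>L. submodule L R M \<longrightarrow>
         submodule (module_closure R N M L) R M \<and> L \<subseteq> module_closure R N M L \<and>
         module_closure R N M (module_closure R N M L) = module_closure R N M L) \<and>
      (\<forall>L L'. submodule L R M \<longrightarrow> submodule L' R M \<longrightarrow> L \<subseteq> L' \<longrightarrow>
         module_closure R N M L \<subseteq> module_closure R N M L')"
    using 1 2 by blast
qed

section \<open>Nakayama's lemma for images of tensor products\<close>

text \<open>\<open>T\<close> is the \<open>S\<close>-module whose restriction of scalars along \<open>\<phi>\<close> is \<open>N\<close>, and \<open>J\<close> plays the role of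
  the Jacobson radical of \<open>S\<close>.\<close>

locale algebra_module = N: module R N + T: module S T
  for R :: "('a, 'z) ring_scheme" and S :: "('s, 'y) ring_scheme"
    and N :: "('a, 'n) module" and T :: "('s, 'n, 'x) module_scheme" +
  fixes \<phi> :: "'a \<Rightarrow> 's" and J :: "'s set"
  assumes carrier_eq: "carrier T = carrier N" and add_eq: "add T = add N"
    and \<phi>_closed: "r \<in> carrier R \<Longrightarrow> \<phi> r \<in> carrier S"
    and \<phi>_smult: "r \<in> carrier R \<Longrightarrow> x \<in> carrier N \<Longrightarrow> \<phi> r \<odot>\<^bsub>T\<^esub> x = r \<odot>\<^bsub>N\<^esub> x"
    and fg: "fg_submodule S T (carrier T)"
    and ideal_J: "ideal J S"
    and unit_J: "a \<in> J \<Longrightarrow> \<one>\<^bsub>S\<^esub> \<ominus>\<^bsub>S\<^esub> a \<in> Units S"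

locale algebra_module_pair = algebra_module R S N T \<phi> J + M: module R M
  for R :: "('a, 'z) ring_scheme" and S :: "('s, 'y) ring_scheme"
    and N :: "('a, 'n) module" and T :: "('s, 'n, 'x) module_scheme"
    and \<phi> J and M :: "('a, 'm) module"
begin

sublocale module_pair R N M
  by unfold_locales

lemma smult_T_closed: "s \<in> carrier S \<Longrightarrow> x \<in> carrier N \<Longrightarrow> s \<odot>\<^bsub>T\<^esub> x \<in> carrier N"
  using T.smult_closed carrier_eq by simp

text \<open>On the free group, \<open>act\<close> is additive in the scalar only modulo the tensor relations.\<close>

definition act :: "'s \<Rightarrow> ('n \<times> 'm \<Rightarrow>\<^sub>0 int) \<Rightarrow> ('n \<times> 'm \<Rightarrow>\<^sub>0 int)"
  where "act s = frag_extend (\<lambda>(x, y). frag_of (s \<odot>\<^bsub>T\<^esub> x, y))"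

lemma act_simps [simp]:
  "act s 0 = 0" "act s (frag_of (x, y)) = frag_of (s \<odot>\<^bsub>T\<^esub> x, y)"
  "act s (c + d) = act s c + act s d" "act s (c - d) = act s c - act s d" "act s (- c) = - act s c"
  by (simp_all add: act_def frag_extend_add frag_extend_diff frag_extend_minus)

lemma keys_act:
  assumes "s \<in> carrier S" "Poly_Mapping.keys c \<subseteq> carrier N \<times> carrier M"
  shows "Poly_Mapping.keys (act s c) \<subseteq> carrier N \<times> carrier M"
  using assms(2)
proof (induction c rule: frag_induction)
  case (diff a b)
  then show ?case
    using keys_diff[of "act s a" "act s b"] by auto
qed (use assms(1) smult_T_closed in auto)

lemma subgroup_vimage_act:
  assumes s: "s \<in> carrier S" and U: "subgroup U free_group"
  shows "subgroup {c. Poly_Mapping.keys c \<subseteq> carrier N \<times> carrier M \<and> act s c \<in> U} free_group"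
proof (rule subgroup_free_Abelian_groupI)
  show "x - y \<in> {c. Poly_Mapping.keys c \<subseteq> carrier N \<times> carrier M \<and> act s c \<in> U}"
    if "x \<in> {c. Poly_Mapping.keys c \<subseteq> carrier N \<times> carrier M \<and> act s c \<in> U}"
      "y \<in> {c. Poly_Mapping.keys c \<subseteq> carrier N \<times> carrier M \<and> act s c \<in> U}" for x y
    using that keys_diff[of x y] subgroup_free_Abelian_groupD(5)[OF U] by auto
qed (use subgroup_free_Abelian_groupD(2)[OF U] in auto)

text \<open>The action of S descends to N \<otimes> M. The balancing relations survive because r
  acts on N as \<phi> r and S is commutative, so scaling by s commutes with scaling by r. It is
  enough to look at the generating relations, as the preimage of \<open>relations\<close> under
  \<open>act s\<close> is a subgroup.\<close>

lemma act_relations: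
  assumes s: "s \<in> carrier S"
  shows "c \<in> relations \<Longrightarrow> act s c \<in> relations"
proof -
  have comm: "s \<odot>\<^bsub>T\<^esub> (r \<odot>\<^bsub>N\<^esub> x) = r \<odot>\<^bsub>N\<^esub> (s \<odot>\<^bsub>T\<^esub> x)" if r: "r \<in> carrier R" and x: "x \<in> carrier N" for r x
  proof -
    have "s \<odot>\<^bsub>T\<^esub> (\<phi> r \<odot>\<^bsub>T\<^esub> x) = \<phi> r \<odot>\<^bsub>T\<^esub> (s \<odot>\<^bsub>T\<^esub> x)"
      using s \<phi>_closed[OF r] x carrier_eq by (simp flip: T.smult_assoc1 add: T.m_comm)
    then show ?thesis
      using \<phi>_smult[OF r] s x smult_T_closed by simp
  qed
  have distr: "s \<odot>\<^bsub>T\<^esub> (x \<oplus>\<^bsub>N\<^esub> x') = s \<odot>\<^bsub>T\<^esub> x \<oplus>\<^bsub>N\<^esub> s \<odot>\<^bsub>T\<^esub> x'"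
    if "x \<in> carrier N" "x' \<in> carrier N" for x x'
    using T.smult_r_distr[of s x x'] s that carrier_eq add_eq by simp
  have "relations \<subseteq> {c. Poly_Mapping.keys c \<subseteq> carrier N \<times> carrier M \<and> act s c \<in> relations}"
    by (rule relations_subset[OF subgroup_vimage_act[OF s subgroup_relations]];
        intro CollectI conjI keys_frag_diff)
      (use s in \<open>simp_all add: comm distr smult_T_closed relation_add_left relation_add_right
        relation_smult\<close>)
  then show "c \<in> relations \<Longrightarrow> act s c \<in> relations"
    by blast
qed

lemma act_one:
  assumes "Poly_Mapping.keys c \<subseteq> carrier N \<times> carrier M"
  shows "act \<one>\<^bsub>S\<^esub> c = c"
  using assms by (induction c rule: frag_induction) (auto simp: T.smult_one carrier_eq)

lemma act_mult:
  assumes "s \<in> carrier S" "t \<in> carrier S" "Poly_Mapping.keys c \<subseteq> carrier N \<times> carrier M"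
  shows "act (s \<otimes>\<^bsub>S\<^esub> t) c = act s (act t c)"
  using assms(3) by (induction c rule: frag_induction) (use assms in \<open>auto simp: T.smult_assoc1 carrier_eq\<close>)

lemma act_add:
  assumes s: "s \<in> carrier S" and t: "t \<in> carrier S"
    and "Poly_Mapping.keys c \<subseteq> carrier N \<times> carrier M"
  shows "act (s \<oplus>\<^bsub>S\<^esub> t) c - (act s c + act t c) \<in> relations"
  using assms(3)
proof (induction c rule: frag_induction)
  case (one z)
  then obtain x y where "z = (x, y)" "x \<in> carrier N" "y \<in> carrier M"
    by blast
  then show ?case
    using relation_add_left[of "s \<odot>\<^bsub>T\<^esub> x" "t \<odot>\<^bsub>T\<^esub> x" y] T.smult_l_distr[OF s t, of x]
      smult_T_closed[OF s] smult_T_closed[OF t] by (simp add: carrier_eq add_eq diff_diff_eq)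
next
  case (diff a b)
  then show ?case
    using relationsD(5)[OF diff] by (simp add: algebra_simps)
qed (simp add: relationsD(2))

text \<open>These are the S-submodules of N \<otimes> M, pulled back to the free group.\<close>

definition stable :: "('n \<times> 'm \<Rightarrow>\<^sub>0 int) set \<Rightarrow> bool"
  where "stable U \<longleftrightarrow> tensor_subgroup U \<and> (\<forall>s\<in>carrier S. \<forall>c\<in>U. act s c \<in> U)"

lemma stableD:
  assumes "stable U"
  shows "tensor_subgroup U" and "subgroup U free_group" and "relations \<subseteq> U"
    and "s \<in> carrier S \<Longrightarrow> c \<in> U \<Longrightarrow> act s c \<in> U"
  using assms unfolding stable_def tensor_subgroup_def by auto

text \<open>The preimage of \<open>tensor_span L\<close> under \<open>act s\<close> is again a
  \<open>tensor_subgroup\<close>, and its slice contains L because s x runs inside N. The Galois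
  connection then places \<open>tensor_span L\<close> inside the preimage, with no induction over
  formal sums.\<close>

lemma stable_tensor_span:
  assumes L: "L \<subseteq> carrier M"
  shows "stable (tensor_span L)"
proof -
  note U = tensor_span_tensor_subgroup[OF L]
  have "act s c \<in> tensor_span L" if s: "s \<in> carrier S" and c: "c \<in> tensor_span L" for s c
  proof -
    let ?V = "{c. Poly_Mapping.keys c \<subseteq> carrier N \<times> carrier M \<and> act s c \<in> tensor_span L}"
    have "tensor_subgroup ?V"
      using subgroup_vimage_act[OF s, of "tensor_span L"] U act_relations[OF s] relationsD(1)
      unfolding tensor_subgroup_def by blast
    moreover have "L \<subseteq> slice (tensor_span L)"
      using tensor_span_subset_iff[OF L U] by simp
    then have "L \<subseteq> slice ?V"
      using smult_T_closed[OF s] by (auto simp: slice_def)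
    ultimately show ?thesis
      using tensor_span_subset_iff[OF L] c by blast
  qed
  then show ?thesis
    using U unfolding stable_def by blast
qed

text \<open>The submodule U + I e. Two ideals occur: all of S, which adds e as a generator, and J,
  for which e in U + J e is the situation of Nakayama's lemma.\<close>

definition adjoin :: "'s set \<Rightarrow> ('n \<times> 'm \<Rightarrow>\<^sub>0 int) set \<Rightarrow> ('n \<times> 'm \<Rightarrow>\<^sub>0 int) \<Rightarrow> ('n \<times> 'm \<Rightarrow>\<^sub>0 int) set"
  where "adjoin I U e = {u + act a e | u a. u \<in> U \<and> a \<in> I}"

lemma act_diff:
  assumes s: "s \<in> carrier S" and t: "t \<in> carrier S"
    and c: "Poly_Mapping.keys c \<subseteq> carrier N \<times> carrier M"
  shows "act (s \<ominus>\<^bsub>S\<^esub> t) c - (act s c - act t c) \<in> relations"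
proof -
  have "act ((s \<ominus>\<^bsub>S\<^esub> t) \<oplus>\<^bsub>S\<^esub> t) c - (act (s \<ominus>\<^bsub>S\<^esub> t) c + act t c) \<in> relations"
    using s t c by (intro act_add) auto
  moreover have "(s \<ominus>\<^bsub>S\<^esub> t) \<oplus>\<^bsub>S\<^esub> t = s"
    using s t by (simp add: a_minus_def T.R.a_assoc T.R.l_neg)
  ultimately show ?thesis
    using relationsD(4) by (fastforce simp: algebra_simps)
qed

lemma act_zero:
  assumes c: "Poly_Mapping.keys c \<subseteq> carrier N \<times> carrier M"
  shows "act \<zero>\<^bsub>S\<^esub> c \<in> relations"
  using act_diff[OF T.R.zero_closed T.R.zero_closed c] by (simp add: a_minus_def)

lemma adjoin_lower:
  assumes U: "stable U" and e: "Poly_Mapping.keys e \<subseteq> carrier N \<times> carrier M" and I: "ideal I S"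
  shows "U \<subseteq> adjoin I U e"
proof
  fix u assume u: "u \<in> U"
  have z: "act \<zero>\<^bsub>S\<^esub> e \<in> U"
    using act_zero[OF e] stableD(3)[OF U] by blast
  \<comment> \<open>On the free group \<open>act\<close> by zero gives a relation rather than 0, so
    it is subtracted from u first; the difference is still in U.\<close>
  have "u = (u - act \<zero>\<^bsub>S\<^esub> e) + act \<zero>\<^bsub>S\<^esub> e"
    by simp
  then show "u \<in> adjoin I U e"
    unfolding adjoin_def
    using subgroup_free_Abelian_groupD(5)[OF stableD(2)[OF U] u z]
      additive_subgroup.zero_closed[OF ideal.axioms(1)[OF I]] by blast
qed

lemma stable_adjoin:
  assumes I: "ideal I S" and U: "stable U" and e: "Poly_Mapping.keys e \<subseteq> carrier N \<times> carrier M"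
  shows "stable (adjoin I U e)"
proof -
  interpret I: ideal I S by fact
  note D = subgroup_free_Abelian_groupD[OF stableD(2)[OF U]]
  have "subgroup (adjoin I U e) free_group"
  proof (rule subgroup_free_Abelian_groupI)
    fix x assume "x \<in> adjoin I U e"
    then obtain u a where "x = u + act a e" "u \<in> U" "a \<in> I"
      unfolding adjoin_def by blast
    then show "Poly_Mapping.keys x \<subseteq> carrier N \<times> carrier M"
      using keys_add[of u "act a e"] D(1)[of u] keys_act[OF I.a_Hcarr e, of a] by blast
  next
    show "0 \<in> adjoin I U e"
      using adjoin_lower[OF U e I] D(2) by blast
  next
    fix x y assume "x \<in> adjoin I U e" "y \<in> adjoin I U e"
    then obtain u a v b where e': "x = u + act a e" "u \<in> U" "a \<in> I" "y = v + act b e" "v \<in> U" "b \<in> I"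
      unfolding adjoin_def by blast
    \<comment> \<open>The scalar a - b acts as the difference of the two actions only up to a
      relation. That error lies in U and is moved into the U-component of x - y.\<close>
    have "act (a \<ominus>\<^bsub>S\<^esub> b) e - (act a e - act b e) \<in> U"
      using act_diff[OF _ _ e, of a b] I.a_Hcarr e' stableD(3)[OF U] by blast
    then have "u - v - (act (a \<ominus>\<^bsub>S\<^esub> b) e - (act a e - act b e)) \<in> U"
      using D(5) e' by blast
    moreover have "x - y = u - v - (act (a \<ominus>\<^bsub>S\<^esub> b) e - (act a e - act b e)) + act (a \<ominus>\<^bsub>S\<^esub> b) e"
      using e' by simp
    moreover have "a \<ominus>\<^bsub>S\<^esub> b \<in> I"
      using e' by (simp add: a_minus_def)
    ultimately show "x - y \<in> adjoin I U e"
      unfolding adjoin_def by blast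
  qed
  moreover have "act s x \<in> adjoin I U e" if s: "s \<in> carrier S" and x: "x \<in> adjoin I U e" for s x
  proof -
    obtain u a where "x = u + act a e" "u \<in> U" "a \<in> I"
      using x unfolding adjoin_def by blast
    then have "act s x = act s u + act (s \<otimes>\<^bsub>S\<^esub> a) e" "act s u \<in> U" "s \<otimes>\<^bsub>S\<^esub> a \<in> I"
      using s e I.I_l_closed stableD(4)[OF U] I.a_Hcarr by (auto simp: act_mult)
    then show ?thesis
      unfolding adjoin_def by blast
  qed
  ultimately show ?thesis
    using stableD(3)[OF U] adjoin_lower[OF U e I] unfolding stable_def tensor_subgroup_def by blast
qed

lemma adjoin_upper:
  assumes U: "stable U" and e: "Poly_Mapping.keys e \<subseteq> carrier N \<times> carrier M"
  shows "e \<in> adjoin (carrier S) U e"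
  unfolding adjoin_def using subgroup_free_Abelian_groupD(2)[OF stableD(2)[OF U]] act_one[OF e]
  by (intro CollectI exI[of _ 0] exI[of _ "\<one>\<^bsub>S\<^esub>"]) simp

text \<open>If \<open>e = u + a e\<close> with \<open>u \<in> U\<close> and \<open>a \<in> J\<close>, then
  \<open>(1 - a) e \<in> U\<close> and \<open>1 - a\<close> is a unit.\<close>

lemma adjoin_radical_cancel:
  assumes U: "stable U" and e: "Poly_Mapping.keys e \<subseteq> carrier N \<times> carrier M"
    and "e \<in> adjoin J U e"
  shows "e \<in> U"
proof -
  obtain u a where ua: "e = u + act a e" "u \<in> U" "a \<in> J"
    using assms(3) unfolding adjoin_def by blast
  let ?v = "\<one>\<^bsub>S\<^esub> \<ominus>\<^bsub>S\<^esub> a"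
  have a: "a \<in> carrier S"
    using ua(3) additive_subgroup.a_Hcarr[OF ideal.axioms(1)[OF ideal_J]] by blast
  have v: "?v \<in> Units S"
    using unit_J ua(3) .
  have "act ?v e - u \<in> relations"
    using act_diff[OF T.R.one_closed a e] act_one[OF e] ua(1)
    by (metis add_diff_cancel_right')
  then have "act ?v e \<in> U"
    using tensor_subgroup_mod[OF stableD(1)[OF U]] ua(2) by blast
  then have "act (inv\<^bsub>S\<^esub> ?v) (act ?v e) \<in> U"
    using stableD(4)[OF U] v by simp
  moreover have "act (inv\<^bsub>S\<^esub> ?v) (act ?v e) = e"
    using act_mult[of "inv\<^bsub>S\<^esub> ?v" ?v e] v e act_one[OF e] T.R.Units_closed[OF v] by simp
  ultimately show ?thesis
    by simp
qed

lemma tensor_span_nakayama_step: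
  assumes U: "stable U" and e: "e \<in> tensor_span N'" and N': "submodule N' R M"
    and L: "submodule L R M" "L \<subseteq> slice U"
    and m: "m \<subseteq> carrier R" "\<phi> ` m \<subseteq> J"
    and sub: "N' \<subseteq> slice (tensor_span (L <+>\<^bsub>M\<^esub> set_smult R M m N'))"
    and gen: "tensor_span N' \<subseteq> adjoin (carrier S) U e"
  shows "tensor_span N' \<subseteq> U"
proof -
  note n = M.submoduleE(1)[OF N'] and l = M.submoduleE(1)[OF L(1)]
  have ke: "Poly_Mapping.keys e \<subseteq> carrier N \<times> carrier M"
    using stableD(2)[OF stable_tensor_span[OF n]] e subgroup_free_Abelian_groupD(1) by blast
  have V: "stable (adjoin J U e)"
    by (rule stable_adjoin[OF ideal_J U ke])
  note DV = subgroup_free_Abelian_groupD[OF stableD(2)[OF V]]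
  have UV: "U \<subseteq> adjoin J U e"
    by (rule adjoin_lower[OF U ke ideal_J])
  have "frag_of (x, a \<odot>\<^bsub>M\<^esub> y) \<in> adjoin J U e" if "a \<in> m" "y \<in> N'" "x \<in> carrier N" for a x y
  proof -
    have a: "a \<in> carrier R" "\<phi> a \<in> J" "\<phi> a \<in> carrier S" and y: "y \<in> carrier M"
      using that m \<phi>_closed n by auto
    have "frag_of (x, y) \<in> tensor_span N'"
      using tensor_span_subset_iff[OF n tensor_span_tensor_subgroup[OF n]] that by (auto simp: slice_def)
    then obtain u s where us: "frag_of (x, y) = u + act s e" "u \<in> U" "s \<in> carrier S"
      using gen unfolding adjoin_def by blast
    \<comment> \<open>Moved to the left factor, a acts as \<phi> a. Applied to an expansion u + s e
      it turns the coefficient s into \<phi> a s, an element of J.\<close>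
    have "frag_of (a \<odot>\<^bsub>N\<^esub> x, y) = act (\<phi> a) (frag_of (x, y))"
      using \<phi>_smult a that by simp
    also have "\<dots> = act (\<phi> a) u + act (\<phi> a \<otimes>\<^bsub>S\<^esub> s) e"
      using us a ke by (simp add: act_mult)
    also have "\<dots> \<in> adjoin J U e"
      unfolding adjoin_def using stableD(4)[OF U a(3) us(2)] ideal.I_r_closed[OF ideal_J a(2) us(3)]
      by blast
    finally show ?thesis
      using tensor_subgroup_mod[OF stableD(1)[OF V] relation_smult[OF a(1) that(3) y]] by blast
  qed
  then have "set_smult R M m N' \<subseteq> slice (adjoin J U e)"
    unfolding set_smult_def
    using slice_submodule[OF stableD(1)[OF V]] m(1) n
    by (intro M.span_minimal) (auto simp: slice_def)
  moreover have "L \<subseteq> slice (adjoin J U e)"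
    using L(2) slice_mono[OF UV] by blast
  ultimately have "L <+>\<^bsub>M\<^esub> set_smult R M m N' \<subseteq> slice (adjoin J U e)"
    using M.submoduleE(5)[OF slice_submodule[OF stableD(1)[OF V]]]
    by (auto simp: M.mem_set_add_iff subset_iff)
  moreover have "L <+>\<^bsub>M\<^esub> set_smult R M m N' \<subseteq> carrier M"
    using M.submodule_set_add[OF L(1) M.set_smult_submodule[OF m(1) n]] M.submoduleE(1) by blast
  ultimately have "tensor_span (L <+>\<^bsub>M\<^esub> set_smult R M m N') \<subseteq> adjoin J U e"
    using tensor_span_subset_iff[OF _ stableD(1)[OF V]] by blast
  then have "tensor_span N' \<subseteq> adjoin J U e"
    using sub slice_mono tensor_span_subset_iff[OF n stableD(1)[OF V]] by blast
  then have "e \<in> U"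
    using adjoin_radical_cancel[OF U ke] e by blast
  have "adjoin (carrier S) U e \<subseteq> U"
    using subgroup_free_Abelian_groupD(3)[OF stableD(2)[OF U]] stableD(4)[OF U _ \<open>e \<in> U\<close>]
    by (auto simp: adjoin_def)
  then show ?thesis
    using gen by blast
qed

text \<open>\<open>foldr\<close> makes the head of the list the last generator adjoined, so that
  induction on the list strips off the head while the remaining generators stay in the base.\<close>

definition adjoins :: "('n \<times> 'm \<Rightarrow>\<^sub>0 int) set \<Rightarrow> ('n \<times> 'm \<Rightarrow>\<^sub>0 int) list \<Rightarrow> ('n \<times> 'm \<Rightarrow>\<^sub>0 int) set"
  where "adjoins U es = foldr (\<lambda>e U. adjoin (carrier S) U e) es U"

lemma adjoins_simps [simp]:
  "adjoins U [] = U" "adjoins U (e # es) = adjoin (carrier S) (adjoins U es) e"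
  by (simp_all add: adjoins_def)

lemma adjoins:
  assumes U: "stable U" and "\<And>e. e \<in> set es \<Longrightarrow> Poly_Mapping.keys e \<subseteq> carrier N \<times> carrier M"
  shows "stable (adjoins U es)" "U \<subseteq> adjoins U es" "set es \<subseteq> adjoins U es"
proof -
  have "stable (adjoins U es) \<and> U \<subseteq> adjoins U es \<and> set es \<subseteq> adjoins U es"
    using assms(2)
  proof (induction es)
    case (Cons e es)
    then have IH: "stable (adjoins U es)" "U \<subseteq> adjoins U es" "set es \<subseteq> adjoins U es"
      and e: "Poly_Mapping.keys e \<subseteq> carrier N \<times> carrier M"
      by simp_all
    show ?case
      using stable_adjoin[OF T.oneideal IH(1) e] adjoin_lower[OF IH(1) e T.oneideal] IH(2,3)
        adjoin_upper[OF IH(1) e] by auto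
  qed (use U in simp)
  then show "stable (adjoins U es)" "U \<subseteq> adjoins U es" "set es \<subseteq> adjoins U es"
    by blast+
qed

text \<open>The generators are the b \<otimes> a with b from a generating set of N over S and a from
  one of N' over R. Finiteness over S suffices for the left factor since the subgroups involved are
  stable under S.\<close>

lemma tensor_span_fg:
  assumes "fg_submodule R M N'" and "stable U"
  obtains es where "set es \<subseteq> tensor_span N'" "tensor_span N' \<subseteq> adjoins U es"
proof -
  obtain A where A: "finite A" "A \<subseteq> N'" "module_span R M A = N'" and N': "submodule N' R M"
    using assms(1) unfolding fg_submodule_def by blast
  obtain B where B: "finite B" "B \<subseteq> carrier N" "module_span S T B = carrier N"
    using fg unfolding fg_submodule_def carrier_eq by blast
  note n = M.submoduleE(1)[OF N']
  obtain es where es: "set es = frag_of ` (B \<times> A)"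
    using finite_list[of "frag_of ` (B \<times> A)"] A(1) B(1) by blast
  have sub: "frag_of ` (carrier N \<times> N') \<subseteq> tensor_span N'"
    using tensor_span_subset_iff[OF n tensor_span_tensor_subgroup[OF n]] by (auto simp: slice_def)
  then have es_sub: "set es \<subseteq> tensor_span N'"
    using es A(2) B(2) by blast
  moreover have ke: "Poly_Mapping.keys e \<subseteq> carrier N \<times> carrier M" if "e \<in> tensor_span N'" for e
    using stableD(2)[OF stable_tensor_span[OF n]] that subgroup_free_Abelian_groupD(1) by blast
  ultimately have V: "stable (adjoins U es)" "set es \<subseteq> adjoins U es"
    using adjoins[OF assms(2), of es] by blast+
  note D = subgroup_free_Abelian_groupD[OF stableD(2)[OF V(1)]]
  have "A \<subseteq> slice (adjoins U es)"
  proof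
    fix y assume y: "y \<in> A"
    then have yM: "y \<in> carrier M"
      using A(2) n by blast
    \<comment> \<open>With y fixed, the admissible left entries form an S-submodule of T. As it
      contains B, it contains everything that B spans over S.\<close>
    let ?X = "{x \<in> carrier T. frag_of (x, y) \<in> adjoins U es}"
    have act: "s \<odot>\<^bsub>T\<^esub> x \<in> ?X" if "s \<in> carrier S" "x \<in> ?X" for s x
      using stableD(4)[OF V(1) that(1), of "frag_of (x, y)"] that by simp
    have BX: "B \<subseteq> ?X"
      using B(2) V(2) es y carrier_eq by blast
    have "submodule ?X S T"
    proof (rule T.submoduleI)
      have "frag_of (x \<oplus>\<^bsub>T\<^esub> x', y) \<in> adjoins U es" if "x \<in> ?X" "x' \<in> ?X" for x x'
      proof -
        have "frag_of (x \<oplus>\<^bsub>N\<^esub> x', y) - (frag_of (x, y) + frag_of (x', y)) \<in> relations"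
          using relation_add_left[of x x' y] that yM carrier_eq by (simp add: algebra_simps)
        then show ?thesis
          using tensor_subgroup_mod[OF stableD(1)[OF V(1)]] D(3) that add_eq by auto
      qed
      then show "x \<oplus>\<^bsub>T\<^esub> x' \<in> ?X" if "x \<in> ?X" "x' \<in> ?X" for x x'
        using that by simp
      have "- frag_of (\<zero>\<^bsub>N\<^esub>, y) \<in> relations"
        using relation_add_left[of "\<zero>\<^bsub>N\<^esub>" "\<zero>\<^bsub>N\<^esub>" y] yM by simp
      then have "frag_of (\<zero>\<^bsub>N\<^esub>, y) \<in> adjoins U es"
        using D(4) stableD(3)[OF V(1)] by fastforce
      \<comment> \<open>T and N are known to share carrier and addition; the zero of T is reached
        from that of N by multiplying with the zero of S.\<close>
      then have "\<zero>\<^bsub>S\<^esub> \<odot>\<^bsub>T\<^esub> \<zero>\<^bsub>N\<^esub> \<in> ?X"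
        using act[OF T.R.zero_closed, of "\<zero>\<^bsub>N\<^esub>"] carrier_eq by simp
      then show "\<zero>\<^bsub>T\<^esub> \<in> ?X"
        using carrier_eq by simp
      show "\<ominus>\<^bsub>T\<^esub> x \<in> ?X" if x: "x \<in> ?X" for x
        using act[of "\<ominus>\<^bsub>S\<^esub> \<one>\<^bsub>S\<^esub>" x] x T.smult_l_minus[of "\<one>\<^bsub>S\<^esub>" x] by simp
    qed (use act in auto)
    then have "carrier N \<subseteq> ?X"
      using T.span_minimal[OF _ BX] B(3) by blast
    then show "y \<in> slice (adjoins U es)"
      using yM unfolding slice_def by blast
  qed
  then have "N' \<subseteq> slice (adjoins U es)"
    using M.span_minimal[OF slice_submodule[OF stableD(1)[OF V(1)]]] A(3) by blast
  then have "tensor_span N' \<subseteq> adjoins U es"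
    using tensor_span_subset_iff[OF n stableD(1)[OF V(1)]] by blast
  then show ?thesis
    using that es_sub by blast
qed

text \<open>In each round the generators not yet removed are counted into the base submodule, and
  the preceding step discards the outermost one. When none are left the base is
  \<open>tensor_span L\<close>.\<close>

lemma tensor_span_nakayama:
  assumes L: "submodule L R M" and N': "fg_submodule R M N'"
    and m: "m \<subseteq> carrier R" "\<phi> ` m \<subseteq> J"
    and sub: "N' \<subseteq> slice (tensor_span (L <+>\<^bsub>M\<^esub> set_smult R M m N'))"
  shows "tensor_span N' \<subseteq> tensor_span L"
proof -
  have sN: "submodule N' R M"
    using N' unfolding fg_submodule_def by blast
  note l = M.submoduleE(1)[OF L] and n = M.submoduleE(1)[OF sN]
  have U: "stable (tensor_span L)"
    by (rule stable_tensor_span[OF l])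
  obtain es where es: "set es \<subseteq> tensor_span N'" "tensor_span N' \<subseteq> adjoins (tensor_span L) es"
    using tensor_span_fg[OF N' U] .
  have "set es \<subseteq> tensor_span N' \<Longrightarrow> tensor_span N' \<subseteq> adjoins (tensor_span L) es \<Longrightarrow>
    tensor_span N' \<subseteq> tensor_span L" for es
  proof (induction es)
    case (Cons e es)
    have "Poly_Mapping.keys c \<subseteq> carrier N \<times> carrier M" if "c \<in> tensor_span N'" for c
      using stableD(2)[OF stable_tensor_span[OF n]] that subgroup_free_Abelian_groupD(1) by blast
    then have V: "stable (adjoins (tensor_span L) es)" "tensor_span L \<subseteq> adjoins (tensor_span L) es"
      using adjoins[OF U, of es] Cons.prems(1) by auto
    have "L \<subseteq> slice (adjoins (tensor_span L) es)"
      using tensor_span_subset_iff[OF l stableD(1)[OF V(1)]] V(2) by blast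
    then have "tensor_span N' \<subseteq> adjoins (tensor_span L) es"
      using tensor_span_nakayama_step[OF V(1) _ sN L _ m sub, of e] Cons.prems by simp
    then show ?case
      using Cons by simp
  qed simp
  then show ?thesis
    using es by blast
qed

end

theorem (in algebra_module) nakayama_closure_module_closure:
  assumes "m \<subseteq> carrier R" "\<phi> ` m \<subseteq> J"
  shows "nakayama_closure R m (module_closure R N :: ('a, 'm) closure_op)"
  unfolding nakayama_closure_def
proof (intro conjI allI impI)
  show "closure_operation R (module_closure R N :: ('a, 'm) closure_op)"
    by (rule module_closure_closure_operation[OF N.module_axioms])
  fix M :: "('a, 'm) module" and L N'
  assume M: "fg_module R M" and fL: "fg_submodule R M L" and fN: "fg_submodule R M N'"
    and LN: "L \<subseteq> N'"
    and sub: "N' \<subseteq> module_closure R N M (L <+>\<^bsub>M\<^esub> set_smult R M m N')"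
  interpret M: module R M
    using M unfolding fg_module_def by simp
  interpret algebra_module_pair R S N T \<phi> J M
    by unfold_locales
  have L: "submodule L R M" and N': "submodule N' R M"
    using fL fN unfolding fg_submodule_def by auto
  have "submodule (L <+>\<^bsub>M\<^esub> set_smult R M m N') R M"
    using M.submodule_set_add[OF L M.set_smult_submodule[OF assms(1)]] M.submoduleE(1)[OF N'] by blast
  then have "tensor_span N' = tensor_span L"
    using tensor_span_nakayama[OF L fN assms] sub tensor_span_mono[OF LN] by (simp add: module_closure_eq)
  then show "module_closure R N M L = module_closure R N M N'"
    using L N' by (simp add: module_closure_eq)
qed

section \<open>The Jacobson radical\<close>

context cring
begin

text \<open>Zorn's lemma for the ideals above I that avoid 1. Avoiding 1 expresses properness in a
  form that unions of chains inherit.\<close>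

lemma proper_ideal_subset_maximalideal:
  assumes I: "ideal I R" "\<one> \<notin> I"
  shows "\<exists>P. maximalideal P R \<and> I \<subseteq> P"
proof -
  let ?A = "{J. ideal J R \<and> I \<subseteq> J \<and> \<one> \<notin> J}"
  have "\<exists>P\<in>?A. \<forall>Q\<in>?A. P \<subseteq> Q \<longrightarrow> Q = P"
  proof (rule subset_Zorn)
    fix C assume C: "subset.chain ?A C"
    show "\<exists>U\<in>?A. \<forall>Q\<in>C. Q \<subseteq> U"
    \<comment> \<open>The union of the empty chain is not an ideal; there I itself serves as upper
      bound.\<close>
    proof (cases "C = {}")
      case False
      have sub: "C \<subseteq> ?A"
        using C unfolding pred_on.chain_def by blast
      have "subset.chain {J. ideal J R} C"
        using C unfolding pred_on.chain_def by blast
      then have "ideal (\<Union>C) R"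
        using chain_Union_is_ideal[of C] False by simp
      then have "\<Union>C \<in> ?A"
        using sub False by blast
      then show ?thesis
        by blast
    qed (use I in blast)
  qed
  then obtain P where "P \<in> ?A" and "\<forall>Q\<in>?A. P \<subseteq> Q \<longrightarrow> Q = P"
    by (rule bexE)
  then have P: "ideal P R" "I \<subseteq> P" "\<one> \<notin> P"
    and max: "ideal Q R \<Longrightarrow> I \<subseteq> Q \<Longrightarrow> \<one> \<notin> Q \<Longrightarrow> P \<subseteq> Q \<Longrightarrow> Q = P" for Q
    by simp_all
  have "maximalideal P R"
  proof (rule maximalidealI[OF P(1)])
    show "carrier R \<noteq> P"
      using P(3) by blast
    show "J = P \<or> J = carrier R" if "ideal J R" "P \<subseteq> J" "J \<subseteq> carrier R" for J
    proof (cases "\<one> \<in> J")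
      case True
      then show ?thesis
        using ideal.one_imp_carrier[OF that(1)] by blast
    next
      case False
      then show ?thesis
        using max[OF that(1) _ False that(2)] that(2) P(2) by blast
    qed
  qed
  then show ?thesis
    using P(2) by blast
qed

lemma jacobson_radical_ideal: "ideal (jacobson_radical R) R"
proof -
  \<comment> \<open>Inserting the whole ring keeps the intersected family nonempty even when there
    are no maximal ideals, as in the zero ring.\<close>
  have "jacobson_radical R = \<Inter>(insert (carrier R) {I. maximalideal I R})"
    unfolding jacobson_radical_def by auto
  then show ?thesis
    using i_Intersect[of "insert (carrier R) {I. maximalideal I R}"] oneideal maximalideal.axioms(1)
    by auto
qed

text \<open>A nonunit 1 - a would lie in some maximal ideal, which also contains a and hence
  1.\<close>

lemma one_minus_jacobson_radical_Units:
  assumes a: "a \<in> jacobson_radical R"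
  shows "\<one> \<ominus> a \<in> Units R"
proof (rule ccontr)
  assume n: "\<one> \<ominus> a \<notin> Units R"
  have ac: "a \<in> carrier R" and am: "\<And>I. maximalideal I R \<Longrightarrow> a \<in> I"
    using a unfolding jacobson_radical_def by auto
  let ?x = "\<one> \<ominus> a"
  have x: "?x \<in> carrier R"
    using ac by simp
  have "\<one> \<notin> PIdl ?x"
  proof
    assume "\<one> \<in> PIdl ?x"
    then obtain y where "y \<in> carrier R" "\<one> = y \<otimes> ?x"
      unfolding cgenideal_def by blast
    then have "?x \<in> Units R"
      using x m_comm[of y ?x] by (auto simp: Units_def)
    with n show False
      by blast
  qed
  then obtain P where P: "maximalideal P R" "PIdl ?x \<subseteq> P"
    using proper_ideal_subset_maximalideal[OF cgenideal_ideal[OF x]] by blast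
  interpret P: maximalideal P R
    by fact
  have "?x \<oplus> a \<in> P"
    using P.a_closed am[OF P(1)] P(2) cgenideal_self[OF x] by blast
  moreover have "?x \<oplus> a = \<one>"
    using ac by (simp add: a_minus_def a_assoc l_neg)
  ultimately show False
    using P.one_imp_carrier P.I_notcarr by simp
qed

end

lemma local_ringD:
  assumes "local_ring R m"
  shows "cring R" and "maximalideal m R" and "m \<subseteq> carrier R" and "jacobson_radical R = m"
proof -
  show "cring R" and m: "maximalideal m R"
    using assms unfolding local_ring_def by auto
  show s: "m \<subseteq> carrier R"
    using additive_subgroup.a_subset[OF ideal.axioms(1)[OF maximalideal.axioms(1)[OF m]]] .
  show "jacobson_radical R = m"
    using assms s unfolding local_ring_def jacobson_radical_def by auto
qed

section \<open>Closures given by algebras and by modules over algebras\<close>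

text \<open>In the record of an R-algebra S the scalars come from R. Viewing S as a module over
  itself requires a record whose scalar multiplication is the ring product.\<close>

definition self_module :: "('a, 'z) ring_scheme \<Rightarrow> ('a, 'a) module"
  where "self_module S = \<lparr>carrier = carrier S, monoid.mult = monoid.mult S, one = one S,
    ring.zero = ring.zero S, add = add S, smult = monoid.mult S\<rparr>"

lemma abelian_group_cong:
  assumes "abelian_group M" "carrier N = carrier M" "add N = add M" "ring.zero N = ring.zero M"
  shows "abelian_group N"
proof -
  interpret M: abelian_group M by fact
  show ?thesis
  proof (rule abelian_groupI, unfold assms(2-4))
    show "\<exists>y\<in>carrier M. y \<oplus>\<^bsub>M\<^esub> x = \<zero>\<^bsub>M\<^esub>" if "x \<in> carrier M" for x
      using that M.l_neg M.a_inv_closed by blast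
  qed (auto simp: M.a_ac)
qed

lemma (in cring) self_module: "module R (self_module R)"
proof (rule moduleI)
  show "abelian_group (self_module R)"
    by (rule abelian_group_cong[OF abelian_group_axioms]) (simp_all add: self_module_def)
qed (auto simp: self_module_def is_cring l_distr r_distr m_assoc)

lemma (in cring) self_module_fg: "fg_submodule R (self_module R) (carrier R)"
proof -
  interpret S: module R "self_module R"
    by (rule self_module)
  have c: "carrier (self_module R) = carrier R"
    by (simp add: self_module_def)
  have one: "{\<one>} \<subseteq> carrier (self_module R)"
    by (simp add: c)
  have "r \<in> module_span R (self_module R) {\<one>}" if "r \<in> carrier R" for r
    using S.submoduleE(4)[OF S.span_submodule[OF one] that, of \<one>] S.span_superset that
    by (auto simp: self_module_def)
  then have "module_span R (self_module R) {\<one>} = carrier R"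
    using S.span_closed[OF one] c by blast
  then show ?thesis
    using S.fg_submodule_spanI[OF _ one] by simp
qed

lemma (in algebra) smult_one_mult:
  assumes "r \<in> carrier R" "x \<in> carrier M"
  shows "(r \<odot>\<^bsub>M\<^esub> \<one>\<^bsub>M\<^esub>) \<otimes>\<^bsub>M\<^esub> x = r \<odot>\<^bsub>M\<^esub> x"
  using assms smult_assoc2[of r "\<one>\<^bsub>M\<^esub>" x] by simp

text \<open>Over itself S is generated by 1, so both N and T are S, with scalars from R and from S.
  Leaving J open allows an ideal to be used whose elements are given explicitly, as for the perfect
  closure.\<close>

theorem nakayama_closure_algebra:
  assumes S: "algebra R S" and J: "ideal J S" "\<And>a. a \<in> J \<Longrightarrow> \<one>\<^bsub>S\<^esub> \<ominus>\<^bsub>S\<^esub> a \<in> Units S"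
    and m: "m \<subseteq> carrier R" "(\<lambda>r. r \<odot>\<^bsub>S\<^esub> \<one>\<^bsub>S\<^esub>) ` m \<subseteq> J"
  shows "nakayama_closure R m (module_closure R S :: ('a, 'm) closure_op)"
proof -
  interpret S: algebra R S by fact
  have "algebra_module R S S (self_module S) (\<lambda>r. r \<odot>\<^bsub>S\<^esub> \<one>\<^bsub>S\<^esub>) J"
  proof (intro algebra_module.intro algebra_module_axioms.intro)
    show "fg_submodule S (self_module S) (carrier (self_module S))"
      using S.self_module_fg by (simp add: self_module_def)
  qed (use S.module S.self_module J in \<open>simp_all add: self_module_def S.smult_one_mult\<close>)
  then show ?thesis
    by (rule algebra_module.nakayama_closure_module_closure[OF _ m])
qed

lemma restrict_scalars_module:
  assumes "algebra R S" and "module S N"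
  shows "module R (restrict_scalars S N)"
proof -
  interpret S: algebra R S by fact
  interpret N: module S N by fact
  show ?thesis
  proof (rule moduleI)
    show "abelian_group (restrict_scalars S N)"
      by (rule abelian_group_cong[OF N.abelian_group_axioms]) (simp_all add: restrict_scalars_def)
    show "(a \<otimes>\<^bsub>R\<^esub> b) \<odot>\<^bsub>restrict_scalars S N\<^esub> x =
        a \<odot>\<^bsub>restrict_scalars S N\<^esub> (b \<odot>\<^bsub>restrict_scalars S N\<^esub> x)"
      if "a \<in> carrier R" "b \<in> carrier R" "x \<in> carrier (restrict_scalars S N)" for a b x
    proof -
      have "(a \<otimes>\<^bsub>R\<^esub> b) \<odot>\<^bsub>S\<^esub> \<one>\<^bsub>S\<^esub> = (a \<odot>\<^bsub>S\<^esub> \<one>\<^bsub>S\<^esub>) \<otimes>\<^bsub>S\<^esub> (b \<odot>\<^bsub>S\<^esub> \<one>\<^bsub>S\<^esub>)"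
        using that by (simp add: S.smult_one_mult S.smult_assoc1)
      then show ?thesis
        using that by (simp add: restrict_scalars_def N.smult_assoc1)
    qed
    show "(a \<oplus>\<^bsub>R\<^esub> b) \<odot>\<^bsub>restrict_scalars S N\<^esub> x =
        a \<odot>\<^bsub>restrict_scalars S N\<^esub> x \<oplus>\<^bsub>restrict_scalars S N\<^esub> b \<odot>\<^bsub>restrict_scalars S N\<^esub> x"
      if "a \<in> carrier R" "b \<in> carrier R" "x \<in> carrier (restrict_scalars S N)" for a b x
      using that by (simp add: restrict_scalars_def S.smult_l_distr N.smult_l_distr)
    show "a \<odot>\<^bsub>restrict_scalars S N\<^esub> (x \<oplus>\<^bsub>restrict_scalars S N\<^esub> y) =
        a \<odot>\<^bsub>restrict_scalars S N\<^esub> x \<oplus>\<^bsub>restrict_scalars S N\<^esub> a \<odot>\<^bsub>restrict_scalars S N\<^esub> y"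
      if "a \<in> carrier R" "x \<in> carrier (restrict_scalars S N)" "y \<in> carrier (restrict_scalars S N)"
      for a x y
      using that by (simp add: restrict_scalars_def N.smult_r_distr)
  qed (simp_all add: restrict_scalars_def S.R_cring)
qed

theorem nakayama_closure_restrict_scalars:
  assumes S: "algebra R S" and N: "fg_module S N"
    and J: "ideal J S" "\<And>a. a \<in> J \<Longrightarrow> \<one>\<^bsub>S\<^esub> \<ominus>\<^bsub>S\<^esub> a \<in> Units S"
    and m: "m \<subseteq> carrier R" "(\<lambda>r. r \<odot>\<^bsub>S\<^esub> \<one>\<^bsub>S\<^esub>) ` m \<subseteq> J"
  shows "nakayama_closure R m (module_closure R (restrict_scalars S N) :: ('a, 'm) closure_op)"
proof -
  interpret S: algebra R S by fact
  have N': "module S N"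
    using N unfolding fg_module_def by blast
  have "algebra_module R S (restrict_scalars S N) N (\<lambda>r. r \<odot>\<^bsub>S\<^esub> \<one>\<^bsub>S\<^esub>) J"
    by (intro algebra_module.intro algebra_module_axioms.intro)
      (use restrict_scalars_module[OF S N'] N N' J in
        \<open>simp_all add: restrict_scalars_def fg_module_def\<close>)
  then show ?thesis
    by (rule algebra_module.nakayama_closure_module_closure[OF _ m])
qed

lemma smult_one_in_set_smult:
  assumes "algebra R S" and "a \<in> m"
  shows "a \<odot>\<^bsub>S\<^esub> \<one>\<^bsub>S\<^esub> \<in> set_smult R S m (carrier S)"
proof -
  interpret S: algebra R S by fact
  have "a \<odot>\<^bsub>S\<^esub> \<one>\<^bsub>S\<^esub> \<in> {a \<odot>\<^bsub>S\<^esub> x | a x. a \<in> m \<and> x \<in> carrier S}"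
    using assms(2) by blast
  then show ?thesis
    unfolding set_smult_def by (rule subsetD[OF S.span_superset])
qed

section \<open>The perfect closure\<close>

context cring
begin

text \<open>What is wanted is the expansion of a p-th power in characteristic p. The induction
  multiplies by x + y and recombines the two sums by Pascal's rule.\<close>

lemma binomial_expansion:
  assumes x: "x \<in> carrier R" and y: "y \<in> carrier R"
  shows "(x \<oplus> y) [^] n = (\<Oplus>i\<in>{..n}. [(n choose i)] \<cdot> (x [^] i \<otimes> y [^] (n - i)))"
proof (induction n)
  case 0
  then show ?case
    using x y by simp
next
  case (Suc n)
  note xy = x y nat_pow_closed[OF x] nat_pow_closed[OF y]
  let ?t = "\<lambda>n i. [(n choose i)] \<cdot> (x [^] i \<otimes> y [^] (n - i))"
  \<comment> \<open>The index k of the binomial coefficient is separated from the exponent i, so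
    that the two sums differ only in k = i and k = i + 1 and can be added termwise.\<close>
  let ?u = "\<lambda>k i. [(n choose k)] \<cdot> (x [^] i \<otimes> x \<otimes> y [^] (n - i))"
  have X: "x \<otimes> (\<Oplus>i\<in>{..n}. ?t n i) = (\<Oplus>i\<in>{..n}. ?u i i)"
  proof -
    have "x \<otimes> ?t n i = ?u i i" for i
      using xy by (simp add: add_pow_rdistr m_ac)
    then show ?thesis
      using xy by (simp add: finsum_rdistr)
  qed
  have Y: "y \<otimes> (\<Oplus>i\<in>{..n}. ?t n i) = (\<Oplus>i\<in>{..n}. ?u (Suc i) i) \<oplus> y [^] Suc n"
  proof -
    have "y \<otimes> ?t n i = [(n choose i)] \<cdot> (x [^] i \<otimes> y [^] (Suc n - i))" if "i \<le> n" for i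
      using xy that by (simp add: add_pow_rdistr m_ac Suc_diff_le)
    then have "y \<otimes> (\<Oplus>i\<in>{..n}. ?t n i) = (\<Oplus>i\<in>{..n}. [(n choose i)] \<cdot> (x [^] i \<otimes> y [^] (Suc n - i)))"
      using xy by (simp add: finsum_rdistr cong: finsum_cong)
    \<comment> \<open>The extra term costs nothing, its binomial coefficient being 0. Splitting off
      index 0 instead of the top one then shifts the sum and leaves the power of y.\<close>
    also have "\<dots> = (\<Oplus>i\<in>{..Suc n}. [(n choose i)] \<cdot> (x [^] i \<otimes> y [^] (Suc n - i)))"
      using xy by (subst finsum_Suc) (simp_all add: binomial_eq_0)
    also have "\<dots> = (\<Oplus>i\<in>{..n}. ?u (Suc i) i) \<oplus> y [^] Suc n"
      using xy by (subst finsum_Suc2) (simp_all)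
    finally show ?thesis .
  qed
  have pascal: "[(Suc n choose Suc i)] \<cdot> (x [^] i \<otimes> x \<otimes> y [^] (n - i)) = ?u i i \<oplus> ?u (Suc i) i" for i
    using xy by (simp add: add.nat_pow_mult)
  have "(\<Oplus>i\<in>{..Suc n}. ?t (Suc n) i) =
      (\<Oplus>i\<in>{..n}. ?u i i \<oplus> ?u (Suc i) i) \<oplus> y [^] Suc n"
    using xy by (subst finsum_Suc2) (simp_all add: pascal del: binomial_Suc_Suc)
  also have "\<dots> = (\<Oplus>i\<in>{..n}. ?u i i) \<oplus> ((\<Oplus>i\<in>{..n}. ?u (Suc i) i) \<oplus> y [^] Suc n)"
    using xy by (simp add: finsum_addf a_assoc)
  also have "\<dots> = (x \<oplus> y) \<otimes> (\<Oplus>i\<in>{..n}. ?t n i)"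
    using xy by (subst l_distr) (simp_all add: X Y)
  also have "\<dots> = (x \<oplus> y) [^] Suc n"
    using xy by (simp add: Suc.IH m_comm)
  finally show ?case ..
qed

end

section \<open>Frobenius and its direct limit in characteristic p\<close>

locale char_p_ring = cring R for R (structure) +
  fixes p :: nat
  assumes prime_p: "Factorial_Ring.prime p" and char_p: "has_characteristic R p"
begin

lemma add_pow_dvd:
  assumes "p dvd k" "x \<in> carrier R"
  shows "[k] \<cdot> x = \<zero>"
proof -
  have "[k] \<cdot> x = ([k] \<cdot> \<one>) \<otimes> x"
    using assms(2) by (simp add: add_pow_ldistr)
  moreover have "[k] \<cdot> \<one> = \<zero>"
    using assms(1) char_p by (simp add: has_characteristic_def)
  ultimately show ?thesis
    using assms(2) by simp
qed

text \<open>The prime p divides every binomial coefficient except the two outermost, so those terms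
  vanish in R.\<close>

lemma add_pow_p:
  assumes x: "x \<in> carrier R" and y: "y \<in> carrier R"
  shows "(x \<oplus> y) [^] p = x [^] p \<oplus> y [^] p"
proof -
  have p: "p > 0"
    using prime_p prime_gt_0_nat by blast
  let ?t = "\<lambda>i. [(p choose i)] \<cdot> (x [^] i \<otimes> y [^] (p - i))"
  have "(\<Oplus>i\<in>{..p}. ?t i) = (\<Oplus>i\<in>{p, 0}. ?t i)"
  proof (rule add.finprod_mono_neutral_cong_right)
    show "?t i = \<zero>" if "i \<in> {..p} - {p, 0}" for i
      using that x y by (intro add_pow_dvd dvd_choose_prime[OF _ _ _ prime_p]) auto
  qed (use x y in auto)
  also have "\<dots> = x [^] p \<oplus> y [^] p"
    using x y p by simp
  finally show ?thesis
    using binomial_expansion[OF x y, of p] by simp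
qed

abbreviation Fr :: "nat \<Rightarrow> 'a \<Rightarrow> 'a"
  where "Fr k \<equiv> frobenius_map R p ^^ k"

abbreviation cls :: "nat \<Rightarrow> 'a \<Rightarrow> (nat \<times> 'a) set"
  where "cls \<equiv> perfect_class R p"

lemma Fr_closed [simp]: "x \<in> carrier R \<Longrightarrow> Fr k x \<in> carrier R"
  by (induction k) (simp_all add: frobenius_map_def)

lemma Fr_add: "x \<in> carrier R \<Longrightarrow> y \<in> carrier R \<Longrightarrow> Fr k (x \<oplus> y) = Fr k x \<oplus> Fr k y"
  by (induction k) (simp_all add: frobenius_map_def add_pow_p)

lemma Fr_mult: "x \<in> carrier R \<Longrightarrow> y \<in> carrier R \<Longrightarrow> Fr k (x \<otimes> y) = Fr k x \<otimes> Fr k y"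
  by (induction k) (simp_all add: frobenius_map_def nat_pow_distrib)

lemma Fr_one [simp]: "Fr k \<one> = \<one>"
  by (induction k) (simp_all add: frobenius_map_def)

lemma Fr_zero [simp]: "Fr k \<zero> = \<zero>"
  using prime_gt_0_nat[OF prime_p] by (induction k) (simp_all add: frobenius_map_def nat_pow_zero)

lemma Fr_Fr: "Fr k (Fr l x) = Fr (k + l) x"
  by (simp add: funpow_add)

lemma Fr_eq_mono:
  assumes "Fr (k - i) x = Fr (k - j) y" "k \<ge> max i j" "l \<ge> k"
  shows "Fr (l - i) x = Fr (l - j) y"
proof -
  have "l - i = (l - k) + (k - i)" "l - j = (l - k) + (k - j)"
    using assms(2,3) by auto
  then show ?thesis
    using assms(1) by (simp add: funpow_add)
qed

lemma perfect_rel_iff: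
  "((i, x), (j, y)) \<in> perfect_rel R p \<longleftrightarrow>
    x \<in> carrier R \<and> y \<in> carrier R \<and> (\<exists>k\<ge>max i j. Fr (k - i) x = Fr (k - j) y)"
  unfolding perfect_rel_def by blast

lemma equiv_perfect_rel: "equiv (UNIV \<times> carrier R) (perfect_rel R p)"
proof (rule equivI)
  show "perfect_rel R p \<subseteq> (UNIV \<times> carrier R) \<times> (UNIV \<times> carrier R)"
    unfolding perfect_rel_def by blast
  show "refl_on (UNIV \<times> carrier R) (perfect_rel R p)"
    by (auto simp: refl_on_def perfect_rel_iff)
  show "sym (perfect_rel R p)"
    by (rule symI) (clarsimp simp: perfect_rel_def, metis)
  show "trans (perfect_rel R p)"
  proof (rule transI)
    fix a b c :: "nat \<times> 'a"
    assume ab: "(a, b) \<in> perfect_rel R p" and bc: "(b, c) \<in> perfect_rel R p"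
    obtain i x j y h z where [simp]: "a = (i, x)" "b = (j, y)" "c = (h, z)"
      by (metis surj_pair)
    obtain k l where k: "k \<ge> max i j" "Fr (k - i) x = Fr (k - j) y"
      and l: "l \<ge> max j h" "Fr (l - j) y = Fr (l - h) z"
      using ab bc by (auto simp: perfect_rel_iff)
    have "Fr (max k l - i) x = Fr (max k l - j) y" "Fr (max k l - j) y = Fr (max k l - h) z"
      using Fr_eq_mono[OF k(2,1), of "max k l"] Fr_eq_mono[OF l(2,1), of "max k l"] by auto
    then show "(a, c) \<in> perfect_rel R p"
      using ab bc k(1) l(1) by (auto simp: perfect_rel_iff intro!: exI[of _ "max k l"])
  qed
qed

lemma cls_eq_iff:
  assumes "x \<in> carrier R" "y \<in> carrier R"
  shows "cls i x = cls j y \<longleftrightarrow> (\<exists>k\<ge>max i j. Fr (k - i) x = Fr (k - j) y)"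
  using eq_equiv_class_iff[OF equiv_perfect_rel, of "(i, x)" "(j, y)"] assms
  by (simp add: perfect_class_def perfect_rel_iff)

text \<open>Raising the stage by d is compensated by d applications of Frobenius. In this way
  finitely many classes can be brought to a common stage.\<close>

lemma cls_shift:
  assumes "x \<in> carrier R"
  shows "cls (d + i) (Fr d x) = cls i x"
  using assms by (auto simp: cls_eq_iff Fr_Fr intro!: exI[of _ "d + i"])

lemma carrier_perfect_closure: "carrier (perfect_closure R p) = {cls i x | i x. x \<in> carrier R}"
  by (auto simp: perfect_closure_def quotient_def perfect_class_def)

lemma cls_closed [simp]: "x \<in> carrier R \<Longrightarrow> cls i x \<in> carrier (perfect_closure R p)"
  by (auto simp: carrier_perfect_closure)

text \<open>The union in \<open>perfect_op\<close> runs over all representatives and is harmless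
  because each contributes the same class. The operation f stays abstract so that addition and
  multiplication are covered at once; what they share is compatibility with Frobenius.\<close>

lemma perfect_op_cls:
  assumes closed: "\<And>x y. x \<in> carrier R \<Longrightarrow> y \<in> carrier R \<Longrightarrow> f x y \<in> carrier R"
    and Fr: "\<And>k x y. x \<in> carrier R \<Longrightarrow> y \<in> carrier R \<Longrightarrow> Fr k (f x y) = f (Fr k x) (Fr k y)"
    and x: "x \<in> carrier R" and y: "y \<in> carrier R"
  shows "perfect_op R p f (cls i x) (cls j y) = cls (i + j) (f (Fr j x) (Fr i y))"
proof -
  have eq: "cls (i' + j') (f (Fr j' x') (Fr i' y')) = cls (i + j) (f (Fr j x) (Fr i y))"
    if x': "(i', x') \<in> cls i x" and y': "(j', y') \<in> cls j y" for i' x' j' y'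
  proof -
    have c: "x' \<in> carrier R" "y' \<in> carrier R"
      using that by (auto simp: perfect_class_def perfect_rel_iff)
    obtain k l where k: "k \<ge> max i i'" "Fr (k - i) x = Fr (k - i') x'"
      and l: "l \<ge> max j j'" "Fr (l - j) y = Fr (l - j') y'"
      using x' y' by (auto simp: perfect_class_def perfect_rel_iff)
    \<comment> \<open>A stage beyond all indices in sight: both equalities of representatives hold
      there, and no natural-number subtraction is truncated.\<close>
    define n where "n = i + j + i' + j' + k + l"
    have e: "Fr (n - i) x = Fr (n - i') x'" "Fr (n - j) y = Fr (n - j') y'"
      using Fr_eq_mono[OF k(2,1), of n] Fr_eq_mono[OF l(2,1), of n] by (auto simp: n_def)
    have d: "n - (i + j) + j = n - i" "n - (i + j) + i = n - j"
      "n - (i' + j') + j' = n - i'" "n - (i' + j') + i' = n - j'"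
      by (auto simp: n_def)
    have "Fr (n - (i' + j')) (f (Fr j' x') (Fr i' y')) = Fr (n - (i + j)) (f (Fr j x) (Fr i y))"
      using x y c by (simp add: Fr Fr_Fr d e)
    then show ?thesis
      using x y c closed by (subst cls_eq_iff) (auto intro!: exI[of _ n] simp: n_def)
  qed
  have "(i, x) \<in> cls i x" "(j, y) \<in> cls j y"
    using x y equiv_class_self[OF equiv_perfect_rel] by (auto simp: perfect_class_def)
  then have ne: "cls i x \<noteq> {}" "cls j y \<noteq> {}"
    by (metis empty_iff)+
  have inner: "(\<Union>(j', y')\<in>cls j y. cls (i' + j') (f (Fr j' x') (Fr i' y'))) = cls (i + j) (f (Fr j x) (Fr i y))"
    if "(i', x') \<in> cls i x" for i' x'
    by (rule SUP_eq_const[OF ne(2)]) (use eq[OF that] in \<open>simp only: split_beta prod.collapse\<close>)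
  show ?thesis
    unfolding perfect_op_def
    by (rule SUP_eq_const[OF ne(1)]) (use inner in \<open>simp only: split_beta prod.collapse\<close>)
qed

lemma perfect_op_cls_same:
  assumes closed: "\<And>x y. x \<in> carrier R \<Longrightarrow> y \<in> carrier R \<Longrightarrow> f x y \<in> carrier R"
    and Fr: "\<And>k x y. x \<in> carrier R \<Longrightarrow> y \<in> carrier R \<Longrightarrow> Fr k (f x y) = f (Fr k x) (Fr k y)"
    and x: "x \<in> carrier R" and y: "y \<in> carrier R"
  shows "perfect_op R p f (cls i x) (cls i y) = cls i (f x y)"
proof -
  have "perfect_op R p f (cls i x) (cls i y) = cls (i + i) (f (Fr i x) (Fr i y))"
    by (rule perfect_op_cls) (use assms in auto)
  then show ?thesis
    using cls_shift[OF closed[OF x y], of i i] by (simp add: Fr x y)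
qed

lemma perfect_add_cls [simp]:
  "x \<in> carrier R \<Longrightarrow> y \<in> carrier R \<Longrightarrow> cls i x \<oplus>\<^bsub>perfect_closure R p\<^esub> cls i y = cls i (x \<oplus> y)"
  by (simp add: perfect_closure_def perfect_op_cls_same Fr_add)

lemma perfect_mult_cls [simp]:
  "x \<in> carrier R \<Longrightarrow> y \<in> carrier R \<Longrightarrow> cls i x \<otimes>\<^bsub>perfect_closure R p\<^esub> cls i y = cls i (x \<otimes> y)"
  by (simp add: perfect_closure_def perfect_op_cls_same Fr_mult)

lemma perfect_one_cls: "\<one>\<^bsub>perfect_closure R p\<^esub> = cls i \<one>"
  using cls_shift[of \<one> i 0] by (simp add: perfect_closure_def)

lemma perfect_zero_cls: "\<zero>\<^bsub>perfect_closure R p\<^esub> = cls i \<zero>"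
  using cls_shift[of \<zero> i 0] by (simp add: perfect_closure_def)

lemma perfect_smult: "r \<odot>\<^bsub>perfect_closure R p\<^esub> C = cls 0 r \<otimes>\<^bsub>perfect_closure R p\<^esub> C"
  by (simp add: perfect_closure_def)

text \<open>On classes at one stage the operations are those of R, so each ring law with up to three
  variables reduces to the same law in R.\<close>

lemma perfect_common_index:
  assumes "C \<in> carrier (perfect_closure R p)" "D \<in> carrier (perfect_closure R p)"
    "E \<in> carrier (perfect_closure R p)"
  obtains i x y z where "x \<in> carrier R" "y \<in> carrier R" "z \<in> carrier R"
    "C = cls i x" "D = cls i y" "E = cls i z"
proof -
  obtain i x j y k z where c: "x \<in> carrier R" "y \<in> carrier R" "z \<in> carrier R"
    and e: "C = cls i x" "D = cls j y" "E = cls k z"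
    using assms unfolding carrier_perfect_closure by blast
  have "C = cls (i + j + k) (Fr (j + k) x)" "D = cls (i + j + k) (Fr (i + k) y)"
    "E = cls (i + j + k) (Fr (i + j) z)"
    using cls_shift[OF c(1), of "j + k" i] cls_shift[OF c(2), of "i + k" j]
      cls_shift[OF c(3), of "i + j" k] e by (simp_all add: ac_simps)
  then show ?thesis
    by (rule that[rotated 3]) (use c in simp_all)
qed

lemma perfect_common_index2:
  assumes "C \<in> carrier (perfect_closure R p)" "D \<in> carrier (perfect_closure R p)"
  obtains i x y where "x \<in> carrier R" "y \<in> carrier R" "C = cls i x" "D = cls i y"
  using perfect_common_index[OF assms assms(2)] by metis

lemma perfect_closure_cring: "cring (perfect_closure R p)"
proof (rule cringI)
  let ?S = "perfect_closure R p"
  show "abelian_group ?S"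
  proof (rule abelian_groupI)
    show "C \<oplus>\<^bsub>?S\<^esub> D \<in> carrier ?S" "C \<oplus>\<^bsub>?S\<^esub> D = D \<oplus>\<^bsub>?S\<^esub> C"
      if CD: "C \<in> carrier ?S" "D \<in> carrier ?S" for C D
    proof -
      obtain i x y where "x \<in> carrier R" "y \<in> carrier R" "C = cls i x" "D = cls i y"
        using perfect_common_index2[OF CD] .
      then show "C \<oplus>\<^bsub>?S\<^esub> D \<in> carrier ?S" "C \<oplus>\<^bsub>?S\<^esub> D = D \<oplus>\<^bsub>?S\<^esub> C"
        by (simp_all add: a_comm)
    qed
    show "(C \<oplus>\<^bsub>?S\<^esub> D) \<oplus>\<^bsub>?S\<^esub> E = C \<oplus>\<^bsub>?S\<^esub> (D \<oplus>\<^bsub>?S\<^esub> E)"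
      if CDE: "C \<in> carrier ?S" "D \<in> carrier ?S" "E \<in> carrier ?S" for C D E
    proof -
      obtain i x y z where "x \<in> carrier R" "y \<in> carrier R" "z \<in> carrier R"
        "C = cls i x" "D = cls i y" "E = cls i z"
        using perfect_common_index[OF CDE] .
      then show ?thesis
        by (simp add: a_assoc)
    qed
    show "\<zero>\<^bsub>?S\<^esub> \<in> carrier ?S"
      by (simp add: perfect_zero_cls[of 0])
    show "\<zero>\<^bsub>?S\<^esub> \<oplus>\<^bsub>?S\<^esub> C = C" "\<exists>D\<in>carrier ?S. D \<oplus>\<^bsub>?S\<^esub> C = \<zero>\<^bsub>?S\<^esub>" if "C \<in> carrier ?S" for C
    proof -
      obtain i x where ix: "x \<in> carrier R" "C = cls i x"
        using \<open>C \<in> carrier ?S\<close> unfolding carrier_perfect_closure by blast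
      then show "\<zero>\<^bsub>?S\<^esub> \<oplus>\<^bsub>?S\<^esub> C = C"
        by (simp add: perfect_zero_cls[of i])
      show "\<exists>D\<in>carrier ?S. D \<oplus>\<^bsub>?S\<^esub> C = \<zero>\<^bsub>?S\<^esub>"
        using ix by (intro bexI[of _ "cls i (\<ominus> x)"]) (simp_all add: perfect_zero_cls[of i] l_neg)
    qed
  qed
  show "Group.comm_monoid ?S"
  proof (rule Group.comm_monoidI)
    show "C \<otimes>\<^bsub>?S\<^esub> D \<in> carrier ?S" "C \<otimes>\<^bsub>?S\<^esub> D = D \<otimes>\<^bsub>?S\<^esub> C"
      if CD: "C \<in> carrier ?S" "D \<in> carrier ?S" for C D
    proof -
      obtain i x y where "x \<in> carrier R" "y \<in> carrier R" "C = cls i x" "D = cls i y"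
        using perfect_common_index2[OF CD] .
      then show "C \<otimes>\<^bsub>?S\<^esub> D \<in> carrier ?S" "C \<otimes>\<^bsub>?S\<^esub> D = D \<otimes>\<^bsub>?S\<^esub> C"
        by (simp_all add: m_comm)
    qed
    show "(C \<otimes>\<^bsub>?S\<^esub> D) \<otimes>\<^bsub>?S\<^esub> E = C \<otimes>\<^bsub>?S\<^esub> (D \<otimes>\<^bsub>?S\<^esub> E)"
      if CDE: "C \<in> carrier ?S" "D \<in> carrier ?S" "E \<in> carrier ?S" for C D E
    proof -
      obtain i x y z where "x \<in> carrier R" "y \<in> carrier R" "z \<in> carrier R"
        "C = cls i x" "D = cls i y" "E = cls i z"
        using perfect_common_index[OF CDE] .
      then show ?thesis
        by (simp add: m_assoc)
    qed
    show "\<one>\<^bsub>?S\<^esub> \<in> carrier ?S"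
      by (simp add: perfect_one_cls[of 0])
    show "\<one>\<^bsub>?S\<^esub> \<otimes>\<^bsub>?S\<^esub> C = C" if C: "C \<in> carrier ?S" for C
    proof -
      obtain i x where "x \<in> carrier R" "C = cls i x"
        using C unfolding carrier_perfect_closure by blast
      then show ?thesis
        by (simp add: perfect_one_cls[of i])
    qed
  qed
  show "(C \<oplus>\<^bsub>?S\<^esub> D) \<otimes>\<^bsub>?S\<^esub> E = C \<otimes>\<^bsub>?S\<^esub> E \<oplus>\<^bsub>?S\<^esub> D \<otimes>\<^bsub>?S\<^esub> E"
    if CDE: "C \<in> carrier ?S" "D \<in> carrier ?S" "E \<in> carrier ?S" for C D E
  proof -
    obtain i x y z where "x \<in> carrier R" "y \<in> carrier R" "z \<in> carrier R"
      "C = cls i x" "D = cls i y" "E = cls i z"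
      using perfect_common_index[OF CDE] .
    then show ?thesis
      by (simp add: l_distr)
  qed
qed

lemma perfect_closure_algebra: "algebra R (perfect_closure R p)"
proof -
  interpret S: cring "perfect_closure R p"
    by (rule perfect_closure_cring)
  show ?thesis
    by (rule algebraI)
      (simp_all add: is_cring S.is_cring perfect_smult S.l_distr S.r_distr S.m_assoc
        perfect_one_cls[of 0, symmetric] flip: perfect_add_cls perfect_mult_cls)
qed

text \<open>Everything happens at a single stage. The inverse of 1 minus the class of x at stage i
  is the class, at the same stage, of the inverse of 1 - x in R. Sums need a change of stage, which
  stays within m because Frobenius maps m into itself.\<close>

theorem nakayama_closure_frobenius:
  assumes "local_ring R m"
  shows "nakayama_closure R m (frobenius_closure R p :: ('a, 'm) closure_op)"
proof -
  let ?S = "perfect_closure R p"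
  let ?J = "{cls i x | i x. x \<in> m}"
  interpret S: cring ?S
    by (rule perfect_closure_cring)
  interpret m: maximalideal m R
    by (rule local_ringD(2)[OF assms])
  have Fr_m: "Fr k x \<in> m" if "x \<in> m" for k x
  proof (induction k)
    case (Suc k)
    have "Fr k x \<otimes> Fr k x [^] (p - 1) \<in> m"
      using Suc m.a_Hcarr[OF that] by (intro m.I_r_closed) auto
    \<comment> \<open>As p is positive, one factor can be split off from the p-th power, and that
      factor lies in m.\<close>
    moreover have "Fr k x [^] p = Fr k x \<otimes> Fr k x [^] (p - 1)"
      using prime_gt_0_nat[OF prime_p] m.a_Hcarr[OF that] nat_pow_Suc2[of "Fr k x" "p - 1"] by simp
    moreover have "Fr (Suc k) x = Fr k x [^] p"
      by (simp add: frobenius_map_def)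
    ultimately show ?case
      by simp
  qed (use that in simp)
  have J: "ideal ?J ?S"
  proof (rule idealI)
    show "subgroup ?J (add_monoid ?S)"
    proof (rule S.add.subgroupI)
      show "?J \<subseteq> carrier ?S"
        using m.a_Hcarr by auto
      show "?J \<noteq> {}"
        using m.zero_closed by blast
      show "\<ominus>\<^bsub>?S\<^esub> C \<in> ?J" if C: "C \<in> ?J" for C
      proof -
        obtain i x where ix: "x \<in> m" "C = cls i x"
          using C by blast
        then have "\<ominus>\<^bsub>?S\<^esub> C = cls i (\<ominus> x)"
          using m.a_Hcarr by (intro S.minus_equality) (simp_all add: l_neg perfect_zero_cls[of i])
        then show ?thesis
          using ix m.a_inv_closed by blast
      qed
      show "C \<oplus>\<^bsub>?S\<^esub> D \<in> ?J" if CD: "C \<in> ?J" "D \<in> ?J" for C D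
      proof -
        obtain i x j y where "x \<in> m" "C = cls i x" "y \<in> m" "D = cls j y"
          using CD by blast
        then have "C \<oplus>\<^bsub>?S\<^esub> D = cls (i + j) (Fr j x \<oplus> Fr i y)" "Fr j x \<oplus> Fr i y \<in> m"
          using cls_shift[of x j i] cls_shift[of y i j] m.a_Hcarr Fr_m
            perfect_add_cls[of "Fr j x" "Fr i y" "i + j"] by (simp_all add: add.commute)
        then show ?thesis
          by blast
      qed
    qed
    have *: "C \<otimes>\<^bsub>?S\<^esub> D \<in> ?J" if CD: "C \<in> ?J" "D \<in> carrier ?S" for C D
    proof -
      obtain i x j y where "x \<in> m" "C = cls i x" "y \<in> carrier R" "D = cls j y"
        using CD unfolding carrier_perfect_closure by blast
      then have "C \<otimes>\<^bsub>?S\<^esub> D = cls (i + j) (Fr j x \<otimes> Fr i y)" "Fr j x \<otimes> Fr i y \<in> m"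
        using cls_shift[of x j i] cls_shift[of y i j] m.a_Hcarr Fr_m m.I_r_closed
          perfect_mult_cls[of "Fr j x" "Fr i y" "i + j"] by (simp_all add: add.commute)
      then show ?thesis
        by blast
    qed
    show "C \<otimes>\<^bsub>?S\<^esub> D \<in> ?J" "D \<otimes>\<^bsub>?S\<^esub> C \<in> ?J" if "C \<in> ?J" "D \<in> carrier ?S" for C D
    proof -
      have "C \<in> carrier ?S"
        using \<open>C \<in> ?J\<close> m.a_Hcarr by auto
      then show "C \<otimes>\<^bsub>?S\<^esub> D \<in> ?J" "D \<otimes>\<^bsub>?S\<^esub> C \<in> ?J"
        using *[OF that] S.m_comm[of C D] that(2) by simp_all
    qed
  qed (rule S.ring_axioms)
  have unit: "\<one>\<^bsub>?S\<^esub> \<ominus>\<^bsub>?S\<^esub> C \<in> Units ?S" if C: "C \<in> ?J" for C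
  proof -
    obtain i x where ix: "x \<in> m" "C = cls i x"
      using C by blast
    have x: "x \<in> carrier R"
      using ix m.a_Hcarr by blast
    have u: "\<one> \<ominus> x \<in> Units R"
      using one_minus_jacobson_radical_Units[of x] ix local_ringD(4)[OF assms] by simp
    have "\<ominus>\<^bsub>?S\<^esub> C = cls i (\<ominus> x)"
      using ix x by (intro S.minus_equality) (simp_all add: l_neg perfect_zero_cls[of i])
    then have "\<one>\<^bsub>?S\<^esub> \<ominus>\<^bsub>?S\<^esub> C = cls i (\<one> \<ominus> x)"
      using x by (simp add: a_minus_def perfect_one_cls[of i])
    moreover have "cls i (inv (\<one> \<ominus> x)) \<otimes>\<^bsub>?S\<^esub> cls i (\<one> \<ominus> x) = \<one>\<^bsub>?S\<^esub>"
      "cls i (\<one> \<ominus> x) \<otimes>\<^bsub>?S\<^esub> cls i (inv (\<one> \<ominus> x)) = \<one>\<^bsub>?S\<^esub>"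
      using u Units_closed[OF u] by (simp_all add: perfect_one_cls[of i])
    ultimately show ?thesis
      using cls_closed[OF Units_inv_closed[OF u]] cls_closed[OF Units_closed[OF u]]
      by (auto simp: Units_def[of ?S])
  qed
  have "(\<lambda>r. r \<odot>\<^bsub>?S\<^esub> \<one>\<^bsub>?S\<^esub>) ` m \<subseteq> ?J"
  proof
    fix C assume "C \<in> (\<lambda>r. r \<odot>\<^bsub>?S\<^esub> \<one>\<^bsub>?S\<^esub>) ` m"
    then obtain r where r: "r \<in> m" "C = r \<odot>\<^bsub>?S\<^esub> \<one>\<^bsub>?S\<^esub>"
      by blast
    then have "C = cls 0 r"
      using m.a_Hcarr by (simp add: perfect_smult)
    then show "C \<in> ?J"
      using r by blast
  qed
  then show ?thesis
    unfolding frobenius_closure_def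
    by (intro nakayama_closure_algebra[OF perfect_closure_algebra J unit local_ringD(3)[OF assms]])
qed

end

section \<open>Submodules of finitely generated modules over Noetherian rings\<close>

context module
begin

lemma span_mono: "A \<subseteq> B \<Longrightarrow> module_span R M A \<subseteq> module_span R M B"
  unfolding module_span_def by auto

lemma span_insert:
  assumes a: "a \<in> carrier M" and A: "A \<subseteq> carrier M"
  shows "module_span R M (insert a A) =
    {r \<odot>\<^bsub>M\<^esub> a \<oplus>\<^bsub>M\<^esub> e | r e. r \<in> carrier R \<and> e \<in> module_span R M A}" (is "_ = ?U")
proof
  note S = submoduleE[OF span_submodule[OF A]]
  have c: "e \<in> carrier M" if "e \<in> module_span R M A" for e
    using S(1) that by blast
  have "submodule ?U R M"
  proof (rule submoduleI)
    show "?U \<subseteq> carrier M"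
      using a c by auto
    show "\<zero>\<^bsub>M\<^esub> \<in> ?U"
      using a submodule_zero[OF span_submodule[OF A]]
      by (intro CollectI exI[of _ "\<zero>"] exI[of _ "\<zero>\<^bsub>M\<^esub>"]) simp
    show smult: "s \<odot>\<^bsub>M\<^esub> x \<in> ?U" if s: "s \<in> carrier R" and x: "x \<in> ?U" for s x
    proof -
      obtain r e where re: "x = r \<odot>\<^bsub>M\<^esub> a \<oplus>\<^bsub>M\<^esub> e" "r \<in> carrier R" "e \<in> module_span R M A"
        using x by blast
      then show ?thesis
        using s a c S(4) by (intro CollectI exI[of _ "s \<otimes> r"] exI[of _ "s \<odot>\<^bsub>M\<^esub> e"])
          (simp add: smult_r_distr smult_assoc1)
    qed
    show "\<ominus>\<^bsub>M\<^esub> x \<in> ?U" if x: "x \<in> ?U" for x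
    proof -
      have "x \<in> carrier M"
        using x a c by auto
      then show ?thesis
        using smult[OF _ x, of "\<ominus> \<one>"] by (simp add: smult_l_minus)
    qed
    show "x \<oplus>\<^bsub>M\<^esub> y \<in> ?U" if x: "x \<in> ?U" and y: "y \<in> ?U" for x y
    proof -
      obtain r e r' e' where re: "x = r \<odot>\<^bsub>M\<^esub> a \<oplus>\<^bsub>M\<^esub> e" "r \<in> carrier R" "e \<in> module_span R M A"
        "y = r' \<odot>\<^bsub>M\<^esub> a \<oplus>\<^bsub>M\<^esub> e'" "r' \<in> carrier R" "e' \<in> module_span R M A"
        using x y by blast
      then have "x \<oplus>\<^bsub>M\<^esub> y = (r \<oplus> r') \<odot>\<^bsub>M\<^esub> a \<oplus>\<^bsub>M\<^esub> (e \<oplus>\<^bsub>M\<^esub> e')"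
        using a c by (simp add: smult_l_distr M.a_ac)
      then show ?thesis
        using re S(5) by blast
    qed
  qed
  moreover have "insert a A \<subseteq> ?U"
  proof (rule insert_subsetI)
    show "a \<in> ?U"
      using a submodule_zero[OF span_submodule[OF A]]
      by (intro CollectI exI[of _ "\<one>"] exI[of _ "\<zero>\<^bsub>M\<^esub>"]) simp
    show "A \<subseteq> ?U"
    proof
      fix x assume "x \<in> A"
      then show "x \<in> ?U"
        using a A subsetD[OF span_superset]
        by (intro CollectI exI[of _ "\<zero>"] exI[of _ x]) auto
    qed
  qed
  ultimately show "module_span R M (insert a A) \<subseteq> ?U"
    by (rule span_minimal)
  have aA: "insert a A \<subseteq> carrier M"
    using a A by simp
  note T = submoduleE[OF span_submodule[OF aA]]
  have "a \<in> module_span R M (insert a A)"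
    using span_superset by blast
  moreover have "module_span R M A \<subseteq> module_span R M (insert a A)"
    by (rule span_mono) blast
  ultimately show "?U \<subseteq> module_span R M (insert a A)"
    using T(4,5) by blast
qed

text \<open>This is the colon ideal (U + E : a), the module analogue of the leading coefficients in
  Hilbert's basis theorem: those r that occur as coefficient of a in an element of U, modulo
  E.\<close>

lemma leading_coefficients_ideal:
  assumes a: "a \<in> carrier M" and E: "submodule E R M" and U: "submodule U R M"
  shows "ideal {r \<in> carrier R. \<exists>e\<in>E. r \<odot>\<^bsub>M\<^esub> a \<oplus>\<^bsub>M\<^esub> e \<in> U} R" (is "ideal ?I R")
proof (rule idealI)
  note E' = submoduleE[OF E] and U' = submoduleE[OF U]
  have c: "e \<in> carrier M" if "e \<in> E" for e
    using E'(1) that by blast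
  have l: "s \<otimes> r \<in> ?I" if s: "s \<in> carrier R" and r: "r \<in> ?I" for s r
  proof -
    obtain e where e: "e \<in> E" "r \<odot>\<^bsub>M\<^esub> a \<oplus>\<^bsub>M\<^esub> e \<in> U" "r \<in> carrier R"
      using r by blast
    have "(s \<otimes> r) \<odot>\<^bsub>M\<^esub> a \<oplus>\<^bsub>M\<^esub> s \<odot>\<^bsub>M\<^esub> e = s \<odot>\<^bsub>M\<^esub> (r \<odot>\<^bsub>M\<^esub> a \<oplus>\<^bsub>M\<^esub> e)"
      using a c e s by (simp add: smult_r_distr smult_assoc1)
    then have "(s \<otimes> r) \<odot>\<^bsub>M\<^esub> a \<oplus>\<^bsub>M\<^esub> s \<odot>\<^bsub>M\<^esub> e \<in> U"
      using U'(4) s e(2) by simp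
    then show ?thesis
      using E'(4) s e by blast
  qed
  show "s \<otimes> r \<in> ?I" "r \<otimes> s \<in> ?I" if "r \<in> ?I" "s \<in> carrier R" for r s
    using l[OF that(2,1)] that R.m_comm[of r s] by auto
  show "subgroup ?I (add_monoid R)"
  proof (rule R.add.subgroupI)
    show "?I \<subseteq> carrier R"
      by blast
    have "\<zero> \<in> ?I"
      using a submodule_zero[OF E] submodule_zero[OF U] by (auto intro!: bexI[of _ "\<zero>\<^bsub>M\<^esub>"])
    then show "?I \<noteq> {}"
      by blast
    show "\<ominus> r \<in> ?I" if r: "r \<in> ?I" for r
      using l[OF _ r, of "\<ominus> \<one>"] r by (auto simp: R.l_minus)
    show "r \<oplus> s \<in> ?I" if rs: "r \<in> ?I" "s \<in> ?I" for r s
    proof -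
      obtain e e' where e: "e \<in> E" "r \<odot>\<^bsub>M\<^esub> a \<oplus>\<^bsub>M\<^esub> e \<in> U" "r \<in> carrier R"
        "e' \<in> E" "s \<odot>\<^bsub>M\<^esub> a \<oplus>\<^bsub>M\<^esub> e' \<in> U" "s \<in> carrier R"
        using rs by blast
      have "(r \<oplus> s) \<odot>\<^bsub>M\<^esub> a \<oplus>\<^bsub>M\<^esub> (e \<oplus>\<^bsub>M\<^esub> e') = (r \<odot>\<^bsub>M\<^esub> a \<oplus>\<^bsub>M\<^esub> e) \<oplus>\<^bsub>M\<^esub> (s \<odot>\<^bsub>M\<^esub> a \<oplus>\<^bsub>M\<^esub> e')"
        using a c e by (simp add: smult_l_distr M.a_ac)
      then have "(r \<oplus> s) \<odot>\<^bsub>M\<^esub> a \<oplus>\<^bsub>M\<^esub> (e \<oplus>\<^bsub>M\<^esub> e') \<in> U"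
        using U'(5) e(2,5) by simp
      then show ?thesis
        using E'(5)[OF e(1,4)] e(3,6) by blast
    qed
  qed
qed (rule R.ring_axioms)

text \<open>Induction on the generators of E. With a new generator a, U is an extension of its ideal
  of coefficients at a by its intersection with the span of the old generators. The ideal is
  finitely generated since R is Noetherian, the intersection by induction, and lifts of the ideal
  generators together with B generate U.\<close>

lemma noetherian_submodule_fg:
  assumes R: "noetherian_ring R" and E: "fg_submodule R M E"
    and U: "submodule U R M" "U \<subseteq> E"
  shows "fg_submodule R M U"
proof -
  interpret noetherian_ring R by fact
  have fg: "\<exists>B. finite B \<and> B \<subseteq> U \<and> module_span R M B = U"
    if "finite A" "A \<subseteq> carrier M" "submodule U R M" "U \<subseteq> module_span R M A" for A U
    using that
  proof (induction A arbitrary: U rule: finite_induct)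
    case empty
    have "module_span R M {} \<subseteq> U"
      using span_minimal[OF empty(2)] by blast
    then show ?case
      using empty by (intro exI[of _ "{}"]) auto
  next
    case (insert a A)
    note U = \<open>submodule U R M\<close> and U' = submoduleE[OF \<open>submodule U R M\<close>]
    have a: "a \<in> carrier M" and A: "A \<subseteq> carrier M"
      using insert.prems(1) by auto
    let ?E = "module_span R M A"
    note E = span_submodule[OF A] and E' = submoduleE[OF span_submodule[OF A]]
    let ?I = "\<lambda>W. {r \<in> carrier R. \<exists>e\<in>?E. r \<odot>\<^bsub>M\<^esub> a \<oplus>\<^bsub>M\<^esub> e \<in> W}"
    obtain C where C: "finite C" "C \<subseteq> carrier R" "?I U = Idl\<^bsub>R\<^esub> C"
      using finetely_gen[OF leading_coefficients_ideal[OF a E U]] by blast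
    then have "\<forall>c\<in>C. \<exists>e\<in>?E. c \<odot>\<^bsub>M\<^esub> a \<oplus>\<^bsub>M\<^esub> e \<in> U"
      using genideal_self[OF C(2)] by blast
    then obtain g where g: "\<And>c. c \<in> C \<Longrightarrow> g c \<in> ?E" "\<And>c. c \<in> C \<Longrightarrow> c \<odot>\<^bsub>M\<^esub> a \<oplus>\<^bsub>M\<^esub> g c \<in> U"
      by metis
    have "submodule (\<Inter>{U, ?E}) R M"
      by (rule submodule_Inter) (use U E in auto)
    then obtain B where B: "finite B" "B \<subseteq> U \<inter> ?E" "module_span R M B = U \<inter> ?E"
      using insert.IH[OF A, of "U \<inter> ?E"] by auto
    let ?B = "(\<lambda>c. c \<odot>\<^bsub>M\<^esub> a \<oplus>\<^bsub>M\<^esub> g c) ` C \<union> B"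
    have BU: "?B \<subseteq> U"
      using g(2) B(2) by blast
    then have Bc: "?B \<subseteq> carrier M"
      using U'(1) by blast
    note W = span_submodule[OF Bc] and W' = submoduleE[OF span_submodule[OF Bc]]
    have WU: "module_span R M ?B \<subseteq> U"
      by (rule span_minimal[OF U BU])
    have "C \<subseteq> ?I (module_span R M ?B)"
    proof
      fix c assume c: "c \<in> C"
      then have "c \<odot>\<^bsub>M\<^esub> a \<oplus>\<^bsub>M\<^esub> g c \<in> module_span R M ?B"
        using subsetD[OF span_superset, of _ ?B] by blast
      then show "c \<in> ?I (module_span R M ?B)"
        using c C(2) g(1) by blast
    qed
    then have I: "?I U \<subseteq> ?I (module_span R M ?B)"
      unfolding C(3) by (rule genideal_minimal[OF leading_coefficients_ideal[OF a E W]])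
    have "x \<in> module_span R M ?B" if x: "x \<in> U" for x
    proof -
      obtain r e where re: "x = r \<odot>\<^bsub>M\<^esub> a \<oplus>\<^bsub>M\<^esub> e" "r \<in> carrier R" "e \<in> ?E"
        using x insert.prems(3) unfolding span_insert[OF a A] by blast
      then have "r \<in> ?I U"
        using x by blast
      then obtain e' where e': "e' \<in> ?E" "r \<odot>\<^bsub>M\<^esub> a \<oplus>\<^bsub>M\<^esub> e' \<in> module_span R M ?B"
        using I by blast
      \<comment> \<open>This element of the generated submodule has the same coefficient r at a as
        x, so x - \<open>?w\<close> lies in the intersection generated by B.\<close>
      let ?w = "r \<odot>\<^bsub>M\<^esub> a \<oplus>\<^bsub>M\<^esub> e'"
      have c: "e \<in> carrier M" "e' \<in> carrier M" "r \<odot>\<^bsub>M\<^esub> a \<in> carrier M"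
        using re(2,3) e'(1) E'(1) a by auto
      have eq: "x = ?w \<oplus>\<^bsub>M\<^esub> (e \<oplus>\<^bsub>M\<^esub> \<ominus>\<^bsub>M\<^esub> e')"
      proof -
        have "?w \<oplus>\<^bsub>M\<^esub> (e \<oplus>\<^bsub>M\<^esub> \<ominus>\<^bsub>M\<^esub> e') = r \<odot>\<^bsub>M\<^esub> a \<oplus>\<^bsub>M\<^esub> e \<oplus>\<^bsub>M\<^esub> (e' \<oplus>\<^bsub>M\<^esub> \<ominus>\<^bsub>M\<^esub> e')"
          using c by (simp add: M.a_ac del: M.r_neg)
        then show ?thesis
          using c re(1) by (simp add: M.r_neg)
      qed
      have "e \<oplus>\<^bsub>M\<^esub> \<ominus>\<^bsub>M\<^esub> e' = x \<oplus>\<^bsub>M\<^esub> \<ominus>\<^bsub>M\<^esub> ?w"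
        using c re(1) by (simp add: M.minus_add M.a_ac M.r_neg1 M.r_neg2 M.r_neg)
      moreover have "x \<oplus>\<^bsub>M\<^esub> \<ominus>\<^bsub>M\<^esub> ?w \<in> U"
        using U'(3,5) x e'(2) WU by blast
      ultimately have "e \<oplus>\<^bsub>M\<^esub> \<ominus>\<^bsub>M\<^esub> e' \<in> U"
        by simp
      moreover have "e \<oplus>\<^bsub>M\<^esub> \<ominus>\<^bsub>M\<^esub> e' \<in> ?E"
        using E'(3,5) re(3) e'(1) by blast
      ultimately have "e \<oplus>\<^bsub>M\<^esub> \<ominus>\<^bsub>M\<^esub> e' \<in> module_span R M B"
        unfolding B(3) by (rule IntI)
      then have "e \<oplus>\<^bsub>M\<^esub> \<ominus>\<^bsub>M\<^esub> e' \<in> module_span R M ?B"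
        by (rule subsetD[OF span_mono[OF Un_upper2]])
      then show ?thesis
        unfolding eq using W'(5)[OF e'(2)] by blast
    qed
    then have "module_span R M ?B = U"
      using WU by blast
    then show ?case
      using BU C(1) B(1) by (intro exI[of _ ?B]) auto
  qed
  obtain A where "finite A" "A \<subseteq> E" "module_span R M A = E" "submodule E R M"
    using E unfolding fg_submodule_def by blast
  then show ?thesis
    using fg[of A U] U submoduleE(1) unfolding fg_submodule_def by blast
qed

end

section \<open>Integral elements\<close>

text \<open>The intended \<phi> is the composite R -> R/P -> K, with kernel P. Keeping the scalars
  in R means that being Noetherian and local need not be carried over to R/P.\<close>

locale noetherian_hom = R: cring R + R: noetherian_ring R + K: field K
  for R :: "('r, 'z) ring_scheme" (structure) and K :: "'k ring" +
  fixes \<phi> :: "'r \<Rightarrow> 'k"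
  assumes hom: "\<phi> \<in> ring_hom R K"
begin

lemma \<phi>_simps [simp]:
  "r \<in> carrier R \<Longrightarrow> \<phi> r \<in> carrier K"
  "r \<in> carrier R \<Longrightarrow> s \<in> carrier R \<Longrightarrow> \<phi> (r \<otimes> s) = \<phi> r \<otimes>\<^bsub>K\<^esub> \<phi> s"
  "r \<in> carrier R \<Longrightarrow> s \<in> carrier R \<Longrightarrow> \<phi> (r \<oplus> s) = \<phi> r \<oplus>\<^bsub>K\<^esub> \<phi> s"
  "\<phi> \<one> = \<one>\<^bsub>K\<^esub>"
  using ring_hom_closed[OF hom] ring_hom_mult[OF hom] ring_hom_add[OF hom] ring_hom_one[OF hom]
  by auto

lemma \<phi>_zero [simp]: "\<phi> \<zero> = \<zero>\<^bsub>K\<^esub>"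
  by (rule ring_hom_zero[OF hom R.ring_axioms K.ring_axioms])

lemma \<phi>_minus [simp]: "r \<in> carrier R \<Longrightarrow> \<phi> (\<ominus> r) = \<ominus>\<^bsub>K\<^esub> \<phi> r"
  using \<phi>_simps(3)[of "\<ominus> r" r] by (intro K.minus_equality[symmetric]) (simp_all add: R.l_neg)

definition Kmod :: "('r, 'k) module"
  where "Kmod = \<lparr>carrier = carrier K, monoid.mult = monoid.mult K, one = one K,
    ring.zero = ring.zero K, add = add K, smult = (\<lambda>r x. \<phi> r \<otimes>\<^bsub>K\<^esub> x)\<rparr>"

lemma Kmod_simps [simp]:
  "carrier Kmod = carrier K" "add Kmod = add K" "ring.zero Kmod = ring.zero K"
  "smult Kmod r x = \<phi> r \<otimes>\<^bsub>K\<^esub> x"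
  by (simp_all add: Kmod_def)

sublocale V: module R Kmod
proof (rule moduleI)
  show "abelian_group Kmod"
    by (rule abelian_group_cong[OF K.abelian_group_axioms]) simp_all
qed (simp_all add: R.is_cring K.l_distr K.r_distr K.m_assoc)

abbreviation span :: "'k set \<Rightarrow> 'k set"
  where "span \<equiv> module_span R Kmod"

lemma submoduleK:
  assumes "submodule U R Kmod"
  shows "U \<subseteq> carrier K" and "\<zero>\<^bsub>K\<^esub> \<in> U"
    and "x \<in> U \<Longrightarrow> y \<in> U \<Longrightarrow> x \<oplus>\<^bsub>K\<^esub> y \<in> U"
    and "r \<in> carrier R \<Longrightarrow> x \<in> U \<Longrightarrow> \<phi> r \<otimes>\<^bsub>K\<^esub> x \<in> U"
    and "x \<in> U \<Longrightarrow> \<ominus>\<^bsub>K\<^esub> x \<in> U"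
proof -
  show s: "U \<subseteq> carrier K" and "\<zero>\<^bsub>K\<^esub> \<in> U"
    and "x \<in> U \<Longrightarrow> y \<in> U \<Longrightarrow> x \<oplus>\<^bsub>K\<^esub> y \<in> U"
    and m: "r \<in> carrier R \<Longrightarrow> x \<in> U \<Longrightarrow> \<phi> r \<otimes>\<^bsub>K\<^esub> x \<in> U" for r x y
    using V.submoduleE[OF assms] V.submodule_zero[OF assms] by simp_all
  show "x \<in> U \<Longrightarrow> \<ominus>\<^bsub>K\<^esub> x \<in> U"
    using m[of "\<ominus> \<one>" x] s by (auto simp: K.l_minus)
qed

lemma submoduleKI:
  assumes "U \<subseteq> carrier K" and "\<zero>\<^bsub>K\<^esub> \<in> U"
    and "\<And>x y. x \<in> U \<Longrightarrow> y \<in> U \<Longrightarrow> x \<oplus>\<^bsub>K\<^esub> y \<in> U"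
    and m: "\<And>r x. r \<in> carrier R \<Longrightarrow> x \<in> U \<Longrightarrow> \<phi> r \<otimes>\<^bsub>K\<^esub> x \<in> U"
  shows "submodule U R Kmod"
proof (rule V.submoduleI)
  show "\<ominus>\<^bsub>Kmod\<^esub> x \<in> U" if "x \<in> U" for x
    using m[of "\<ominus> \<one>" x] that assms(1) V.smult_l_minus[of \<one> x] by auto
qed (use assms in simp_all)

text \<open>Together with \<open>span_minimal\<close> this extends a statement "c times a generator
  lies in U" to the whole span.\<close>

lemma submodule_vimage_mult:
  assumes U: "submodule U R Kmod" and c: "c \<in> carrier K"
  shows "submodule {z \<in> carrier K. c \<otimes>\<^bsub>K\<^esub> z \<in> U} R Kmod"
proof (rule submoduleKI)
  fix r x assume r: "r \<in> carrier R" and "x \<in> {z \<in> carrier K. c \<otimes>\<^bsub>K\<^esub> z \<in> U}"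
  then have "\<phi> r \<otimes>\<^bsub>K\<^esub> (c \<otimes>\<^bsub>K\<^esub> x) \<in> U" "x \<in> carrier K"
    using submoduleK(4)[OF U] by auto
  then show "\<phi> r \<otimes>\<^bsub>K\<^esub> x \<in> {z \<in> carrier K. c \<otimes>\<^bsub>K\<^esub> z \<in> U}"
    using r c by (simp add: K.m_lcomm)
qed (use submoduleK(2,3)[OF U] c in \<open>auto simp: K.r_distr\<close>)

text \<open>Integrality by a stable finitely generated module makes sums and products easy; the Noetherian
  hypothesis is what recovers a monic equation from it.\<close>

definition integral :: "'k \<Rightarrow> bool"
  where "integral x \<longleftrightarrow> x \<in> carrier K \<and>
    (\<exists>E. fg_submodule R Kmod E \<and> \<one>\<^bsub>K\<^esub> \<in> E \<and> (\<forall>e\<in>E. x \<otimes>\<^bsub>K\<^esub> e \<in> E))"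

text \<open>The product module D E, spanned by the products of generators, is stable under x through
  its left factor and under y through its right factor. Sums and products of x and y then act on one
  and the same module.\<close>

lemma common_module:
  assumes "integral x" and "integral y"
  obtains E where "fg_submodule R Kmod E" "\<one>\<^bsub>K\<^esub> \<in> E"
    "\<And>e. e \<in> E \<Longrightarrow> x \<otimes>\<^bsub>K\<^esub> e \<in> E" "\<And>e. e \<in> E \<Longrightarrow> y \<otimes>\<^bsub>K\<^esub> e \<in> E"
proof -
  have x: "x \<in> carrier K" and y: "y \<in> carrier K"
    using assms by (auto simp: integral_def)
  obtain D E where D: "fg_submodule R Kmod D" "\<one>\<^bsub>K\<^esub> \<in> D" "\<And>e. e \<in> D \<Longrightarrow> x \<otimes>\<^bsub>K\<^esub> e \<in> D"
    and E: "fg_submodule R Kmod E" "\<one>\<^bsub>K\<^esub> \<in> E" "\<And>e. e \<in> E \<Longrightarrow> y \<otimes>\<^bsub>K\<^esub> e \<in> E"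
    using assms unfolding integral_def by blast
  obtain A B where A: "finite A" "A \<subseteq> D" "span A = D" and B: "finite B" "B \<subseteq> E" "span B = E"
    using D(1) E(1) unfolding fg_submodule_def by blast
  have Dc: "D \<subseteq> carrier K" and Ec: "E \<subseteq> carrier K"
    using D(1) E(1) submoduleK(1) unfolding fg_submodule_def by auto
  let ?P = "(\<lambda>(a, b). a \<otimes>\<^bsub>K\<^esub> b) ` (A \<times> B)"
  have ABc: "a \<in> carrier K" "b \<in> carrier K" if "a \<in> A" "b \<in> B" for a b
    using that A(2) B(2) Dc Ec by auto
  then have Pc: "?P \<subseteq> carrier Kmod"
    by auto
  note W = V.span_submodule[OF Pc]
  have aB: "a \<otimes>\<^bsub>K\<^esub> e \<in> span ?P" if a: "a \<in> A" and e: "e \<in> E" for a e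
  proof -
    have ac: "a \<in> carrier K"
      using a A(2) Dc by blast
    have "B \<subseteq> {z \<in> carrier K. a \<otimes>\<^bsub>K\<^esub> z \<in> span ?P}"
      using a B(2) Ec subsetD[OF V.span_superset, of _ ?P] by auto
    then have "E \<subseteq> {z \<in> carrier K. a \<otimes>\<^bsub>K\<^esub> z \<in> span ?P}"
      using V.span_minimal[OF submodule_vimage_mult[OF W ac]] B(3) by blast
    then show ?thesis
      using e by blast
  qed
  \<comment> \<open>Bilinearity is used one factor at a time: the right entry has been freed
    already, now the left one is, with commutativity exchanging the roles.\<close>
  have DE: "d \<otimes>\<^bsub>K\<^esub> e \<in> span ?P" if d: "d \<in> D" and e: "e \<in> E" for d e
  proof -
    have ec: "e \<in> carrier K"
      using e Ec by blast
    have "A \<subseteq> {z \<in> carrier K. e \<otimes>\<^bsub>K\<^esub> z \<in> span ?P}"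
      using aB[OF _ e] A(2) Dc ec K.m_comm by fastforce
    then have "D \<subseteq> {z \<in> carrier K. e \<otimes>\<^bsub>K\<^esub> z \<in> span ?P}"
      using V.span_minimal[OF submodule_vimage_mult[OF W ec]] A(3) by blast
    then show ?thesis
      using d Dc ec K.m_comm[of d e] by auto
  qed
  have stable: "z \<otimes>\<^bsub>K\<^esub> w \<in> span ?P"
    if "z \<in> carrier K" "\<And>a b. a \<in> A \<Longrightarrow> b \<in> B \<Longrightarrow> z \<otimes>\<^bsub>K\<^esub> (a \<otimes>\<^bsub>K\<^esub> b) \<in> span ?P" "w \<in> span ?P" for z w
  proof -
    have "?P \<subseteq> {w \<in> carrier K. z \<otimes>\<^bsub>K\<^esub> w \<in> span ?P}"
      using that(2) Pc by auto
    then show ?thesis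
      using V.span_minimal[OF submodule_vimage_mult[OF W that(1)]] that(3) by blast
  qed
  show ?thesis
  proof (rule that)
    show "fg_submodule R Kmod (span ?P)"
      using V.fg_submodule_spanI[OF _ Pc] A(1) B(1) by simp
    show "\<one>\<^bsub>K\<^esub> \<in> span ?P"
      using DE[OF D(2) E(2)] by simp
    show "x \<otimes>\<^bsub>K\<^esub> e \<in> span ?P" if "e \<in> span ?P" for e
    proof (rule stable[OF x _ that])
      fix a b assume ab: "a \<in> A" "b \<in> B"
      then have "x \<otimes>\<^bsub>K\<^esub> (a \<otimes>\<^bsub>K\<^esub> b) = (x \<otimes>\<^bsub>K\<^esub> a) \<otimes>\<^bsub>K\<^esub> b"
        using x A(2) B(2) Dc Ec by (simp add: K.m_assoc subset_iff)
      moreover have "x \<otimes>\<^bsub>K\<^esub> a \<in> D" "b \<in> E"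
        using D(3) ab A(2) B(2) by auto
      ultimately show "x \<otimes>\<^bsub>K\<^esub> (a \<otimes>\<^bsub>K\<^esub> b) \<in> span ?P"
        using DE by simp
    qed
    show "y \<otimes>\<^bsub>K\<^esub> e \<in> span ?P" if "e \<in> span ?P" for e
    proof (rule stable[OF y _ that])
      fix a b assume ab: "a \<in> A" "b \<in> B"
      then have "y \<otimes>\<^bsub>K\<^esub> (a \<otimes>\<^bsub>K\<^esub> b) = a \<otimes>\<^bsub>K\<^esub> (y \<otimes>\<^bsub>K\<^esub> b)"
        using y A(2) B(2) Dc Ec by (simp add: K.m_lcomm subset_iff)
      moreover have "y \<otimes>\<^bsub>K\<^esub> b \<in> E" "a \<in> D"
        using E(3) ab A(2) B(2) by auto
      ultimately show "y \<otimes>\<^bsub>K\<^esub> (a \<otimes>\<^bsub>K\<^esub> b) \<in> span ?P"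
        using DE by simp
    qed
  qed
qed

lemma integral_add:
  assumes "integral x" and "integral y"
  shows "integral (x \<oplus>\<^bsub>K\<^esub> y)"
proof -
  obtain E where E: "fg_submodule R Kmod E" "\<one>\<^bsub>K\<^esub> \<in> E"
    "\<And>e. e \<in> E \<Longrightarrow> x \<otimes>\<^bsub>K\<^esub> e \<in> E" "\<And>e. e \<in> E \<Longrightarrow> y \<otimes>\<^bsub>K\<^esub> e \<in> E"
    using common_module[OF assms] by blast
  have sE: "submodule E R Kmod"
    using E(1) unfolding fg_submodule_def by blast
  have "(x \<oplus>\<^bsub>K\<^esub> y) \<otimes>\<^bsub>K\<^esub> e \<in> E" if "e \<in> E" for e
    using that assms submoduleK(1,3)[OF sE] E(3,4)
    by (auto simp: integral_def K.l_distr)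
  then show ?thesis
    using assms E(1,2) unfolding integral_def by blast
qed

lemma integral_mult:
  assumes "integral x" and "integral y"
  shows "integral (x \<otimes>\<^bsub>K\<^esub> y)"
proof -
  obtain E where E: "fg_submodule R Kmod E" "\<one>\<^bsub>K\<^esub> \<in> E"
    "\<And>e. e \<in> E \<Longrightarrow> x \<otimes>\<^bsub>K\<^esub> e \<in> E" "\<And>e. e \<in> E \<Longrightarrow> y \<otimes>\<^bsub>K\<^esub> e \<in> E"
    using common_module[OF assms] by blast
  have sE: "submodule E R Kmod"
    using E(1) unfolding fg_submodule_def by blast
  have "(x \<otimes>\<^bsub>K\<^esub> y) \<otimes>\<^bsub>K\<^esub> e \<in> E" if "e \<in> E" for e
    using that assms submoduleK(1)[OF sE] E(3,4)
    by (auto simp: integral_def K.m_assoc)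
  then show ?thesis
    using assms E(1,2) unfolding integral_def by blast
qed

lemma integral_\<phi>:
  assumes r: "r \<in> carrier R"
  shows "integral (\<phi> r)"
proof -
  have 1: "{\<one>\<^bsub>K\<^esub>} \<subseteq> carrier Kmod"
    by simp
  show ?thesis
    unfolding integral_def
    using V.fg_submodule_spanI[OF _ 1] V.span_superset[of "{\<one>\<^bsub>K\<^esub>}"]
      submoduleK(4)[OF V.span_submodule[OF 1] r] r
    by (intro conjI exI[of _ "span {\<one>\<^bsub>K\<^esub>}"]) auto
qed

lemma integral_minus:
  assumes "integral x"
  shows "integral (\<ominus>\<^bsub>K\<^esub> x)"
  using integral_mult[OF integral_\<phi>[of "\<ominus> \<one>"] assms] assms by (simp add: integral_def K.l_minus)

section \<open>From stable modules to monic equations and back\<close>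

lemma eval_in_span:
  assumes "x \<in> carrier K" "set q \<subseteq> \<phi> ` carrier R"
  shows "K.eval q x \<in> span ((\<lambda>i. x [^]\<^bsub>K\<^esub> i) ` {..<length q})"
  using assms(2)
proof (induction q)
  case Nil
  then show ?case
    using submoduleK(2)[OF V.span_submodule[of "{}"]] by simp
next
  case (Cons a q)
  let ?W = "span ((\<lambda>i. x [^]\<^bsub>K\<^esub> i) ` {..<length (a # q)})"
  have W: "submodule ?W R Kmod"
    using assms(1) by (intro V.span_submodule) auto
  have "x [^]\<^bsub>K\<^esub> length q \<in> ?W"
    by (rule subsetD[OF V.span_superset]) simp
  then have "a \<otimes>\<^bsub>K\<^esub> x [^]\<^bsub>K\<^esub> length q \<in> ?W"
    using submoduleK(4)[OF W] Cons.prems by auto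
  moreover have "K.eval q x \<in> ?W"
  proof (rule subsetD[OF V.span_mono])
    show "K.eval q x \<in> span ((\<lambda>i. x [^]\<^bsub>K\<^esub> i) ` {..<length q})"
      using Cons by simp
  qed auto
  ultimately show ?case
    using submoduleK(3)[OF W] by simp
qed

text \<open>The length is exactly n because leading zeros are allowed in q; prefixing 1 therefore
  gives a monic polynomial of degree exactly n.\<close>

lemma span_powers_eval:
  assumes x: "x \<in> carrier K"
  shows "z \<in> span ((\<lambda>i. x [^]\<^bsub>K\<^esub> i) ` {..<n}) \<Longrightarrow>
    \<exists>q. length q = n \<and> set q \<subseteq> \<phi> ` carrier R \<and> K.eval q x = z"
proof (induction n arbitrary: z)
  case 0
  have "span {} \<subseteq> {\<zero>\<^bsub>K\<^esub>}"
    by (rule V.span_minimal[OF submoduleKI]) auto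
  then show ?case
    using 0 by auto
next
  case (Suc n)
  have eq: "(\<lambda>i. x [^]\<^bsub>K\<^esub> i) ` {..<Suc n} =
      insert (x [^]\<^bsub>K\<^esub> n) ((\<lambda>i. x [^]\<^bsub>K\<^esub> i) ` {..<n})"
    by (simp add: lessThan_Suc)
  have c: "x [^]\<^bsub>K\<^esub> n \<in> carrier Kmod" "(\<lambda>i. x [^]\<^bsub>K\<^esub> i) ` {..<n} \<subseteq> carrier Kmod"
    using x by auto
  obtain r e where re: "z = \<phi> r \<otimes>\<^bsub>K\<^esub> x [^]\<^bsub>K\<^esub> n \<oplus>\<^bsub>K\<^esub> e" "r \<in> carrier R"
    "e \<in> span ((\<lambda>i. x [^]\<^bsub>K\<^esub> i) ` {..<n})"
    using Suc.prems unfolding eq V.span_insert[OF c] by auto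
  obtain q where "length q = n" "set q \<subseteq> \<phi> ` carrier R" "K.eval q x = e"
    using Suc.IH[OF re(3)] by blast
  then show ?case
    using re by (intro exI[of _ "\<phi> r # q"]) auto
qed

text \<open>A monic equation of degree n makes the span of the first n powers of x stable under x.
  Conversely, all powers of x lie in the stable module E because 1 does, so the spans of the first n
  powers form an ascending chain inside E; it becomes stationary, and then some power is a
  combination of lower ones.\<close>

lemma integral_closure_in_eq: "integral_closure_in K (\<phi> ` carrier R) = Collect integral"
proof (intro equalityI subsetI)
  fix x assume "x \<in> integral_closure_in K (\<phi> ` carrier R)"
  then obtain f where x: "x \<in> carrier K" and f: "f \<noteq> []" "polynomial\<^bsub>K\<^esub> (\<phi> ` carrier R) f"
    "lead_coeff f = \<one>\<^bsub>K\<^esub>" "K.eval f x = \<zero>\<^bsub>K\<^esub>"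
    unfolding integral_closure_in_def by blast
  obtain q where q: "f = \<one>\<^bsub>K\<^esub> # q" "set q \<subseteq> \<phi> ` carrier R"
    using f(1-3) unfolding polynomial_def by (cases f) auto
  let ?n = "length q"
  let ?P = "(\<lambda>i. x [^]\<^bsub>K\<^esub> i) ` {..<?n}"
  have Pc: "?P \<subseteq> carrier Kmod"
    using x by auto
  note W = V.span_submodule[OF Pc]
  have "K.eval q x \<in> span ?P"
    by (rule eval_in_span[OF x q(2)])
  moreover have "x [^]\<^bsub>K\<^esub> ?n \<oplus>\<^bsub>K\<^esub> K.eval q x = \<zero>\<^bsub>K\<^esub>"
    using f(4) q(1) x by simp
  then have "x [^]\<^bsub>K\<^esub> ?n = \<ominus>\<^bsub>K\<^esub> K.eval q x"
    using x K.minus_equality calculation submoduleK(1)[OF W] by (metis K.nat_pow_closed subsetD)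
  ultimately have n: "x [^]\<^bsub>K\<^esub> ?n \<in> span ?P"
    using submoduleK(5)[OF W] by simp
  have pow: "x [^]\<^bsub>K\<^esub> i \<in> span ?P" if "i \<le> ?n" for i
  proof (cases "i = ?n")
    case False
    then show ?thesis
      using that by (intro subsetD[OF V.span_superset]) simp
  qed (use n in simp)
  \<comment> \<open>Multiplication by x raises the exponent; the only power leaving the range is the
    n-th, which the monic equation puts back into the span.\<close>
  have "?P \<subseteq> {z \<in> carrier K. x \<otimes>\<^bsub>K\<^esub> z \<in> span ?P}"
  proof (intro subsetI CollectI conjI; elim imageE)
    fix z i assume "z = x [^]\<^bsub>K\<^esub> i" "i \<in> {..<?n}"
    then show "z \<in> carrier K" "x \<otimes>\<^bsub>K\<^esub> z \<in> span ?P"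
      using x pow[of "Suc i"] K.m_comm[of x z] by simp_all
  qed
  then have "span ?P \<subseteq> {z \<in> carrier K. x \<otimes>\<^bsub>K\<^esub> z \<in> span ?P}"
    by (rule V.span_minimal[OF submodule_vimage_mult[OF W x]])
  moreover have "\<one>\<^bsub>K\<^esub> \<in> span ?P"
    using pow[of 0] by simp
  ultimately show "x \<in> Collect integral"
    using x V.fg_submodule_spanI[OF _ Pc] unfolding integral_def by blast
next
  fix x assume "x \<in> Collect integral"
  then obtain E where x: "x \<in> carrier K" and E: "fg_submodule R Kmod E" "\<one>\<^bsub>K\<^esub> \<in> E"
    "\<And>e. e \<in> E \<Longrightarrow> x \<otimes>\<^bsub>K\<^esub> e \<in> E"
    unfolding integral_def by blast
  have sE: "submodule E R Kmod"
    using E(1) unfolding fg_submodule_def by blast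
  have pE: "x [^]\<^bsub>K\<^esub> (i::nat) \<in> E" for i
  proof (induction i)
    case (Suc i)
    then show ?case
      using E(3)[OF Suc] x by (simp add: K.m_comm)
  qed (use E(2) in simp)
  let ?P = "\<lambda>n. (\<lambda>i. x [^]\<^bsub>K\<^esub> i) ` {..<n::nat}"
  \<comment> \<open>This union is the subring of K generated by x over the image of R.\<close>
  let ?U = "\<Union>n. span (?P n)"
  have Pc: "?P n \<subseteq> carrier Kmod" for n
    using x by auto
  note W = submoduleK[OF V.span_submodule[OF Pc]]
  have mono: "span (?P n) \<subseteq> span (?P k)" if "n \<le> k" for n k
    using that by (intro V.span_mono image_mono) auto
  have "submodule ?U R Kmod"
  proof (rule submoduleKI)
    fix y z assume "y \<in> ?U" "z \<in> ?U"
    then obtain n k where "y \<in> span (?P n)" "z \<in> span (?P k)"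
      by blast
    then have "y \<in> span (?P (max n k))" "z \<in> span (?P (max n k))"
      using mono[of n "max n k"] mono[of k "max n k"] by auto
    then show "y \<oplus>\<^bsub>K\<^esub> z \<in> ?U"
      using W(3) by blast
  next
    fix r y assume r: "r \<in> carrier R" and "y \<in> ?U"
    then obtain n where "y \<in> span (?P n)"
      by blast
    then have "\<phi> r \<otimes>\<^bsub>K\<^esub> y \<in> span (?P n)"
      using W(4) r by blast
    then show "\<phi> r \<otimes>\<^bsub>K\<^esub> y \<in> ?U"
      by blast
  next
    show "?U \<subseteq> carrier K"
      by (intro UN_least W(1))
    show "\<zero>\<^bsub>K\<^esub> \<in> ?U"
      by (rule UN_I[of 0, OF UNIV_I W(2)])
  qed
  moreover have "?U \<subseteq> E"
    by (intro UN_least V.span_minimal[OF sE]) (use pE in auto)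
  ultimately have "fg_submodule R Kmod ?U"
    using V.noetherian_submodule_fg[OF R.noetherian_ring_axioms E(1)] by blast
  then obtain B where B: "finite B" "B \<subseteq> ?U" "span B = ?U"
    unfolding fg_submodule_def by blast
  \<comment> \<open>A finite generating set of the union fits into one member of the chain, which is
    then the whole union.\<close>
  have "\<exists>n. B \<subseteq> span (?P n)"
    using B(1,2)
  proof (induction B rule: finite_induct)
    case (insert b B)
    then obtain n k where "B \<subseteq> span (?P n)" "b \<in> span (?P k)"
      by auto
    then have "insert b B \<subseteq> span (?P (max n k))"
      using mono[of n "max n k"] mono[of k "max n k"] by auto
    then show ?case
      by blast
  qed simp
  then obtain n where "B \<subseteq> span (?P n)"
    by blast
  then have "?U \<subseteq> span (?P n)"
    using V.span_minimal[OF V.span_submodule[OF Pc]] B(3) by blast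
  moreover have "x [^]\<^bsub>K\<^esub> n \<in> span (?P (Suc n))"
    by (rule subsetD[OF V.span_superset]) simp
  ultimately have "\<ominus>\<^bsub>K\<^esub> (x [^]\<^bsub>K\<^esub> n) \<in> span (?P n)"
    using W(5) by blast
  then obtain q where q: "length q = n" "set q \<subseteq> \<phi> ` carrier R" "K.eval q x = \<ominus>\<^bsub>K\<^esub> (x [^]\<^bsub>K\<^esub> n)"
    using span_powers_eval[OF x] by blast
  have one: "\<one>\<^bsub>K\<^esub> \<in> \<phi> ` carrier R"
    by (rule image_eqI[of _ _ \<one>]) simp_all
  have "polynomial\<^bsub>K\<^esub> (\<phi> ` carrier R) (\<one>\<^bsub>K\<^esub> # q)"
    using q(2) one unfolding polynomial_def by simp
  moreover have "K.eval (\<one>\<^bsub>K\<^esub> # q) x = \<zero>\<^bsub>K\<^esub>"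
    using x q(1,3) by (simp add: K.r_neg)
  ultimately show "x \<in> integral_closure_in K (\<phi> ` carrier R)"
    unfolding integral_closure_in_def using x
    by (intro CollectI conjI exI[of _ "\<one>\<^bsub>K\<^esub> # q"]) simp_all
qed

lemma integral_closed: "integral x \<Longrightarrow> x \<in> carrier K"
  by (simp add: integral_def)

text \<open>With \<open>u = 1 - \<phi>(r) t\<close>, multiplying a polynomial relation of degree \<open>n\<close> for \<open>t\<close> by \<open>\<phi>(r)\<^sup>n\<close> and
  replacing \<open>\<phi>(r) t\<close> by \<open>1\<close> shows that the multiples of \<open>u\<close> contain \<open>\<phi>(1 + s)\<close> for some \<open>s \<in> m\<close>.\<close>

lemma integral_one_minus_unit:
  assumes m: "local_ring R m" and r: "r \<in> m" and t: "integral t"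
  shows "\<exists>w. integral w \<and> (\<one>\<^bsub>K\<^esub> \<ominus>\<^bsub>K\<^esub> \<phi> r \<otimes>\<^bsub>K\<^esub> t) \<otimes>\<^bsub>K\<^esub> w = \<one>\<^bsub>K\<^esub>"
proof -
  interpret m: maximalideal m R
    by (rule local_ringD(2)[OF m])
  let ?c = "\<phi> r" and ?u = "\<one>\<^bsub>K\<^esub> \<ominus>\<^bsub>K\<^esub> \<phi> r \<otimes>\<^bsub>K\<^esub> t"
  have rc: "r \<in> carrier R"
    using r m.a_Hcarr by blast
  have tK: "t \<in> carrier K" and cK: "?c \<in> carrier K" and uK: "?u \<in> carrier K"
    using t rc integral_closed by auto
  have cI: "integral ?c"
    by (rule integral_\<phi>[OF rc])
  have pow: "\<exists>w. integral w \<and> (?c \<otimes>\<^bsub>K\<^esub> t) [^]\<^bsub>K\<^esub> (n::nat) = \<one>\<^bsub>K\<^esub> \<oplus>\<^bsub>K\<^esub> ?u \<otimes>\<^bsub>K\<^esub> w" for n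
  proof (induction n)
    case 0
    show ?case
      using uK integral_\<phi>[of \<zero>] by (intro exI[of _ "\<zero>\<^bsub>K\<^esub>"]) simp
  next
    case (Suc n)
    then obtain w where w: "integral w" "(?c \<otimes>\<^bsub>K\<^esub> t) [^]\<^bsub>K\<^esub> n = \<one>\<^bsub>K\<^esub> \<oplus>\<^bsub>K\<^esub> ?u \<otimes>\<^bsub>K\<^esub> w"
      by blast
    have wK: "w \<in> carrier K"
      using w(1) integral_closed by blast
    \<comment> \<open>As \<phi>(r) t = 1 - u, the product (1 + u w)(1 - u) taken as \<phi>(r) t + u
      w \<phi>(r) t equals 1 + u (w \<phi>(r) t - 1).\<close>
    let ?w = "w \<otimes>\<^bsub>K\<^esub> (?c \<otimes>\<^bsub>K\<^esub> t) \<oplus>\<^bsub>K\<^esub> \<ominus>\<^bsub>K\<^esub> \<one>\<^bsub>K\<^esub>"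
    have "integral ?w"
      using integral_add integral_mult integral_minus w(1) cI t integral_\<phi>[of \<one>] by simp
    moreover have "(?c \<otimes>\<^bsub>K\<^esub> t) [^]\<^bsub>K\<^esub> Suc n = \<one>\<^bsub>K\<^esub> \<oplus>\<^bsub>K\<^esub> ?u \<otimes>\<^bsub>K\<^esub> ?w"
      unfolding K.nat_pow_Suc w(2) using tK cK wK by algebra
    ultimately show ?case
      by blast
  qed
  \<comment> \<open>The exponent \<open>length q\<close> exceeds the degree of q by at least one.
    Each coefficient thus keeps a spare factor \<phi>(r) after the powers of t have been paired with
    powers of \<phi>(r), which is why s lands in m.\<close>
  have red: "\<exists>s\<in>m. \<exists>w. integral w \<and>
      ?c [^]\<^bsub>K\<^esub> length q \<otimes>\<^bsub>K\<^esub> K.eval q t = \<phi> s \<oplus>\<^bsub>K\<^esub> ?u \<otimes>\<^bsub>K\<^esub> w"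
    if "set q \<subseteq> \<phi> ` carrier R" for q
    using that
  proof (induction q)
    case Nil
    show ?case
      using uK integral_\<phi>[of \<zero>] m.zero_closed
      by (intro bexI[of _ \<zero>] exI[of _ "\<zero>\<^bsub>K\<^esub>"]) simp_all
  next
    case (Cons b q)
    let ?n = "length q"
    obtain a where a: "a \<in> carrier R" "b = \<phi> a"
      using Cons.prems by auto
    obtain s w where s: "s \<in> m" and w: "integral w"
      and eq: "?c [^]\<^bsub>K\<^esub> ?n \<otimes>\<^bsub>K\<^esub> K.eval q t = \<phi> s \<oplus>\<^bsub>K\<^esub> ?u \<otimes>\<^bsub>K\<^esub> w"
      using Cons by auto
    obtain v where v: "integral v" "(?c \<otimes>\<^bsub>K\<^esub> t) [^]\<^bsub>K\<^esub> ?n = \<one>\<^bsub>K\<^esub> \<oplus>\<^bsub>K\<^esub> ?u \<otimes>\<^bsub>K\<^esub> v"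
      using pow by blast
    have sc: "s \<in> carrier R"
      using s m.a_Hcarr by blast
    have "set q \<subseteq> carrier K"
      using Cons.prems \<phi>_simps(1) by auto
    then have cc: "w \<in> carrier K" "v \<in> carrier K" "\<phi> a \<in> carrier K" "\<phi> s \<in> carrier K"
      "K.eval q t \<in> carrier K" "?c [^]\<^bsub>K\<^esub> ?n \<in> carrier K" "t [^]\<^bsub>K\<^esub> ?n \<in> carrier K"
      using w v(1) a sc cK tK integral_closed K.eval_in_carrier[of q t] Cons.prems by auto
    let ?w = "?c \<otimes>\<^bsub>K\<^esub> \<phi> a \<otimes>\<^bsub>K\<^esub> v \<oplus>\<^bsub>K\<^esub> ?c \<otimes>\<^bsub>K\<^esub> w"
    have "?c [^]\<^bsub>K\<^esub> length (b # q) \<otimes>\<^bsub>K\<^esub> K.eval (b # q) t =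
        (?c [^]\<^bsub>K\<^esub> ?n \<otimes>\<^bsub>K\<^esub> ?c) \<otimes>\<^bsub>K\<^esub> (\<phi> a \<otimes>\<^bsub>K\<^esub> t [^]\<^bsub>K\<^esub> ?n \<oplus>\<^bsub>K\<^esub> K.eval q t)"
      using a by simp
    also have "\<dots> = ?c \<otimes>\<^bsub>K\<^esub> \<phi> a \<otimes>\<^bsub>K\<^esub> (?c [^]\<^bsub>K\<^esub> ?n \<otimes>\<^bsub>K\<^esub> t [^]\<^bsub>K\<^esub> ?n) \<oplus>\<^bsub>K\<^esub>
        ?c \<otimes>\<^bsub>K\<^esub> (?c [^]\<^bsub>K\<^esub> ?n \<otimes>\<^bsub>K\<^esub> K.eval q t)"
      using cc cK by algebra
    also have "\<dots> = ?c \<otimes>\<^bsub>K\<^esub> \<phi> a \<otimes>\<^bsub>K\<^esub> (\<one>\<^bsub>K\<^esub> \<oplus>\<^bsub>K\<^esub> ?u \<otimes>\<^bsub>K\<^esub> v) \<oplus>\<^bsub>K\<^esub> ?c \<otimes>\<^bsub>K\<^esub> (\<phi> s \<oplus>\<^bsub>K\<^esub> ?u \<otimes>\<^bsub>K\<^esub> w)"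
      unfolding eq v(2)[symmetric] using cK tK by (simp add: K.nat_pow_distrib)
    also have "\<dots> = (?c \<otimes>\<^bsub>K\<^esub> \<phi> a \<oplus>\<^bsub>K\<^esub> ?c \<otimes>\<^bsub>K\<^esub> \<phi> s) \<oplus>\<^bsub>K\<^esub> ?u \<otimes>\<^bsub>K\<^esub> ?w"
      using cc cK uK by algebra
    also have "?c \<otimes>\<^bsub>K\<^esub> \<phi> a \<oplus>\<^bsub>K\<^esub> ?c \<otimes>\<^bsub>K\<^esub> \<phi> s = \<phi> (r \<otimes> a \<oplus> r \<otimes> s)"
      using rc a(1) sc by simp
    finally have "?c [^]\<^bsub>K\<^esub> length (b # q) \<otimes>\<^bsub>K\<^esub> K.eval (b # q) t =
      \<phi> (r \<otimes> a \<oplus> r \<otimes> s) \<oplus>\<^bsub>K\<^esub> ?u \<otimes>\<^bsub>K\<^esub> ?w" .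
    moreover have "r \<otimes> a \<oplus> r \<otimes> s \<in> m"
      using r a(1) sc m.I_r_closed by (intro m.a_closed) auto
    moreover have "integral ?w"
      using integral_add integral_mult cI integral_\<phi>[OF a(1)] v(1) w by simp
    ultimately show ?case
      by blast
  qed
  have "t \<in> integral_closure_in K (\<phi> ` carrier R)"
    using t by (simp add: integral_closure_in_eq)
  then obtain f where f: "f \<noteq> []" "polynomial\<^bsub>K\<^esub> (\<phi> ` carrier R) f"
    "lead_coeff f = \<one>\<^bsub>K\<^esub>" "K.eval f t = \<zero>\<^bsub>K\<^esub>"
    unfolding integral_closure_in_def by blast
  obtain q where q: "f = \<one>\<^bsub>K\<^esub> # q" "set q \<subseteq> \<phi> ` carrier R"
    using f(1-3) unfolding polynomial_def by (cases f) auto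
  let ?n = "length q"
  have tq: "t [^]\<^bsub>K\<^esub> ?n \<oplus>\<^bsub>K\<^esub> K.eval q t = \<zero>\<^bsub>K\<^esub>"
    using f(4) q(1) tK by simp
  obtain s w where s: "s \<in> m" and w: "integral w"
    and eq: "?c [^]\<^bsub>K\<^esub> ?n \<otimes>\<^bsub>K\<^esub> K.eval q t = \<phi> s \<oplus>\<^bsub>K\<^esub> ?u \<otimes>\<^bsub>K\<^esub> w"
    using red[OF q(2)] by blast
  obtain v where v: "integral v" "(?c \<otimes>\<^bsub>K\<^esub> t) [^]\<^bsub>K\<^esub> ?n = \<one>\<^bsub>K\<^esub> \<oplus>\<^bsub>K\<^esub> ?u \<otimes>\<^bsub>K\<^esub> v"
    using pow by blast
  have sc: "s \<in> carrier R"
    using s m.a_Hcarr by blast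
  have "set q \<subseteq> carrier K"
    using q(2) \<phi>_simps(1) by auto
  then have cc: "w \<in> carrier K" "v \<in> carrier K" "\<phi> s \<in> carrier K"
    "K.eval q t \<in> carrier K" "?c [^]\<^bsub>K\<^esub> ?n \<in> carrier K" "t [^]\<^bsub>K\<^esub> ?n \<in> carrier K"
    using w v(1) sc cK tK integral_closed K.eval_in_carrier[of q t] q(2) by auto
  \<comment> \<open>The leading term of the scaled monic equation contributes 1 and the lower terms
    contribute \<phi> s, both modulo multiples of u.\<close>
  have "\<zero>\<^bsub>K\<^esub> = ?c [^]\<^bsub>K\<^esub> ?n \<otimes>\<^bsub>K\<^esub> (t [^]\<^bsub>K\<^esub> ?n \<oplus>\<^bsub>K\<^esub> K.eval q t)"
    using tq cc by simp
  also have "\<dots> = (?c \<otimes>\<^bsub>K\<^esub> t) [^]\<^bsub>K\<^esub> ?n \<oplus>\<^bsub>K\<^esub> ?c [^]\<^bsub>K\<^esub> ?n \<otimes>\<^bsub>K\<^esub> K.eval q t"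
    using cc cK tK by (simp add: K.nat_pow_distrib K.r_distr)
  also have "\<dots> = (\<one>\<^bsub>K\<^esub> \<oplus>\<^bsub>K\<^esub> ?u \<otimes>\<^bsub>K\<^esub> v) \<oplus>\<^bsub>K\<^esub> (\<phi> s \<oplus>\<^bsub>K\<^esub> ?u \<otimes>\<^bsub>K\<^esub> w)"
    unfolding eq v(2) ..
  finally have z: "\<zero>\<^bsub>K\<^esub> = (\<one>\<^bsub>K\<^esub> \<oplus>\<^bsub>K\<^esub> ?u \<otimes>\<^bsub>K\<^esub> v) \<oplus>\<^bsub>K\<^esub> (\<phi> s \<oplus>\<^bsub>K\<^esub> ?u \<otimes>\<^bsub>K\<^esub> w)" .
  have "?u \<otimes>\<^bsub>K\<^esub> (\<ominus>\<^bsub>K\<^esub> (v \<oplus>\<^bsub>K\<^esub> w)) = (\<one>\<^bsub>K\<^esub> \<oplus>\<^bsub>K\<^esub> \<phi> s) \<ominus>\<^bsub>K\<^esub>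
      ((\<one>\<^bsub>K\<^esub> \<oplus>\<^bsub>K\<^esub> ?u \<otimes>\<^bsub>K\<^esub> v) \<oplus>\<^bsub>K\<^esub> (\<phi> s \<oplus>\<^bsub>K\<^esub> ?u \<otimes>\<^bsub>K\<^esub> w))"
    using cc uK by algebra
  then have u: "?u \<otimes>\<^bsub>K\<^esub> (\<ominus>\<^bsub>K\<^esub> (v \<oplus>\<^bsub>K\<^esub> w)) = \<phi> (\<one> \<oplus> s)"
    unfolding z[symmetric] using cc sc by (simp add: a_minus_def)
  \<comment> \<open>Since -s also lies in m, the Jacobson radical of R, the element 1 + s is
    invertible in R, and the image of its inverse is integral.\<close>
  have "\<one> \<ominus> (\<ominus> s) \<in> Units R"
    using s local_ringD(4)[OF m] m.a_inv_closed by (intro R.one_minus_jacobson_radical_Units) simp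
  then have U: "\<one> \<oplus> s \<in> Units R"
    using sc by (simp add: a_minus_def)
  let ?i = "inv (\<one> \<oplus> s)"
  have i: "?i \<in> carrier R"
    using U by simp
  have "?u \<otimes>\<^bsub>K\<^esub> (\<ominus>\<^bsub>K\<^esub> (v \<oplus>\<^bsub>K\<^esub> w) \<otimes>\<^bsub>K\<^esub> \<phi> ?i) = \<phi> ((\<one> \<oplus> s) \<otimes> ?i)"
    using u i sc cc uK by (simp add: K.m_assoc[symmetric])
  also have "\<dots> = \<one>\<^bsub>K\<^esub>"
    using U by simp
  finally show ?thesis
    using integral_mult[OF integral_minus[OF integral_add[OF v(1) w]] integral_\<phi>[OF i]] by blast
qed

end

section \<open>Plus closure\<close>

text \<open>If a were outside a maximal ideal P, then P and a would generate the whole ring, so 1 =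
  p + s a with p in P. But p = 1 - a s is invertible by assumption.\<close>

lemma (in cring) mem_jacobson_radicalI:
  assumes a: "a \<in> carrier R"
    and unit: "\<And>s. s \<in> carrier R \<Longrightarrow> \<exists>w\<in>carrier R. (\<one> \<ominus> a \<otimes> s) \<otimes> w = \<one>"
  shows "a \<in> jacobson_radical R"
proof -
  have "a \<in> P" if P: "maximalideal P R" for P
  proof (rule ccontr)
    assume "a \<notin> P"
    interpret P: maximalideal P R
      by fact
    let ?J = "P <+>\<^bsub>R\<^esub> PIdl a"
    have J: "ideal ?J R"
      by (rule add_ideals[OF P.is_ideal cgenideal_ideal[OF a]])
    have "p \<in> ?J" if "p \<in> P" for p
    proof -
      have "\<zero> \<in> PIdl a"
        using additive_subgroup.zero_closed[OF ideal.axioms(1)[OF cgenideal_ideal[OF a]]] .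
      then show ?thesis
        using that P.a_Hcarr[OF that] r_zero[of p] unfolding set_add_def' by blast
    qed
    moreover have "a \<in> ?J"
      using l_zero[OF a] P.zero_closed cgenideal_self[OF a] unfolding set_add_def' by blast
    moreover have "?J \<subseteq> carrier R"
      using additive_subgroup.a_subset[OF ideal.axioms(1)[OF J]] .
    ultimately have "?J = carrier R"
      using P.I_maximal[OF J] \<open>a \<notin> P\<close> by blast
    then obtain p s where ps: "p \<in> P" "s \<in> carrier R" "\<one> = p \<oplus> s \<otimes> a"
      using one_closed unfolding set_add_def' cgenideal_def by blast
    have pc: "p \<in> carrier R"
      using ps(1) P.a_Hcarr by blast
    obtain w where w: "w \<in> carrier R" "(\<one> \<ominus> a \<otimes> s) \<otimes> w = \<one>"
      using unit ps(2) by blast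
    have "(p \<oplus> s \<otimes> a) \<ominus> a \<otimes> s = p"
      using pc ps(2) a by algebra
    then have "p \<otimes> w = \<one>"
      using w(2) ps(3) by simp
    then have "\<one> \<in> P"
      using P.I_r_closed[OF ps(1) w(1)] by simp
    then show False
      using P.one_imp_carrier P.I_notcarr by simp
  qed
  then show ?thesis
    using a unfolding jacobson_radical_def by blast
qed

lemma restrict_eqI:
  assumes "f \<in> Pi\<^sub>E I T" "\<And>i. i \<in> I \<Longrightarrow> g i = f i"
  shows "(\<lambda>i\<in>I. g i) = f"
proof
  show "(\<lambda>i\<in>I. g i) i = f i" for i
    using assms(2) PiE_arb[OF assms(1)] by (cases "i \<in> I") simp_all
qed

locale absolute_integral_closures = cring R + noetherian_ring R
  for R :: "('r, 'z) ring_scheme" (structure) +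
  fixes K :: "'r set \<Rightarrow> 'k ring" and \<iota> :: "'r set \<Rightarrow> 'r set \<Rightarrow> 'k"
  assumes alg_closure:
    "P \<in> minimal_primes R \<Longrightarrow> alg_closure_of_fractions (R Quot P) (K P) (\<iota> P)"
begin

abbreviation I :: "'r set set"
  where "I \<equiv> minimal_primes R"

definition \<phi> :: "'r set \<Rightarrow> 'r \<Rightarrow> 'k"
  where "\<phi> P r = \<iota> P (P +> r)"

definition T :: "'r set \<Rightarrow> 'k set"
  where "T P = integral_closure_in (K P) (\<iota> P ` carrier (R Quot P))"

abbreviation plus_ring :: "('r, 'r set \<Rightarrow> 'k) module"
  where "plus_ring \<equiv> absolute_integral_closure R K \<iota>"

lemma noetherian_hom:
  assumes P: "P \<in> I"
  shows "noetherian_hom R (K P) (\<phi> P)"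
proof -
  have "ideal P R"
    using P unfolding minimal_primes_def primeideal_def by blast
  then have "\<iota> P \<circ> (+>) P \<in> ring_hom R (K P)"
    using ideal.rcos_ring_hom alg_closure[OF P] ring_hom_trans
    unfolding alg_closure_of_fractions_def by blast
  moreover have "\<phi> P = \<iota> P \<circ> (+>) P"
    by (auto simp: \<phi>_def)
  moreover have "field (K P)"
    using alg_closure[OF P] algebraic_closure.axioms(1) unfolding alg_closure_of_fractions_def by blast
  ultimately show ?thesis
    by (intro noetherian_hom.intro noetherian_hom_axioms.intro)
      (simp_all add: cring_axioms noetherian_ring_axioms)
qed

text \<open>R and R/P have the same image in \<open>K P\<close>, so being integral over R/P is being
  integral over R along \<open>\<phi> P\<close>.\<close>

lemma T_eq:
  assumes P: "P \<in> I"
  shows "T P = Collect (noetherian_hom.integral R (K P) (\<phi> P))"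
proof -
  have "carrier (R Quot P) = (+>) P ` carrier R"
    by (auto simp: FactRing_def A_RCOSETS_def')
  then have "\<iota> P ` carrier (R Quot P) = \<phi> P ` carrier R"
    by (simp add: image_image \<phi>_def)
  then show ?thesis
    unfolding T_def by (simp add: noetherian_hom.integral_closure_in_eq[OF noetherian_hom[OF P]])
qed

lemma T_closed:
  assumes P: "P \<in> I"
  shows "x \<in> T P \<Longrightarrow> x \<in> carrier (K P)"
    and "x \<in> T P \<Longrightarrow> y \<in> T P \<Longrightarrow> x \<oplus>\<^bsub>K P\<^esub> y \<in> T P"
    and "x \<in> T P \<Longrightarrow> y \<in> T P \<Longrightarrow> x \<otimes>\<^bsub>K P\<^esub> y \<in> T P"
    and "x \<in> T P \<Longrightarrow> \<ominus>\<^bsub>K P\<^esub> x \<in> T P"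
    and "r \<in> carrier R \<Longrightarrow> \<phi> P r \<in> T P"
    and "\<zero>\<^bsub>K P\<^esub> \<in> T P" and "\<one>\<^bsub>K P\<^esub> \<in> T P"
proof -
  interpret noetherian_hom R "K P" "\<phi> P"
    by (rule noetherian_hom[OF P])
  show "x \<in> T P \<Longrightarrow> x \<in> carrier (K P)"
    and "x \<in> T P \<Longrightarrow> y \<in> T P \<Longrightarrow> x \<oplus>\<^bsub>K P\<^esub> y \<in> T P"
    and "x \<in> T P \<Longrightarrow> y \<in> T P \<Longrightarrow> x \<otimes>\<^bsub>K P\<^esub> y \<in> T P"
    and "x \<in> T P \<Longrightarrow> \<ominus>\<^bsub>K P\<^esub> x \<in> T P"
    and "r \<in> carrier R \<Longrightarrow> \<phi> P r \<in> T P"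
    and "\<zero>\<^bsub>K P\<^esub> \<in> T P" and "\<one>\<^bsub>K P\<^esub> \<in> T P"
    using integral_closed integral_add integral_mult integral_minus integral_\<phi>
      integral_\<phi>[of \<zero>] integral_\<phi>[of \<one>]
    by (simp_all add: T_eq[OF P])
qed

lemma K_cring: "P \<in> I \<Longrightarrow> cring (K P)"
  using noetherian_hom noetherian_hom.axioms(3) fieldE(1) by blast

lemma plus_ring_simps:
  "carrier plus_ring = Pi\<^sub>E I T"
  "f \<otimes>\<^bsub>plus_ring\<^esub> g = (\<lambda>P\<in>I. f P \<otimes>\<^bsub>K P\<^esub> g P)"
  "f \<oplus>\<^bsub>plus_ring\<^esub> g = (\<lambda>P\<in>I. f P \<oplus>\<^bsub>K P\<^esub> g P)"
  "\<one>\<^bsub>plus_ring\<^esub> = (\<lambda>P\<in>I. \<one>\<^bsub>K P\<^esub>)" "\<zero>\<^bsub>plus_ring\<^esub> = (\<lambda>P\<in>I. \<zero>\<^bsub>K P\<^esub>)"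
  "r \<odot>\<^bsub>plus_ring\<^esub> f = (\<lambda>P\<in>I. \<phi> P r \<otimes>\<^bsub>K P\<^esub> f P)"
  by (simp_all add: absolute_integral_closure_def T_def \<phi>_def cong: PiE_cong)

lemma plus_ring_mem: "f \<in> Pi\<^sub>E I T \<Longrightarrow> P \<in> I \<Longrightarrow> f P \<in> T P"
  by (rule PiE_mem)

lemma plus_ring_mem': "f \<in> Pi\<^sub>E I T \<Longrightarrow> P \<in> I \<Longrightarrow> f P \<in> carrier (K P)"
  using plus_ring_mem T_closed(1) by blast

lemma plus_ring_cring: "cring plus_ring"
proof (rule cringI)
  show "abelian_group plus_ring"
  proof (rule abelian_groupI, unfold plus_ring_simps)
    fix f g h assume f: "f \<in> Pi\<^sub>E I T" and g: "g \<in> Pi\<^sub>E I T" and h: "h \<in> Pi\<^sub>E I T"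
    show "(\<lambda>P\<in>I. f P \<oplus>\<^bsub>K P\<^esub> g P) \<in> Pi\<^sub>E I T"
      using f g by (simp add: T_closed plus_ring_mem)
    show "(\<lambda>P\<in>I. (\<lambda>P\<in>I. f P \<oplus>\<^bsub>K P\<^esub> g P) P \<oplus>\<^bsub>K P\<^esub> h P) =
        (\<lambda>P\<in>I. f P \<oplus>\<^bsub>K P\<^esub> (\<lambda>P\<in>I. g P \<oplus>\<^bsub>K P\<^esub> h P) P)"
    proof (rule restrict_ext)
      fix P assume P: "P \<in> I"
      interpret K: cring "K P"
        by (rule K_cring[OF P])
      show "(\<lambda>P\<in>I. f P \<oplus>\<^bsub>K P\<^esub> g P) P \<oplus>\<^bsub>K P\<^esub> h P = f P \<oplus>\<^bsub>K P\<^esub> (\<lambda>P\<in>I. g P \<oplus>\<^bsub>K P\<^esub> h P) P"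
        using P f g h by (simp add: K.a_assoc plus_ring_mem')
    qed
    show "(\<lambda>P\<in>I. f P \<oplus>\<^bsub>K P\<^esub> g P) = (\<lambda>P\<in>I. g P \<oplus>\<^bsub>K P\<^esub> f P)"
    proof (rule restrict_ext)
      fix P assume P: "P \<in> I"
      interpret K: cring "K P"
        by (rule K_cring[OF P])
      show "f P \<oplus>\<^bsub>K P\<^esub> g P = g P \<oplus>\<^bsub>K P\<^esub> f P"
        using P f g by (simp add: K.a_comm plus_ring_mem')
    qed
    show "(\<lambda>P\<in>I. (\<lambda>P\<in>I. \<zero>\<^bsub>K P\<^esub>) P \<oplus>\<^bsub>K P\<^esub> f P) = f"
    proof (rule restrict_eqI[OF f])
      fix P assume P: "P \<in> I"
      interpret K: cring "K P"
        by (rule K_cring[OF P])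
      show "(\<lambda>P\<in>I. \<zero>\<^bsub>K P\<^esub>) P \<oplus>\<^bsub>K P\<^esub> f P = f P"
        using P f by (simp add: plus_ring_mem')
    qed
    show "\<exists>g\<in>Pi\<^sub>E I T. (\<lambda>P\<in>I. g P \<oplus>\<^bsub>K P\<^esub> f P) = (\<lambda>P\<in>I. \<zero>\<^bsub>K P\<^esub>)"
    proof (intro bexI restrict_ext)
      show "(\<lambda>P\<in>I. \<ominus>\<^bsub>K P\<^esub> f P) \<in> Pi\<^sub>E I T"
        using f by (simp add: T_closed plus_ring_mem)
      fix P assume P: "P \<in> I"
      interpret K: cring "K P"
        by (rule K_cring[OF P])
      show "(\<lambda>P\<in>I. \<ominus>\<^bsub>K P\<^esub> f P) P \<oplus>\<^bsub>K P\<^esub> f P = \<zero>\<^bsub>K P\<^esub>"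
        using P f by (simp add: K.l_neg plus_ring_mem')
    qed
  next
    show "(\<lambda>P\<in>I. \<zero>\<^bsub>K P\<^esub>) \<in> Pi\<^sub>E I T"
      by (simp add: T_closed)
  qed
  show "Group.comm_monoid plus_ring"
  proof (rule Group.comm_monoidI, unfold plus_ring_simps)
    fix f g h assume f: "f \<in> Pi\<^sub>E I T" and g: "g \<in> Pi\<^sub>E I T" and h: "h \<in> Pi\<^sub>E I T"
    show "(\<lambda>P\<in>I. f P \<otimes>\<^bsub>K P\<^esub> g P) \<in> Pi\<^sub>E I T"
      using f g by (simp add: T_closed plus_ring_mem)
    show "(\<lambda>P\<in>I. (\<lambda>P\<in>I. f P \<otimes>\<^bsub>K P\<^esub> g P) P \<otimes>\<^bsub>K P\<^esub> h P) =
        (\<lambda>P\<in>I. f P \<otimes>\<^bsub>K P\<^esub> (\<lambda>P\<in>I. g P \<otimes>\<^bsub>K P\<^esub> h P) P)"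
    proof (rule restrict_ext)
      fix P assume P: "P \<in> I"
      interpret K: cring "K P"
        by (rule K_cring[OF P])
      show "(\<lambda>P\<in>I. f P \<otimes>\<^bsub>K P\<^esub> g P) P \<otimes>\<^bsub>K P\<^esub> h P = f P \<otimes>\<^bsub>K P\<^esub> (\<lambda>P\<in>I. g P \<otimes>\<^bsub>K P\<^esub> h P) P"
        using P f g h by (simp add: K.m_assoc plus_ring_mem')
    qed
    show "(\<lambda>P\<in>I. f P \<otimes>\<^bsub>K P\<^esub> g P) = (\<lambda>P\<in>I. g P \<otimes>\<^bsub>K P\<^esub> f P)"
    proof (rule restrict_ext)
      fix P assume P: "P \<in> I"
      interpret K: cring "K P"
        by (rule K_cring[OF P])
      show "f P \<otimes>\<^bsub>K P\<^esub> g P = g P \<otimes>\<^bsub>K P\<^esub> f P"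
        using P f g by (simp add: K.m_comm plus_ring_mem')
    qed
    show "(\<lambda>P\<in>I. (\<lambda>P\<in>I. \<one>\<^bsub>K P\<^esub>) P \<otimes>\<^bsub>K P\<^esub> f P) = f"
    proof (rule restrict_eqI[OF f])
      fix P assume P: "P \<in> I"
      interpret K: cring "K P"
        by (rule K_cring[OF P])
      show "(\<lambda>P\<in>I. \<one>\<^bsub>K P\<^esub>) P \<otimes>\<^bsub>K P\<^esub> f P = f P"
        using P f by (simp add: plus_ring_mem')
    qed
  next
    show "(\<lambda>P\<in>I. \<one>\<^bsub>K P\<^esub>) \<in> Pi\<^sub>E I T"
      by (simp add: T_closed)
  qed
  fix f g h assume "f \<in> carrier plus_ring" "g \<in> carrier plus_ring" "h \<in> carrier plus_ring"
  then have fgh: "f \<in> Pi\<^sub>E I T" "g \<in> Pi\<^sub>E I T" "h \<in> Pi\<^sub>E I T"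
    by (simp_all add: plus_ring_simps)
  show "(f \<oplus>\<^bsub>plus_ring\<^esub> g) \<otimes>\<^bsub>plus_ring\<^esub> h = f \<otimes>\<^bsub>plus_ring\<^esub> h \<oplus>\<^bsub>plus_ring\<^esub> g \<otimes>\<^bsub>plus_ring\<^esub> h"
    unfolding plus_ring_simps
  proof (rule restrict_ext)
    fix P assume P: "P \<in> I"
    interpret K: cring "K P"
      by (rule K_cring[OF P])
    show "(\<lambda>P\<in>I. f P \<oplus>\<^bsub>K P\<^esub> g P) P \<otimes>\<^bsub>K P\<^esub> h P =
        (\<lambda>P\<in>I. f P \<otimes>\<^bsub>K P\<^esub> h P) P \<oplus>\<^bsub>K P\<^esub> (\<lambda>P\<in>I. g P \<otimes>\<^bsub>K P\<^esub> h P) P"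
      using P fgh by (simp add: K.l_distr plus_ring_mem')
  qed
qed

text \<open>The structure map of the product ring, restricted to the minimal primes because the
  carrier consists of extensional functions.\<close>

definition \<Phi> :: "'r \<Rightarrow> 'r set \<Rightarrow> 'k"
  where "\<Phi> r = (\<lambda>P\<in>I. \<phi> P r)"

lemma plus_ring_smult: "r \<odot>\<^bsub>plus_ring\<^esub> f = \<Phi> r \<otimes>\<^bsub>plus_ring\<^esub> f"
  by (auto simp: plus_ring_simps \<Phi>_def)

lemma \<Phi>_ring_hom: "\<Phi> \<in> ring_hom R plus_ring"
proof (rule ring_hom_memI)
  fix r s assume rs: "r \<in> carrier R" "s \<in> carrier R"
  show "\<Phi> r \<in> carrier plus_ring"
    using rs by (simp add: plus_ring_simps \<Phi>_def T_closed)
  show "\<Phi> (r \<otimes> s) = \<Phi> r \<otimes>\<^bsub>plus_ring\<^esub> \<Phi> s" "\<Phi> (r \<oplus> s) = \<Phi> r \<oplus>\<^bsub>plus_ring\<^esub> \<Phi> s"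
    using rs by (auto simp: plus_ring_simps \<Phi>_def noetherian_hom.\<phi>_simps(2,3)[OF noetherian_hom]
        intro!: restrict_ext)
next
  show "\<Phi> \<one> = \<one>\<^bsub>plus_ring\<^esub>"
    by (auto simp: plus_ring_simps \<Phi>_def noetherian_hom.\<phi>_simps(4)[OF noetherian_hom]
        intro!: restrict_ext)
qed

lemma plus_ring_algebra: "algebra R plus_ring"
proof -
  interpret S: cring plus_ring
    by (rule plus_ring_cring)
  note h = ring_hom_closed[OF \<Phi>_ring_hom] ring_hom_mult[OF \<Phi>_ring_hom]
    ring_hom_add[OF \<Phi>_ring_hom] ring_hom_one[OF \<Phi>_ring_hom]
  show ?thesis
    by (rule algebraI)
      (simp_all add: is_cring S.is_cring plus_ring_smult h S.l_distr S.r_distr S.m_assoc)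
qed

text \<open>Invertibility in a product is decided in each factor. The inverses of 1 - \<phi>(r) s(P)
  supplied by integrality are chosen for every P and assembled into one function.\<close>

lemma maximal_ideal_image_in_jacobson_radical:
  assumes m: "local_ring R m" and r: "r \<in> m"
  shows "\<Phi> r \<in> jacobson_radical plus_ring"
proof -
  interpret S: cring plus_ring
    by (rule plus_ring_cring)
  have rc: "r \<in> carrier R"
    using r local_ringD(3)[OF m] by blast
  have \<Phi>r: "\<Phi> r \<in> carrier plus_ring"
    using ring_hom_closed[OF \<Phi>_ring_hom rc] .
  show ?thesis
  proof (rule S.mem_jacobson_radicalI[OF \<Phi>r])
    fix s assume s: "s \<in> carrier plus_ring"
    then have sT: "s P \<in> T P" if "P \<in> I" for P
      using that by (simp add: plus_ring_simps plus_ring_mem)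
    have "\<exists>w. w \<in> T P \<and> (\<one>\<^bsub>K P\<^esub> \<ominus>\<^bsub>K P\<^esub> \<phi> P r \<otimes>\<^bsub>K P\<^esub> s P) \<otimes>\<^bsub>K P\<^esub> w = \<one>\<^bsub>K P\<^esub>" if P: "P \<in> I" for P
      using noetherian_hom.integral_one_minus_unit[OF noetherian_hom[OF P] m r] sT[OF P]
      by (simp add: T_eq[OF P])
    then obtain w where w: "\<And>P. P \<in> I \<Longrightarrow> w P \<in> T P"
      "\<And>P. P \<in> I \<Longrightarrow> (\<one>\<^bsub>K P\<^esub> \<ominus>\<^bsub>K P\<^esub> \<phi> P r \<otimes>\<^bsub>K P\<^esub> s P) \<otimes>\<^bsub>K P\<^esub> w P = \<one>\<^bsub>K P\<^esub>"
      by metis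
    let ?w = "\<lambda>P\<in>I. w P" and ?x = "\<lambda>P\<in>I. \<phi> P r \<otimes>\<^bsub>K P\<^esub> s P"
    have x: "?x \<in> carrier plus_ring" "(\<lambda>P\<in>I. \<ominus>\<^bsub>K P\<^esub> ?x P) \<in> carrier plus_ring"
      using rc sT by (simp_all add: plus_ring_simps T_closed)
    have "\<Phi> r \<otimes>\<^bsub>plus_ring\<^esub> s = ?x"
      by (auto simp: plus_ring_simps \<Phi>_def)
    moreover have "\<ominus>\<^bsub>plus_ring\<^esub> ?x = (\<lambda>P\<in>I. \<ominus>\<^bsub>K P\<^esub> ?x P)"
    proof (rule S.minus_equality[OF _ x])
      show "(\<lambda>P\<in>I. \<ominus>\<^bsub>K P\<^esub> ?x P) \<oplus>\<^bsub>plus_ring\<^esub> ?x = \<zero>\<^bsub>plus_ring\<^esub>"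
        unfolding plus_ring_simps
      proof (rule restrict_ext)
        fix P assume P: "P \<in> I"
        interpret K: cring "K P"
          by (rule K_cring[OF P])
        show "(\<lambda>P\<in>I. \<ominus>\<^bsub>K P\<^esub> ?x P) P \<oplus>\<^bsub>K P\<^esub> ?x P = \<zero>\<^bsub>K P\<^esub>"
          using P T_closed(1)[OF P sT[OF P]] T_closed(1)[OF P T_closed(5)[OF P rc]]
          by (simp add: K.l_neg)
      qed
    qed
    ultimately have "(\<one>\<^bsub>plus_ring\<^esub> \<ominus>\<^bsub>plus_ring\<^esub> \<Phi> r \<otimes>\<^bsub>plus_ring\<^esub> s) \<otimes>\<^bsub>plus_ring\<^esub> ?w = \<one>\<^bsub>plus_ring\<^esub>"
      using w(2) by (auto simp: a_minus_def plus_ring_simps intro!: restrict_ext)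
    moreover have "?w \<in> carrier plus_ring"
      using w(1) by (simp add: plus_ring_simps)
    ultimately show "\<exists>w\<in>carrier plus_ring.
        (\<one>\<^bsub>plus_ring\<^esub> \<ominus>\<^bsub>plus_ring\<^esub> \<Phi> r \<otimes>\<^bsub>plus_ring\<^esub> s) \<otimes>\<^bsub>plus_ring\<^esub> w = \<one>\<^bsub>plus_ring\<^esub>"
      by blast
  qed
qed

theorem nakayama_closure_plus:
  assumes m: "local_ring R m"
  shows "nakayama_closure R m (plus_closure R K \<iota> :: ('r, 'm) closure_op)"
proof -
  interpret S: cring plus_ring
    by (rule plus_ring_cring)
  have "r \<odot>\<^bsub>plus_ring\<^esub> \<one>\<^bsub>plus_ring\<^esub> \<in> jacobson_radical plus_ring" if r: "r \<in> m" for r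
  proof -
    have "r \<in> carrier R"
      using r local_ringD(3)[OF m] by blast
    then have "r \<odot>\<^bsub>plus_ring\<^esub> \<one>\<^bsub>plus_ring\<^esub> = \<Phi> r"
      using ring_hom_closed[OF \<Phi>_ring_hom] by (simp add: plus_ring_smult)
    then show ?thesis
      using maximal_ideal_image_in_jacobson_radical[OF m r] by simp
  qed
  then show ?thesis
    unfolding plus_closure_def
    by (intro nakayama_closure_algebra[OF plus_ring_algebra S.jacobson_radical_ideal
          S.one_minus_jacobson_radical_Units local_ringD(3)[OF m]]) auto
qed

end

theorem theoremB:
  fixes R :: "'r ring" and m :: "'r set"
    and S :: "('r, 's) module" and N :: "('s, 'n) module"
    and p :: nat
    and K :: "'r set \<Rightarrow> 'k ring" and \<iota> :: "'r set \<Rightarrow> 'r set \<Rightarrow> 'k"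
    and B :: "('r, 'b) module" and n :: "'b set"
  assumes "noetherian_ring R" and "local_ring R m"
  shows
    "(algebra R S \<and> set_smult R S m (carrier S) \<subseteq> jacobson_radical S \<longrightarrow>
        nakayama_closure R m (module_closure R S :: ('r, 'm) closure_op)) \<and>
     (algebra R S \<and> set_smult R S m (carrier S) \<subseteq> jacobson_radical S \<and>
        (\<exists>q. local_ring S q) \<and> fg_module S N \<longrightarrow>
        nakayama_closure R m
          (module_closure R (restrict_scalars S N) :: ('r, 'm) closure_op)) \<and>
     (Factorial_Ring.prime p \<and> has_characteristic R p \<longrightarrow>
        nakayama_closure R m (frobenius_closure R p :: ('r, 'm) closure_op)) \<and>
     (adic_complete R m \<and>
        (\<forall>P \<in> minimal_primes R. alg_closure_of_fractions (R Quot P) (K P) (\<iota> P)) \<longrightarrow>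
        nakayama_closure R m (plus_closure R K \<iota> :: ('r, 'm) closure_op)) \<and>
     (big_CM_algebra R m B \<and> local_ring B n \<and> (\<lambda>r. r \<odot>\<^bsub>B\<^esub> \<one>\<^bsub>B\<^esub>) ` m \<subseteq> n \<longrightarrow>
        nakayama_closure R m (module_closure R B :: ('r, 'm) closure_op))"
proof (intro conjI impI; (elim conjE)?)
  note m = local_ringD[OF assms(2)]
  have J: "ideal (jacobson_radical C) C"
    "\<And>a. a \<in> jacobson_radical C \<Longrightarrow> \<one>\<^bsub>C\<^esub> \<ominus>\<^bsub>C\<^esub> a \<in> Units C"
    if "algebra R C" for C :: "('r, 'c) module"
    using cring.jacobson_radical_ideal[of C] cring.one_minus_jacobson_radical_Units[of C]
      algebra.M_cring[OF that] by auto
  have S: "(\<lambda>r. r \<odot>\<^bsub>S\<^esub> \<one>\<^bsub>S\<^esub>) ` m \<subseteq> jacobson_radical S"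
    if "algebra R S" "set_smult R S m (carrier S) \<subseteq> jacobson_radical S"
    using smult_one_in_set_smult[OF that(1)] that(2) by blast
  show "nakayama_closure R m (module_closure R S :: ('r, 'm) closure_op)"
    if "algebra R S" "set_smult R S m (carrier S) \<subseteq> jacobson_radical S"
    by (rule nakayama_closure_algebra[OF that(1) J[OF that(1)] m(3) S[OF that]])
  show "nakayama_closure R m (module_closure R (restrict_scalars S N) :: ('r, 'm) closure_op)"
    if "algebra R S" "set_smult R S m (carrier S) \<subseteq> jacobson_radical S" "fg_module S N"
    by (rule nakayama_closure_restrict_scalars[OF that(1,3) J[OF that(1)] m(3) S[OF that(1,2)]])
  show "nakayama_closure R m (frobenius_closure R p :: ('r, 'm) closure_op)"
    if "Factorial_Ring.prime p" "has_characteristic R p"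
  proof -
    interpret char_p_ring R p
      using m(1) that by (intro char_p_ring.intro char_p_ring_axioms.intro)
    show ?thesis
      by (rule nakayama_closure_frobenius[OF assms(2)])
  qed
  show "nakayama_closure R m (plus_closure R K \<iota> :: ('r, 'm) closure_op)"
    if "\<forall>P \<in> minimal_primes R. alg_closure_of_fractions (R Quot P) (K P) (\<iota> P)"
  proof -
    interpret absolute_integral_closures R K \<iota>
      using m(1) assms(1) that
      by (simp add: absolute_integral_closures_def absolute_integral_closures_axioms_def)
    show ?thesis
      by (rule nakayama_closure_plus[OF assms(2)])
  qed
  show "nakayama_closure R m (module_closure R B :: ('r, 'm) closure_op)"
    if "big_CM_algebra R m B" "local_ring B n" "(\<lambda>r. r \<odot>\<^bsub>B\<^esub> \<one>\<^bsub>B\<^esub>) ` m \<subseteq> n"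
  proof -
    have B: "algebra R B"
      using that(1) unfolding big_CM_algebra_def by blast
    \<comment> \<open>As B is local, its Jacobson radical is n, and locality of R -> B is the
      required containment of the image of m.\<close>
    show ?thesis
      using nakayama_closure_algebra[OF B J[OF B] m(3)] local_ringD(4)[OF that(2)] that(3) by simp
  qed
qed

end
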